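(* Let $A$ be a continuous inverse algebra. If $A$ is locally $m$-convex and a Fréchet space, then its unit group $A^\times$ is $L^1$-regular.
   Context: Continuous inverse algebra: a unital associative real (or complex) algebra $A$ with a Hausdorff locally convex vector topology for which the unit group $A^\times\subseteq A$ is open and both the inversion map $A^\times\to A$, $a\mapsto a^{-1}$ and the multiplication $A\times A\to A$ are continuous; then $A^\times$, as an open subset of $A$, is a Lie group modelled on $A$. $A$ is locally $m$-convex if its topology can be defined by a family of submultiplicative seminorms ($q(xy)\le q(x)q(y)$). Conventions. A map $f:U\to F$ from an open subset $U$ of a locally convex space $E$ to a locally convex space $F$ is $C^1$ if it is continuous, $df(x,y)=\lim_{t\to0}t^{-1}(f(x+ty)-f(x))$ ($t$ real) exists for all $(x,y)\in U\times E$, and $df$ is continuous; it is $C^k$ ($k\ge2$) if it is $C^1$ and $df$ is $C^{k-1}$; smooth means $C^k$ for all $k$. Lie groups modelled on locally convex spaces are defined with this notion. $e$ is the neutral element, $L(G)=T_eG$, $g.v=T\lambda_g(v)$ for $v\in TG$, where $\lambda_g(x)=gx$. $L^1$-regularity. Let $E$ be a Fréchet space and $a<b$. $L^1([a,b],E)$ is the Fréchet space of classes $[\gamma]$ (modulo equality almost everywhere) of Borel measurable $\gamma:[a,b]\to E$ with separable image such that $\int_a^bq(\gamma(t))\,dt<\infty$ for every continuous seminorm $q$ on $E$; these integrals are the seminorms defining its topology. $AC_{L^1}([a,b],E)$ is the space of $\eta:[a,b]\to E$ of the form $\eta(t)=\eta(a)+\int_a^t\gamma(s)\,ds$ (weak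 integrals, which exist) with $[\gamma]\in L^1([a,b],E)$; $\eta':=[\gamma]$ is unique, and the space is topologized so that $\eta\mapsto(\eta(a),\eta')\in E\times L^1([a,b],E)$ is an isomorphism of topological vector spaces. If $G$ is a Lie group modelled on $E$, $AC_{L^1}([0,1],G)$ is the set of continuous $\eta:[0,1]\to G$ for which there are $0=t_0<\dots<t_n=1$ and charts $\phi_j:U_j\to V_j\subseteq E$ of $G$ with $\eta([t_{j-1},t_j])\subseteq U_j$ and $\phi_j\circ\eta|_{[t_{j-1},t_j]}\in AC_{L^1}([t_{j-1},t_j],E)$; such $\eta$ is differentiable almost everywhere. It is a group under pointwise multiplication, with the unique Lie group structure such that for each chart $\phi:U\to V$ of $G$ with $e\in U=U^{-1}$, the set of $\eta$ with image in $U$ is open and $\eta\mapsto\phi\circ\eta$ is a $C^\infty$-diffeomorphism from it onto the open set of elements of $AC_{L^1}([0,1],E)$ with image in $V$. $G$ is $L^1$-regular if for each $[\gamma]\in L^1([0,1],L(G))$ there is a (necessarily unique) $\operatorname{Evol}([\gamma]):=\eta\in AC_{L^1}([0,1],G)$ with $\eta(0)=e$ and $\eta'(t)=\eta(t).\gamma(t)$ for almost every $t$, and $\operatorname{Evol}:L^1([0,1],L(G))\to AC_{L^1}([0,1],G)$ is smooth. *)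

theory Defs
  imports "HOL-Analysis.Analysis" "HOL-Algebra.Group" "HOL-Library.Function_Algebras"
begin

section \<open>Locally convex spaces and continuous inverse algebras\<close>

class locally_convex_space = real_vector + topological_group_add + t2_space +
  assumes tendsto_scaleR_Pair: "LIM p (nhds c \<times>\<^sub>F nhds x). fst p *\<^sub>R snd p :> nhds (c *\<^sub>R x)"
    and convex_nhds_zero:
      "open U \<Longrightarrow> 0 \<in> U \<Longrightarrow> \<exists>V. open V \<and> 0 \<in> V \<and> V \<subseteq> U \<and>
        (\<forall>x\<in>V. \<forall>y\<in>V. \<forall>u\<ge>0. \<forall>v\<ge>0. u + v = 1 \<longrightarrow> u *\<^sub>R x + v *\<^sub>R y \<in> V)"

definition (in monoid_mult) mult_monoid :: "'a monoid" where
  "mult_monoid = \<lparr>carrier = UNIV, monoid.mult = (*), one = 1\<rparr>"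

text \<open>
  The sort consisting of \<^class>\<open>real_algebra\<close> and \<^class>\<open>monoid_mult\<close> is that of unital associative
  real algebras; unlike \<^class>\<open>real_algebra_1\<close> it does not exclude the zero algebra.
  Complex algebras are covered by restriction of scalars: submultiplicative complex seminorms are
  submultiplicative real seminorms, and differentiability is defined with real parameters
  in either case.
\<close>

class continuous_inverse_algebra =
  real_algebra + monoid_mult + locally_convex_space + topological_semigroup_mult +
  assumes open_Units: "open (Units mult_monoid)"
    and tendsto_m_inv: "x \<in> Units mult_monoid \<Longrightarrow>
      LIM y nhds x. m_inv mult_monoid y :> nhds (m_inv mult_monoid x)"

definition seminorm :: "('v::real_vector \<Rightarrow> real) \<Rightarrow> bool" where
  "seminorm q \<longleftrightarrow> (\<forall>x y. q (x + y) \<le> q x + q y) \<and> (\<forall>c x. q (c *\<^sub>R x) = \<bar>c\<bar> * q x)"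

text \<open>The topology on \<open>S\<close> defined by a family \<open>Q\<close> of seminorms.\<close>

definition seminorm_topology :: "'v::real_vector set \<Rightarrow> ('v \<Rightarrow> real) set \<Rightarrow> 'v topology" where
  "seminorm_topology S Q = topology (\<lambda>U. U \<subseteq> S \<and>
     (\<forall>x\<in>U. \<exists>F \<epsilon>. finite F \<and> F \<subseteq> Q \<and> 0 < \<epsilon> \<and> {y\<in>S. \<forall>q\<in>F. q (y - x) < \<epsilon>} \<subseteq> U))"

definition locally_m_convex :: "'a::continuous_inverse_algebra itself \<Rightarrow> bool" where
  "locally_m_convex _ \<longleftrightarrow>
     (\<exists>Q. (\<forall>q\<in>Q. seminorm q \<and> (\<forall>x y::'a. q (x * y) \<le> q x * q y)) \<and>
          euclidean = seminorm_topology UNIV Q)"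

definition frechet_space :: "'e::locally_convex_space itself \<Rightarrow> bool" where
  "frechet_space _ \<longleftrightarrow>
     metrizable_space (euclidean :: 'e topology) \<and>
     (\<forall>X :: nat \<Rightarrow> 'e.
        (\<forall>U. open U \<and> 0 \<in> U \<longrightarrow> (\<exists>N. \<forall>m\<ge>N. \<forall>n\<ge>N. X m - X n \<in> U)) \<longrightarrow> convergent X)"


section \<open>Differentiable maps between locally convex spaces\<close>

text \<open>
  Function spaces are linear subspaces of ambient real vector spaces that carry no suitable
  topology of their own.  Therefore, from here on, a locally convex space is given by a topology
  \<open>E :: 'v topology\<close> on a linear subspace \<^term>\<open>topspace E\<close> of a type \<open>'v\<close> of class
  \<^class>\<open>real_vector\<close>.
\<close>

instantiation "fun" :: (type, real_vector) real_vector
begin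

definition scaleR_fun :: "real \<Rightarrow> ('a \<Rightarrow> 'b) \<Rightarrow> 'a \<Rightarrow> 'b" where
  "scaleR_fun c f = (\<lambda>x. c *\<^sub>R f x)"

instance
  by standard (auto simp: scaleR_fun_def fun_eq_iff scaleR_add_right scaleR_add_left)

end

definition has_directional_derivative ::
    "'w topology \<Rightarrow> ('v::real_vector \<Rightarrow> 'w::real_vector) \<Rightarrow> 'v \<Rightarrow> 'v \<Rightarrow> 'w \<Rightarrow> bool" where
  "has_directional_derivative F f x y l \<longleftrightarrow>
     limitin F (\<lambda>t::real. (f (x + t *\<^sub>R y) - f x) /\<^sub>R t) l (at 0)"

definition dir_deriv ::
    "'w topology \<Rightarrow> ('v::real_vector \<Rightarrow> 'w::real_vector) \<Rightarrow> 'v \<Rightarrow> 'v \<Rightarrow> 'w" where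
  "dir_deriv F f x y = (THE l. has_directional_derivative F f x y l)"

text \<open>
  If \<open>f\<close> is defined on a subset of \<open>E\<close>, then \<open>df\<close> is defined on a subset of \<open>E \<times> E\<close>, \<open>d(df)\<close> on a
  subset of \<open>E\<^sup>4\<close>, and so on.  To keep the recursion over \<open>k\<close> within a fixed type, the elements of
  the power \<open>E\<^sup>n\<close> are encoded as the functions \<open>nat \<Rightarrow> 'v\<close> vanishing outside \<open>{..<n}\<close>, and
  \<open>E\<^sup>n \<times> E\<^sup>n\<close> is identified with \<open>E\<^sup>2\<^sup>n\<close> by concatenation.
\<close>

definition power_top :: "nat \<Rightarrow> 'v::real_vector topology \<Rightarrow> (nat \<Rightarrow> 'v) topology" where
  "power_top n E = pullback_topology
     {x. (\<forall>i<n. x i \<in> topspace E) \<and> (\<forall>i\<ge>n. x i = 0)}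
     (\<lambda>x. restrict x {..<n})
     (product_topology (\<lambda>_. E) {..<n})"

definition first_half :: "nat \<Rightarrow> (nat \<Rightarrow> 'v::zero) \<Rightarrow> nat \<Rightarrow> 'v" where
  "first_half n z = (\<lambda>i. if i < n then z i else 0)"

definition second_half :: "nat \<Rightarrow> (nat \<Rightarrow> 'v::zero) \<Rightarrow> nat \<Rightarrow> 'v" where
  "second_half n z = (\<lambda>i. if i < n then z (n + i) else 0)"

primrec Ck_power :: "nat \<Rightarrow> 'v::real_vector topology \<Rightarrow> 'w::real_vector topology \<Rightarrow>
    nat \<Rightarrow> (nat \<Rightarrow> 'v) set \<Rightarrow> ((nat \<Rightarrow> 'v) \<Rightarrow> 'w) \<Rightarrow> bool" where
  "Ck_power 0 E F n U f \<longleftrightarrow> continuous_map (subtopology (power_top n E) U) F f"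
| "Ck_power (Suc k) E F n U f \<longleftrightarrow>
     continuous_map (subtopology (power_top n E) U) F f \<and>
     (\<forall>x\<in>U. \<forall>y\<in>topspace (power_top n E). \<exists>l. has_directional_derivative F f x y l) \<and>
     Ck_power k E F (2 * n)
       {z \<in> topspace (power_top (2 * n) E). first_half n z \<in> U}
       (\<lambda>z. dir_deriv F f (first_half n z) (second_half n z))"

definition Ck_on :: "nat \<Rightarrow> 'v::real_vector topology \<Rightarrow> 'w::real_vector topology \<Rightarrow>
    'v set \<Rightarrow> ('v \<Rightarrow> 'w) \<Rightarrow> bool" where
  "Ck_on k E F U f \<longleftrightarrow> openin E U \<and>
     Ck_power k E F 1 {x \<in> topspace (power_top 1 E). x 0 \<in> U} (\<lambda>x. f (x 0))"

definition smooth_on :: "'v::real_vector topology \<Rightarrow> 'w::real_vector topology \<Rightarrow>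
    'v set \<Rightarrow> ('v \<Rightarrow> 'w) \<Rightarrow> bool" where
  "smooth_on E F U f \<longleftrightarrow> (\<forall>k. Ck_on k E F U f)"


section \<open>Manifolds and Lie groups modelled on locally convex spaces\<close>

text \<open>A chart is given by its domain \<open>U\<close> and a map \<open>\<phi>\<close>, of which only the values on \<open>U\<close> matter.\<close>

type_synonym ('x, 'v) chart = "'x set \<times> ('x \<Rightarrow> 'v)"

definition compatible :: "'v::real_vector topology \<Rightarrow> ('x, 'v) chart \<Rightarrow> ('x, 'v) chart \<Rightarrow> bool" where
  "compatible E c d = (case (c, d) of ((U, \<phi>), (V, \<psi>)) \<Rightarrow>
     smooth_on E E (\<phi> ` (U \<inter> V)) (\<lambda>y. \<psi> (inv_into U \<phi> y)) \<and>
     smooth_on E E (\<psi> ` (U \<inter> V)) (\<lambda>y. \<phi> (inv_into V \<psi> y)))"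

definition charts :: "'v::real_vector topology \<Rightarrow> 'x set \<Rightarrow> ('x, 'v) chart set \<Rightarrow> ('x, 'v) chart set" where
  "charts E X \<A> = {(U, \<phi>). U \<subseteq> X \<and> inj_on \<phi> U \<and> openin E (\<phi> ` U) \<and>
     (\<forall>d\<in>\<A>. compatible E (U, \<phi>) d)}"

definition atlas_topology :: "'v topology \<Rightarrow> 'x set \<Rightarrow> ('x, 'v) chart set \<Rightarrow> 'x topology" where
  "atlas_topology E X \<A> =
     topology (\<lambda>W. W \<subseteq> X \<and> (\<forall>(U, \<phi>)\<in>\<A>. openin E (\<phi> ` (W \<inter> U))))"

definition smooth_atlas :: "'v::real_vector topology \<Rightarrow> 'x set \<Rightarrow> ('x, 'v) chart set \<Rightarrow> bool" where
  "smooth_atlas E X \<A> \<longleftrightarrow>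
     \<A> \<subseteq> charts E X \<A> \<and> X = (\<Union>(U, \<phi>)\<in>\<A>. U) \<and> Hausdorff_space (atlas_topology E X \<A>)"

text \<open>
  Smoothness of a map is expressed, as usual, by some pair of charts around \<open>x\<close> and \<open>f x\<close>,
  the map being continuous at \<open>x\<close> as a consequence.
\<close>

definition smooth_map :: "'v::real_vector topology \<Rightarrow> ('x, 'v) chart set \<Rightarrow>
    'w::real_vector topology \<Rightarrow> ('y, 'w) chart set \<Rightarrow> ('x \<Rightarrow> 'y) \<Rightarrow> bool" where
  "smooth_map E \<A> F \<B> f \<longleftrightarrow>
     (\<forall>x \<in> (\<Union>(U, \<phi>)\<in>\<A>. U). \<exists>(U, \<phi>)\<in>\<A>. \<exists>(V, \<psi>)\<in>\<B>. \<exists>W.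
        x \<in> W \<and> W \<subseteq> U \<and> openin E (\<phi> ` W) \<and> f ` W \<subseteq> V \<and>
        smooth_on E F (\<phi> ` W) (\<lambda>y. \<psi> (f (inv_into U \<phi> y))))"

definition product_atlas :: "('x, 'v) chart set \<Rightarrow> ('y, 'w) chart set \<Rightarrow> ('x \<times> 'y, 'v \<times> 'w) chart set" where
  "product_atlas \<A> \<B> = {(U \<times> V, map_prod \<phi> \<psi>) | U \<phi> V \<psi>. (U, \<phi>) \<in> \<A> \<and> (V, \<psi>) \<in> \<B>}"

record ('g, 'v) group_atlas = "'g monoid" +
  atlas :: "('g, 'v) chart set"

definition lie_group :: "'v::real_vector topology \<Rightarrow> ('g, 'v) group_atlas \<Rightarrow> bool" where
  "lie_group E G \<longleftrightarrow> group G \<and> smooth_atlas E (carrier G) (atlas G) \<and>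
     smooth_map (prod_topology E E) (product_atlas (atlas G) (atlas G)) E (atlas G)
       (\<lambda>(g, h). g \<otimes>\<^bsub>G\<^esub> h) \<and>
     smooth_map E (atlas G) E (atlas G) (\<lambda>g. inv\<^bsub>G\<^esub> g)"

abbreviation lie_charts :: "'v::real_vector topology \<Rightarrow> ('g, 'v) group_atlas \<Rightarrow> ('g, 'v) chart set" where
  "lie_charts E G \<equiv> charts E (carrier G) (atlas G)"

text \<open>The unit group, with the manifold structure of an open subset of the algebra.\<close>

definition unit_group :: "('a::continuous_inverse_algebra, 'a) group_atlas" where
  "unit_group = \<lparr>carrier = Units mult_monoid, monoid.mult = (*), one = 1,
     atlas = {(Units mult_monoid, \<lambda>x. x)}\<rparr>"


section \<open>Lebesgue spaces of vector-valued functions\<close>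

text \<open>
  Functions on \<open>[a,b]\<close> with values in a vector space are represented by their extension by \<open>0\<close>
  to the real line, so that pointwise operations and almost-everywhere equality on the real line
  restrict to those on \<open>[a,b]\<close>.
\<close>

quotient_type (overloaded) 'e ae_fun =
  "real \<Rightarrow> 'e" / "\<lambda>f g. AE t in lborel. f t = g t"
  morphisms rep_ae_fun ae_class
proof (rule equivpI)
  show "symp (\<lambda>f g :: real \<Rightarrow> 'e. AE t in lborel. f t = g t)"
    by (rule sympI) (simp add: eq_commute)
  show "transp (\<lambda>f g :: real \<Rightarrow> 'e. AE t in lborel. f t = g t)"
    by (rule transpI) (erule (1) AE_mp[OF _ AE_mp], simp)
qed (simp add: reflp_def)

instantiation ae_fun :: (real_vector) real_vector
begin

lift_definition zero_ae_fun :: "'a ae_fun" is "\<lambda>_. 0" .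

lift_definition plus_ae_fun :: "'a ae_fun \<Rightarrow> 'a ae_fun \<Rightarrow> 'a ae_fun"
  is "\<lambda>f g t. f t + g t" by (erule (1) AE_mp[OF _ AE_mp]) simp

lift_definition minus_ae_fun :: "'a ae_fun \<Rightarrow> 'a ae_fun \<Rightarrow> 'a ae_fun"
  is "\<lambda>f g t. f t - g t" by (erule (1) AE_mp[OF _ AE_mp]) simp

lift_definition uminus_ae_fun :: "'a ae_fun \<Rightarrow> 'a ae_fun"
  is "\<lambda>f t. - f t" by (erule AE_mp) simp

lift_definition scaleR_ae_fun :: "real \<Rightarrow> 'a ae_fun \<Rightarrow> 'a ae_fun"
  is "\<lambda>c f t. c *\<^sub>R f t" by (erule AE_mp) simp

instance
  by standard (transfer; simp add: algebra_simps)+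

end

definition cont_seminorm :: "('e::{real_vector, topological_space} \<Rightarrow> real) \<Rightarrow> bool" where
  "cont_seminorm q \<longleftrightarrow> seminorm q \<and> continuous_on UNIV q"

definition L1_functions :: "real \<Rightarrow> real \<Rightarrow> (real \<Rightarrow> 'e::locally_convex_space) set" where
  "L1_functions a b = {\<gamma>. \<gamma> \<in> borel_measurable borel \<and>
     separable_space (subtopology euclidean (\<gamma> ` {a..b})) \<and>
     (\<forall>t. t \<notin> {a..b} \<longrightarrow> \<gamma> t = 0) \<and>
     (\<forall>q. cont_seminorm q \<longrightarrow> (\<integral>\<^sup>+t\<in>{a..b}. ennreal (q (\<gamma> t)) \<partial>lborel) < \<infinity>)}"

lift_definition L1_seminorm :: "('e \<Rightarrow> real) \<Rightarrow> 'e ae_fun \<Rightarrow> real"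
  is "\<lambda>q \<gamma>. enn2real (\<integral>\<^sup>+t. ennreal (q (\<gamma> t)) \<partial>lborel)"
  by (rule arg_cong[where f = enn2real], rule nn_integral_cong_AE, erule AE_mp) simp

definition L1_space :: "real \<Rightarrow> real \<Rightarrow> 'e::locally_convex_space ae_fun topology" where
  "L1_space a b = seminorm_topology (ae_class ` L1_functions a b) (L1_seminorm ` Collect cont_seminorm)"


section \<open>Absolutely continuous functions\<close>

definition has_weak_integral ::
    "(real \<Rightarrow> 'e::locally_convex_space) \<Rightarrow> 'e \<Rightarrow> real set \<Rightarrow> bool" where
  "has_weak_integral \<gamma> I S \<longleftrightarrow>
     (\<forall>\<Lambda> :: 'e \<Rightarrow> real. linear \<Lambda> \<and> continuous_on UNIV \<Lambda> \<longrightarrow>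
        set_integrable lborel S (\<lambda>s. \<Lambda> (\<gamma> s)) \<and> \<Lambda> I = (LINT s:S|lborel. \<Lambda> (\<gamma> s)))"

definition is_primitive :: "real \<Rightarrow> real \<Rightarrow>
    (real \<Rightarrow> 'e::locally_convex_space) \<Rightarrow> (real \<Rightarrow> 'e) \<Rightarrow> bool" where
  "is_primitive a b \<gamma> \<eta> \<longleftrightarrow> (\<forall>t\<in>{a..b}. has_weak_integral \<gamma> (\<eta> t - \<eta> a) {a..t})"

definition AC_functions :: "real \<Rightarrow> real \<Rightarrow> (real \<Rightarrow> 'e::locally_convex_space) set" where
  "AC_functions a b = {\<eta>. (\<forall>t. t \<notin> {a..b} \<longrightarrow> \<eta> t = 0) \<and>
     (\<exists>\<gamma> \<in> L1_functions a b. is_primitive a b \<gamma> \<eta>)}"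

definition AC_deriv :: "real \<Rightarrow> real \<Rightarrow> (real \<Rightarrow> 'e::locally_convex_space) \<Rightarrow> 'e ae_fun" where
  "AC_deriv a b \<eta> = (THE c. \<exists>\<gamma> \<in> L1_functions a b. c = ae_class \<gamma> \<and> is_primitive a b \<gamma> \<eta>)"

definition AC_space :: "real \<Rightarrow> real \<Rightarrow> (real \<Rightarrow> 'e::locally_convex_space) topology" where
  "AC_space a b = pullback_topology (AC_functions a b) (\<lambda>\<eta>. (\<eta> a, AC_deriv a b \<eta>))
     (prod_topology euclidean (L1_space a b))"

definition zero_extend :: "real \<Rightarrow> real \<Rightarrow> (real \<Rightarrow> 'e::zero) \<Rightarrow> real \<Rightarrow> 'e" where
  "zero_extend a b f = (\<lambda>t. if t \<in> {a..b} then f t else 0)"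

text \<open>Group-valued paths on \<open>[0,1]\<close> are represented by extensional functions.\<close>

definition AC_paths :: "('g, 'e::locally_convex_space) group_atlas \<Rightarrow> (real \<Rightarrow> 'g) set" where
  "AC_paths G = {\<eta> \<in> extensional {0..1}.
     continuous_map (subtopology euclidean {0..1})
       (atlas_topology euclidean (carrier G) (atlas G)) \<eta> \<and>
     (\<exists>(n::nat) \<tau>. \<tau> 0 = 0 \<and> \<tau> n = 1 \<and>
        (\<forall>j<n. \<tau> j < \<tau> (Suc j) \<and>
           (\<exists>(U, \<phi>) \<in> lie_charts euclidean G.
              \<eta> ` {\<tau> j..\<tau> (Suc j)} \<subseteq> U \<and>
              zero_extend (\<tau> j) (\<tau> (Suc j)) (\<lambda>t. \<phi> (\<eta> t)) \<in> AC_functions (\<tau> j) (\<tau> (Suc j)))))}"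

text \<open>
  The Lie group of absolutely continuous paths, modelled on \<^term>\<open>AC_space 0 1\<close>.  Its Lie group
  structure is determined by the requirement that \<open>\<eta> \<mapsto> \<phi> \<circ> \<eta>\<close>, on the set of all \<open>\<eta>\<close> with image in
  \<open>U\<close>, be a chart for every chart \<open>\<phi>\<close> of \<open>G\<close> on a symmetric identity neighbourhood \<open>U\<close>;
  since left translations are diffeomorphisms, the left translates of these charts form an
  atlas of it.
\<close>

definition AC_group :: "('g, 'e::locally_convex_space) group_atlas \<Rightarrow>
    (real \<Rightarrow> 'g, real \<Rightarrow> 'e) group_atlas" where
  "AC_group G = \<lparr>carrier = AC_paths G,
     monoid.mult = (\<lambda>\<eta> \<zeta>. \<lambda>t\<in>{0..1}. \<eta> t \<otimes>\<^bsub>G\<^esub> \<zeta> t),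
     one = (\<lambda>t\<in>{0..1}. \<one>\<^bsub>G\<^esub>),
     atlas = {({\<eta> \<in> AC_paths G. \<forall>t\<in>{0..1}. inv\<^bsub>G\<^esub> \<xi> t \<otimes>\<^bsub>G\<^esub> \<eta> t \<in> U},
               \<lambda>\<eta>. zero_extend 0 1 (\<lambda>t. \<phi> (inv\<^bsub>G\<^esub> \<xi> t \<otimes>\<^bsub>G\<^esub> \<eta> t))) | \<xi> U \<phi>.
              \<xi> \<in> AC_paths G \<and> (U, \<phi>) \<in> lie_charts euclidean G \<and>
              \<one>\<^bsub>G\<^esub> \<in> U \<and> m_inv G ` U = U}\<rparr>"


section \<open>Regularity\<close>

text \<open>
  Let \<open>\<phi>\<^sub>0 : U\<^sub>0 \<rightarrow> V\<^sub>0\<close> be a chart around the neutral element, by means of which \<open>L(G)\<close> is identified with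
  the modelling space.  Then the tangent vector \<open>\<eta>(t).v\<close> is represented in a chart \<open>\<phi>\<close> around \<open>\<eta>(t)\<close>
  by the directional derivative of \<open>\<phi> \<circ> \<lambda>\<^bsub>\<eta>(t)\<^esub> \<circ> \<phi>\<^sub>0\<^sup>-\<^sup>1\<close> at \<open>\<phi>\<^sub>0(e)\<close> in the direction \<open>v\<close>.
  That \<open>\<eta>\<close> is differentiable at \<open>t\<close> with derivative \<open>\<eta>(t).v\<close> does not depend on \<open>\<phi>\<close>.
\<close>

definition has_left_derivative :: "('g, 'e::locally_convex_space) group_atlas \<Rightarrow>
    ('g, 'e) chart \<Rightarrow> (real \<Rightarrow> 'g) \<Rightarrow> real \<Rightarrow> 'e \<Rightarrow> bool" where
  "has_left_derivative G c\<^sub>0 \<eta> t v = (case c\<^sub>0 of (U\<^sub>0, \<phi>\<^sub>0) \<Rightarrow>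
     \<exists>(U, \<phi>) \<in> lie_charts euclidean G. \<eta> t \<in> U \<and>
       ((\<lambda>s. (\<phi> (\<eta> s) - \<phi> (\<eta> t)) /\<^sub>R (s - t)) \<longlongrightarrow>
          dir_deriv euclidean (\<lambda>y. \<phi> (\<eta> t \<otimes>\<^bsub>G\<^esub> inv_into U\<^sub>0 \<phi>\<^sub>0 y)) (\<phi>\<^sub>0 \<one>\<^bsub>G\<^esub>) v)
         (at t within {0..1}))"

text \<open>
  The notion does not depend on the chart \<open>(U\<^sub>0, \<phi>\<^sub>0)\<close> used to identify \<open>L(G)\<close> with the modelling space:
  a change of this chart amounts to an automorphism of the topological vector space
  \<^term>\<open>L1_space 0 1\<close>.  Moreover, \<open>Evol\<close> is uniquely determined on \<^term>\<open>topspace (L1_space 0 1)\<close>,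
  as solutions of the initial value problem are unique.
\<close>

definition L1_regular :: "('g, 'e::locally_convex_space) group_atlas \<Rightarrow> bool" where
  "L1_regular G \<longleftrightarrow> frechet_space TYPE('e) \<and> lie_group (euclidean :: 'e topology) G \<and>
     (\<exists>(U\<^sub>0, \<phi>\<^sub>0) \<in> lie_charts euclidean G. \<one>\<^bsub>G\<^esub> \<in> U\<^sub>0 \<and>
       (\<exists>Evol :: 'e ae_fun \<Rightarrow> real \<Rightarrow> 'g.
          (\<forall>\<gamma> \<in> L1_functions 0 1.
             Evol (ae_class \<gamma>) \<in> AC_paths G \<and>
             Evol (ae_class \<gamma>) 0 = \<one>\<^bsub>G\<^esub> \<and>
             (AE t in lborel. t \<in> {0..1} \<longrightarrow>
                has_left_derivative G (U\<^sub>0, \<phi>\<^sub>0) (Evol (ae_class \<gamma>)) t (\<gamma> t))) \<and>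
          smooth_map (L1_space 0 1) {(topspace (L1_space 0 1), \<lambda>x. x)}
            (AC_space 0 1) (atlas (AC_group G)) Evol))"

end

theory Submission
  imports Defs
begin

text \<open>
  Fix an increasing sequence of submultiplicative seminorms defining the topology of \<open>A\<close>. Write
  \<open>P \<rho> (t) = \<integral>\<^sub>0\<^sup>t \<rho>\<close> for \<open>\<rho> \<in> L\<^sup>1\<close> and \<open>B(\<rho>, \<gamma>) = (P \<rho>) \<gamma>\<close>. Looking for \<open>\<eta> = Evol(\<gamma>)\<close> in the form
  \<open>\<eta> = 1 + P \<rho>\<close>, the equation \<open>\<eta>' = \<eta> \<gamma>\<close> becomes \<open>\<rho> = B(\<rho>, \<gamma>) + \<gamma>\<close>. More generally,
  \<open>\<rho> = B(\<rho>, \<gamma>) + \<sigma>\<close> is solved by Picard iteration: submultiplicativity bounds the iterates in each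
  seminorm separately, and a discrete form of Gronwall's lemma makes their series converge and gives
  uniqueness. The solution \<open>\<rho> = R(\<gamma>, \<sigma>)\<close> is jointly continuous, linear in \<open>\<sigma>\<close>, and satisfies
  \<open>R(\<gamma> + \<delta>, \<sigma>) - R(\<gamma>, \<sigma>) = R(\<gamma> + \<delta>, B(R(\<gamma>, \<sigma>), \<delta>))\<close>.
  Hence its directional derivatives are again built from \<open>R\<close> and \<open>B\<close>, so that it is smooth, and
  so is \<open>Evol\<close>, as \<open>\<eta> \<mapsto> (\<eta>(0), \<eta>')\<close> identifies the absolutely continuous functions with \<open>A \<times> L\<^sup>1\<close>.

  The values of \<open>\<eta>\<close> are invertible because \<open>\<eta>(t) = \<eta>(s) \<zeta>(t)\<close>, where \<open>\<zeta>\<close> is the solution starting from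
  \<open>1\<close> at time \<open>s\<close>, which is close to \<open>1\<close> for short times; and the group of units is open. Finally, \<open>\<eta>\<close> is
  differentiable almost everywhere by Lebesgue's differentiation theorem applied to the functions
  \<open>q(\<rho>(t) - d)\<close>, where \<open>d\<close> ranges over a countable set whose closure contains the values of \<open>\<rho>\<close>.
\<close>


section \<open>The Hahn--Banach theorem for seminorms\<close>

text \<open>Integrals are weak, hence known only through continuous functionals, whereas every
  estimate is made in seminorms. The Hahn--Banach theorem links the two: a functional dominated by
  \<open>p n\<close> that attains \<open>p n I\<close> at the integral \<open>I\<close> bounds
  \<open>p n I\<close> by a scalar integral.

  The unknown is the derivative \<open>\<rho>\<close> and not the path because the topology on paths
  is read off from initial value and derivative. All analysis then takes place in one space, on
  which \<open>B\<close> is bilinear and submultiplicative in each seminorm. No single norm controls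
  that space, so each seminorm gets its own Gronwall constant on the whole unit interval. The free
  inhomogeneity \<open>\<sigma>\<close> is kept because differentiating in \<open>\<gamma>\<close>
  changes only this term of the equation.

  Smoothness concerns infinitely many iterated derivatives on ever larger powers. It is reduced to
  exhibiting a class of continuous maps on all powers that is closed under one derivation: rational
  maps for the group operations, maps built from \<open>R\<close> and \<open>B\<close> for the
  evolution. Both the unit group and its group of paths have a global chart, so only maps between
  vector spaces remain.\<close>

definition sublinear :: "('v::real_vector \<Rightarrow> real) \<Rightarrow> bool" where
  "sublinear p \<longleftrightarrow> (\<forall>x y. p (x + y) \<le> p x + p y) \<and> (\<forall>c x. 0 \<le> c \<longrightarrow> p (c *\<^sub>R x) = c * p x)"

text \<open>One inequality for all positive scalars suffices: applied to \<open>inverse c\<close>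
  and \<open>c *\<^sub>R x\<close> it gives the reverse one.\<close>

lemma sublinearI:
  assumes add: "\<And>x y. p (x + y) \<le> p x + p y"
    and scale: "\<And>c x. 0 < c \<Longrightarrow> c * p x \<le> p (c *\<^sub>R x)" and zero: "p 0 = 0"
  shows "sublinear p"
proof -
  have "p (c *\<^sub>R x) = c * p x" if c: "0 < c" for c x
    using scale[OF c, of x] scale[of "inverse c" "c *\<^sub>R x"] c by (simp add: field_simps)
  then show ?thesis
    unfolding sublinear_def using add zero by (metis less_le mult_zero_left scaleR_zero_left)
qed

lemma sublinear_zero: "sublinear p \<Longrightarrow> p 0 = 0"
  unfolding sublinear_def by (metis mult_zero_left order_refl scaleR_zero_left)

lemma sublinear_minus:
  assumes p: "sublinear p"
  shows "- p (- x) \<le> p x"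
proof -
  have "p (x + - x) \<le> p x + p (- x)"
    using p unfolding sublinear_def by blast
  then show ?thesis using sublinear_zero[OF p] by simp
qed

text \<open>For sublinear \<open>p\<close> this is the largest sublinear \<open>r \<le> p\<close>
  with \<open>r (- z) \<le> - p z\<close>: any such \<open>r\<close> satisfies
  \<open>r x \<le> r (x + t *\<^sub>R z) + t * r (- z)\<close>, which is at most every term of the
  infimum.\<close>

definition sublinear_shift :: "('v::real_vector \<Rightarrow> real) \<Rightarrow> 'v \<Rightarrow> 'v \<Rightarrow> real" where
  "sublinear_shift p z x = (INF t\<in>{0..}. p (x + t *\<^sub>R z) - t * p z)"

lemma sublinear_shift:
  assumes p: "sublinear p"
  shows "sublinear (sublinear_shift p z)"
    and "sublinear_shift p z x \<le> p x"
    and "sublinear_shift p z (- z) \<le> - p z"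
proof -
  have add: "p (x + y) \<le> p x + p y" for x y
    using p by (simp add: sublinear_def)
  have scale: "p (c *\<^sub>R x) = c * p x" if "0 \<le> c" for c x
    using p that by (simp add: sublinear_def)
  \<comment> \<open>A lower bound independent of \<open>t\<close>, so the infimum is finite.\<close>
  have low: "- p (- x) \<le> p (x + t *\<^sub>R z) - t * p z" if "0 \<le> t" for t x
    using add[of "x + t *\<^sub>R z" "- x"] scale[OF that, of z] by simp
  have bdd: "bdd_below ((\<lambda>t. p (x + t *\<^sub>R z) - t * p z) ` {0..})" for x
    using low by (intro bdd_belowI2[where m = "- p (- x)"]) auto
  have le: "sublinear_shift p z x \<le> p (x + t *\<^sub>R z) - t * p z" if "0 \<le> t" for t x
    unfolding sublinear_shift_def using bdd that by (intro cINF_lower) auto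
  have ge: "m \<le> sublinear_shift p z x" if "\<And>t. 0 \<le> t \<Longrightarrow> m \<le> p (x + t *\<^sub>R z) - t * p z" for m x
    unfolding sublinear_shift_def using that by (intro cINF_greatest) auto
  show "sublinear_shift p z x \<le> p x"
    using le[of 0 x] by simp
  show "sublinear_shift p z (- z) \<le> - p z"
    using le[of 1 "- z"] sublinear_zero[OF p] by simp
  have sub: "sublinear_shift p z (x + y) \<le> sublinear_shift p z x + sublinear_shift p z y" for x y
  proof -
    have "sublinear_shift p z (x + y) - sublinear_shift p z y \<le> sublinear_shift p z x"
    proof (rule ge)
      fix t :: real assume t: "0 \<le> t"
      have "sublinear_shift p z (x + y) - (p (x + t *\<^sub>R z) - t * p z) \<le> sublinear_shift p z y"
      proof (rule ge)
        fix s :: real assume s: "0 \<le> s"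
        \<comment> \<open>The parameter \<open>t\<close> used for \<open>x\<close> and the parameter
          \<open>s\<close> used for \<open>y\<close> combine to \<open>t + s\<close> for the
          sum.\<close>
        have "sublinear_shift p z (x + y) \<le> p (x + y + (t + s) *\<^sub>R z) - (t + s) * p z"
          using s t by (intro le) auto
        also have "p (x + y + (t + s) *\<^sub>R z) \<le> p (x + t *\<^sub>R z) + p (y + s *\<^sub>R z)"
          using add[of "x + t *\<^sub>R z" "y + s *\<^sub>R z"] by (simp add: algebra_simps)
        finally show "sublinear_shift p z (x + y) - (p (x + t *\<^sub>R z) - t * p z)
            \<le> p (y + s *\<^sub>R z) - s * p z"
          by (simp add: algebra_simps)
      qed
      then show "sublinear_shift p z (x + y) - sublinear_shift p z y \<le> p (x + t *\<^sub>R z) - t * p z"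
        by simp
    qed
    then show ?thesis by simp
  qed
  have scale_le: "c * sublinear_shift p z x \<le> sublinear_shift p z (c *\<^sub>R x)" if c: "0 < c" for c x
  proof (rule ge)
    fix t :: real assume t: "0 \<le> t"
    have "c * sublinear_shift p z x \<le> c * (p (x + (t / c) *\<^sub>R z) - (t / c) * p z)"
      using c t by (intro mult_left_mono le) auto
    also have "\<dots> = p (c *\<^sub>R x + t *\<^sub>R z) - t * p z"
      using c scale[of c "x + (t / c) *\<^sub>R z"] by (simp add: algebra_simps)
    finally show "c * sublinear_shift p z x \<le> p (c *\<^sub>R x + t *\<^sub>R z) - t * p z" .
  qed
  have "sublinear_shift p z 0 = 0"
    using sublinear_zero[OF p] by (simp add: sublinear_shift_def scale image_constant_conv cong: image_cong_simp)
  with sub scale_le show "sublinear (sublinear_shift p z)"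
    by (intro sublinearI)
qed

text \<open>Minimality forces \<open>sublinear_shift p z = p\<close>, and the bound of the shift at
  \<open>- z\<close> makes \<open>p\<close> odd. A subadditive odd functional is additive.\<close>

lemma minimal_sublinear_imp_linear:
  assumes p: "sublinear p" and min: "\<And>r. sublinear r \<Longrightarrow> (\<And>x. r x \<le> p x) \<Longrightarrow> r = p"
  shows "linear p"
proof -
  have odd: "p (- z) = - p z" for z
  proof (rule antisym)
    have "sublinear_shift p z = p"
      using sublinear_shift[OF p] by (intro min) auto
    then show "p (- z) \<le> - p z"
      using sublinear_shift(3)[OF p, of z] by simp
  qed (use sublinear_minus[OF p, of "z"] in linarith)
  have add: "p (x + y) \<le> p x + p y" for x y
    using p by (simp add: sublinear_def)
  have "p (x + y) = p x + p y" for x y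
    using add[of x y] add[of "x + y" "- y"] odd[of y] by simp
  moreover have "p (c *\<^sub>R x) = c * p x" for c x
  proof (cases "0 \<le> c")
    case False
    then have "p ((- c) *\<^sub>R x) = (- c) * p x"
      using p by (simp only: sublinear_def)
    then show ?thesis using odd[of "c *\<^sub>R x"] by simp
  qed (use p in \<open>simp add: sublinear_def\<close>)
  ultimately show ?thesis
    by (intro linearI) auto
qed

text \<open>Zorn's lemma applied downwards: the pointwise infimum of a chain is again sublinear, so
  a minimal sublinear functional below \<open>q\<close> exists, and minimal ones are linear.\<close>

lemma minimal_sublinear_exists:
  fixes q :: "'v::real_vector \<Rightarrow> real"
  assumes q: "sublinear q"
  shows "\<exists>p. linear p \<and> (\<forall>x. p x \<le> q x)"
proof -
  define A where "A = {p. sublinear p \<and> (\<forall>x. p x \<le> q x)}"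
  \<comment> \<open>The order is reversed, so that a maximal element for \<open>P\<close> is a
    minimal functional.\<close>
  define P where "P = (\<lambda>f g :: 'v \<Rightarrow> real. \<forall>x. g x \<le> f x)"
  have "\<exists>m\<in>A. \<forall>a\<in>A. P m a \<longrightarrow> a = m"
  proof (rule predicate_Zorn)
    show "partial_order_on A (relation_of P A)"
      by (rule partial_order_on_relation_ofI) (auto simp: P_def intro: order_trans intro!: ext antisym)
    fix C assume C: "C \<in> Chains (relation_of P A)"
    then have CA: "C \<subseteq> A"
      by (auto simp: Chains_def relation_of_def)
    have tot: "(\<forall>x. f x \<le> g x) \<or> (\<forall>x. g x \<le> f x)" if "f \<in> C" "g \<in> C" for f g
      using C that by (auto simp: Chains_def relation_of_def P_def)
    show "\<exists>u\<in>A. \<forall>a\<in>C. P a u"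
    proof (cases "C = {}")
      case True
      then show ?thesis using q by (auto simp: A_def)
    next
      case False
      define u where "u = (\<lambda>x. INF f\<in>C. f x)"
      have low: "- q (- x) \<le> f x" if "f \<in> C" for f x
      proof -
        have "sublinear f" "f (- x) \<le> q (- x)" using that CA by (auto simp: A_def)
        then show ?thesis using sublinear_minus[of f x] by linarith
      qed
      have bdd: "bdd_below ((\<lambda>f. f x) ` C)" for x
        using low by (intro bdd_belowI2[where m = "- q (- x)"]) auto
      have le: "u x \<le> f x" if "f \<in> C" for f x
        unfolding u_def using bdd that by (intro cINF_lower) auto
      have ge: "m \<le> u x" if "\<And>f. f \<in> C \<Longrightarrow> m \<le> f x" for m x
        unfolding u_def using that False by (intro cINF_greatest) auto
      have add: "f (x + y) \<le> f x + f y" if "f \<in> C" for f x y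
        using that CA by (auto simp: A_def sublinear_def)
      have scale: "f (c *\<^sub>R x) = c * f x" if "f \<in> C" "0 \<le> c" for f c x
        using that CA by (auto simp: A_def sublinear_def)
      have sub: "u (x + y) \<le> u x + u y" for x y
      proof -
        have "u (x + y) - u y \<le> u x"
        proof (rule ge)
          fix f assume f: "f \<in> C"
          have "u (x + y) - f x \<le> u y"
          proof (rule ge)
            fix g assume g: "g \<in> C"
            \<comment> \<open>Members of the chain are comparable; the smaller of \<open>f\<close>
              and \<open>g\<close> serves for both summands.\<close>
            show "u (x + y) - f x \<le> g y"
              using tot[OF f g] add[OF f, of x y] add[OF g, of x y] le[OF f, of "x + y"] le[OF g, of "x + y"]
              by (smt (verit))
          qed
          then show "u (x + y) - u y \<le> f x" by linarith
        qed
        then show ?thesis by linarith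
      qed
      have scale_le: "c * u x \<le> u (c *\<^sub>R x)" if c: "0 \<le> c" for c x
        using c le by (intro ge) (simp add: scale mult_left_mono)
      have "u 0 = 0"
      proof -
        have "f 0 = 0" if "f \<in> C" for f
          using scale[OF that, of 0 0] by simp
        then have "(\<lambda>f. f 0) ` C = (\<lambda>_. 0) ` C"
          by (intro image_cong) auto
        then show ?thesis using False by (simp add: u_def)
      qed
      with sub scale_le have "sublinear u"
        by (intro sublinearI) auto
      moreover have "u x \<le> q x" for x
        using False le CA by (force simp: A_def intro: order_trans)
      ultimately show ?thesis
        using le by (auto simp: A_def P_def)
    qed
  qed
  then obtain m where m: "m \<in> A" "\<And>a. a \<in> A \<Longrightarrow> P m a \<Longrightarrow> a = m" by blast
  have "linear m"
    using m by (intro minimal_sublinear_imp_linear) (auto simp: A_def P_def intro: order_trans)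
  then show ?thesis using m(1) by (auto simp: A_def)
qed

lemma seminorm_imp_sublinear: "seminorm q \<Longrightarrow> sublinear q"
  by (auto simp: seminorm_def sublinear_def)

lemma seminorm_minus: "seminorm q \<Longrightarrow> q (- x) = q x"
  unfolding seminorm_def by (metis abs_minus_cancel abs_one mult_1 scaleR_minus1_left)

text \<open>The minimal functional is taken below the shift of \<open>q\<close> at \<open>x\<close>
  instead of below \<open>q\<close>. The bound of the shift at \<open>- x\<close> forces the value
  \<open>q x\<close> at \<open>x\<close>; this replaces an extension from the line through
  \<open>x\<close>.\<close>

theorem Hahn_Banach_seminorm:
  fixes q :: "'v::real_vector \<Rightarrow> real"
  assumes q: "seminorm q"
  obtains \<Lambda> where "linear \<Lambda>" "\<And>y. \<bar>\<Lambda> y\<bar> \<le> q y" "\<Lambda> x = q x"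
proof -
  note s = seminorm_imp_sublinear[OF q]
  obtain \<Lambda> where \<Lambda>: "linear \<Lambda>" "\<And>y. \<Lambda> y \<le> sublinear_shift q x y"
    using minimal_sublinear_exists[OF sublinear_shift(1)[OF s]] by blast
  have le: "\<Lambda> y \<le> q y" for y
    using \<Lambda>(2) sublinear_shift(2)[OF s] by (rule order_trans)
  have "\<Lambda> (- x) \<le> - q x"
    using \<Lambda>(2) sublinear_shift(3)[OF s] by (rule order_trans)
  then have "\<Lambda> x = q x"
    using le[of x] linear_neg[OF \<Lambda>(1), of x] by simp
  moreover have "\<bar>\<Lambda> y\<bar> \<le> q y" for y
    using le[of y] le[of "- y"] linear_neg[OF \<Lambda>(1), of y] seminorm_minus[OF q, of y] by linarith
  ultimately show ?thesis using that \<Lambda>(1) by blast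
qed


section \<open>Lebesgue's differentiation theorem and Gronwall's lemma\<close>

text \<open>A bad point is an endpoint of arbitrarily short intervals on which the Riemann term
  misses the integral by at least \<open>e\<close> times the length. Henstock's lemma bounds the
  total miss of finitely many disjoint such intervals, hence their total length; Vitali's covering
  lemma reduces the whole set to disjoint intervals at the price of a fivefold enlargement.\<close>

lemma negligible_not_derivative:
  fixes f :: "real \<Rightarrow> real" and e :: real
  assumes f: "f integrable_on {a..b}" and e: "0 < e"
  defines "I \<equiv> \<lambda>x. integral {a..x} f"
  shows "negligible {x\<in>{a..b}. \<forall>d>0. \<exists>s\<in>{a..b}. s \<noteq> x \<and> \<bar>s - x\<bar> < d \<and>
    e * \<bar>s - x\<bar> \<le> \<bar>I s - I x - f x * (s - x)\<bar>}" (is "negligible ?E")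
  unfolding negligible_outer_le
proof (intro allI impI)
  fix c :: real assume c: "0 < c"
  \<comment> \<open>An interval of half-length \<open>r\<close> is enlarged to measure
    \<open>10 * r\<close>, which is at most \<open>5 / e\<close> times its miss. With this tolerance
    the total becomes \<open>c\<close>.\<close>
  obtain \<gamma> where \<gamma>: "gauge \<gamma>"
    and Hen: "\<And>p. p tagged_partial_division_of (cbox a b) \<Longrightarrow> \<gamma> fine p \<Longrightarrow>
      (\<Sum>(x,k)\<in>p. norm (measure lborel k *\<^sub>R f x - integral k f)) < c * e / 5"
    using Henstock_lemma[of f a b "c * e / 5"] f c e by auto
  define J where "J = (\<lambda>(x::real, s). {min x s..max x s})"
  define K where "K = {(x, s). x \<in> {a..b} \<and> s \<in> {a..b} \<and> s \<noteq> x \<and> J (x, s) \<subseteq> \<gamma> x \<and>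
    e * \<bar>s - x\<bar> \<le> \<bar>I s - I x - f x * (s - x)\<bar>}"
  define m where "m = (\<lambda>(x::real, s). (x + s) / 2)"
  define r where "r = (\<lambda>(x::real, s). \<bar>s - x\<bar> / 2)"
  have J_cball: "J i = cball (m i) (r i)" for i
    by (cases i) (auto simp: J_def m_def r_def cball_eq_atLeastAtMost abs_if field_simps min_def max_def)
  \<comment> \<open>The sign accounts for intervals whose tag is the right endpoint.\<close>
  have diff: "measure lborel (J (x, s)) *\<^sub>R f x - integral (J (x, s)) f
      = (if x \<le> s then 1 else -1) * (f x * (s - x) - (I s - I x))"
    if "x \<in> {a..b}" "s \<in> {a..b}" for x s
  proof -
    have *: "integral {u..v} f = I v - I u" if "a \<le> u" "u \<le> v" "v \<le> b" for u v
    proof -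
      have "f integrable_on {a..v}"
        using integrable_on_subinterval[OF f] that by auto
      then show ?thesis
        using Henstock_Kurzweil_Integration.integral_combine[of a u v f] that by (simp add: I_def)
    qed
    show ?thesis
      using that by (auto simp: J_def * min_def max_def algebra_simps)
  qed
  have sub: "?E \<subseteq> (\<Union>i\<in>K. cball (m i) (r i))"
  proof
    fix x assume x: "x \<in> ?E"
    obtain d where d: "0 < d" "ball x d \<subseteq> \<gamma> x"
      using \<gamma> by (meson gauge_def open_contains_ball)
    with x obtain s where s: "s \<in> {a..b}" "s \<noteq> x" "\<bar>s - x\<bar> < d"
        "e * \<bar>s - x\<bar> \<le> \<bar>I s - I x - f x * (s - x)\<bar>"
      by blast
    have "J (x, s) \<subseteq> ball x d"
      using s by (auto simp: J_def dist_real_def abs_if split: if_splits)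
    then have "(x, s) \<in> K"
      using s d x by (auto simp: K_def)
    moreover have "x \<in> J (x, s)" by (auto simp: J_def)
    ultimately show "x \<in> (\<Union>i\<in>K. cball (m i) (r i))"
      unfolding J_cball by blast
  qed
  have rK: "0 < r i \<and> r i \<le> (b - a) / 2" if "i \<in> K" for i
    using that by (auto simp: K_def r_def abs_if)
  obtain C where C: "countable C" "C \<subseteq> K"
     "pairwise (\<lambda>i j. disjnt (cball (m i) (r i)) (cball (m j) (r j))) C"
     "?E \<subseteq> (\<Union>i\<in>C. cball (m i) (5 * r i))"
    by (rule Vitali_covering_lemma_cballs[OF sub rK])
  let ?T = "\<Union>i\<in>C. cball (m i) (5 * r i)"
  \<comment> \<open>A bound common to all finite subfamilies carries over to the countable
    union.\<close>
  have bound: "measure lebesgue (\<Union>i\<in>D. cball (m i) (5 * r i)) \<le> c" if D: "D \<subseteq> C" "finite D" for D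
  proof -
    define p where "p = (\<lambda>i. (fst i, J i)) ` D"
    have disj: "disjnt (J i) (J j)" if "i \<in> D" "j \<in> D" "i \<noteq> j" for i j
      unfolding J_cball using C(3) D(1) that by (auto simp: pairwise_def)
    have ne: "fst i \<in> J i" for i by (cases i) (auto simp: J_def)
    have inj: "inj_on (\<lambda>i. (fst i, J i)) D"
      by (intro inj_onI) (metis disj disjnt_iff ne prod.inject)
    have part: "p tagged_partial_division_of (cbox a b)"
      unfolding tagged_partial_division_of_def
    proof (intro conjI allI impI)
      show "finite p" using D by (simp add: p_def)
      fix x k assume "(x, k) \<in> p"
      then obtain i where i: "i \<in> D" "x = fst i" "k = J i" by (auto simp: p_def)
      have "i \<in> K" using i D C by auto
      then show "x \<in> k" "k \<subseteq> cbox a b" "\<exists>u v. k = cbox u v"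
        using i ne by (auto simp: K_def J_def split: prod.splits)
    next
      fix x1 k1 x2 k2 assume "(x1, k1) \<in> p \<and> (x2, k2) \<in> p \<and> (x1, k1) \<noteq> (x2, k2)"
      then have "disjnt k1 k2"
        using disj by (auto simp: p_def)
      then show "interior k1 \<inter> interior k2 = {}"
        using interior_subset[of k1] interior_subset[of k2] by (auto simp: disjnt_iff)
    qed
    have "J i \<subseteq> \<gamma> (fst i)" if "i \<in> D" for i
    proof -
      have "i \<in> K" using that D C by blast
      then show ?thesis by (cases i) (simp add: K_def)
    qed
    then have fine: "\<gamma> fine p"
      by (auto simp: fine_def p_def)
    have "measure lebesgue (\<Union>i\<in>D. cball (m i) (5 * r i))
        \<le> (\<Sum>i\<in>D. measure lebesgue (cball (m i) (5 * r i)))"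
      using D by (intro measure_UNION_le) auto
    also have "\<dots> \<le> (\<Sum>i\<in>D. 10 * r i)"
    proof (rule sum_mono)
      fix i assume "i \<in> D"
      then have "0 < r i" using D C rK by blast
      then show "measure lebesgue (cball (m i) (5 * r i)) \<le> 10 * r i"
        by (simp add: cball_eq_atLeastAtMost)
    qed
    also have "\<dots> \<le> (\<Sum>i\<in>D. 5 / e * norm (measure lborel (J i) *\<^sub>R f (fst i) - integral (J i) f))"
    proof (rule sum_mono)
      fix i assume "i \<in> D"
      then have "i \<in> K" using D C by blast
      then obtain x s where i: "i = (x, s)" "x \<in> {a..b}" "s \<in> {a..b}"
        "e * \<bar>s - x\<bar> \<le> \<bar>I s - I x - f x * (s - x)\<bar>" by (auto simp: K_def)
      have "norm (measure lborel (J i) *\<^sub>R f (fst i) - integral (J i) f) = \<bar>I s - I x - f x * (s - x)\<bar>"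
        using diff[OF i(2,3)] unfolding i(1) by (simp add: abs_mult abs_minus_commute)
      then show "10 * r i \<le> 5 / e * norm (measure lborel (J i) *\<^sub>R f (fst i) - integral (J i) f)"
        using i e by (simp add: r_def field_simps)
    qed
    also have "\<dots> = 5 / e * (\<Sum>(x,k)\<in>p. norm (measure lborel k *\<^sub>R f x - integral k f))"
      unfolding p_def sum.reindex[OF inj] by (simp add: sum_distrib_left o_def)
    also have "\<dots> \<le> 5 / e * (c * e / 5)"
      using Hen[OF part fine] e by (intro mult_left_mono) auto
    also have "\<dots> = c" using e by simp
    finally show ?thesis .
  qed
  have "?T \<in> lmeasurable" "measure lebesgue ?T \<le> c"
    using fmeasurable_UN_bound[OF C(1) _ bound] measure_UN_bound[OF C(1) _ bound] c by auto
  with C(4) show "\<exists>T. ?E \<subseteq> T \<and> T \<in> lmeasurable \<and> measure lebesgue T \<le> c" by blast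
qed

text \<open>The exceptional set is contained in the union of those for the tolerances
  \<open>inverse (Suc n)\<close>.\<close>

theorem negligible_not_Lebesgue_differentiable:
  fixes f :: "real \<Rightarrow> real"
  assumes f: "f integrable_on {a..b}"
  defines "I \<equiv> \<lambda>x. integral {a..x} f"
  shows "negligible {x\<in>{a..b}. \<not> ((\<lambda>s. (I s - I x) / (s - x)) \<longlongrightarrow> f x) (at x within {a..b})}"
proof -
  let ?E = "\<lambda>n::nat. {x\<in>{a..b}. \<forall>d>0. \<exists>s\<in>{a..b}. s \<noteq> x \<and> \<bar>s - x\<bar> < d \<and>
    inverse (Suc n) * \<bar>s - x\<bar> \<le> \<bar>I s - I x - f x * (s - x)\<bar>}"
  have "negligible (\<Union>n. ?E n)"
    unfolding I_def by (intro negligible_Union_nat negligible_not_derivative f) auto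
  moreover have "((\<lambda>s. (I s - I x) / (s - x)) \<longlongrightarrow> f x) (at x within {a..b})"
    if x: "x \<in> {a..b}" "\<And>n. x \<notin> ?E n" for x
    unfolding tendsto_iff
  proof (intro allI impI)
    fix e :: real assume "0 < e"
    then obtain n where n: "inverse (Suc n) < e"
      using reals_Archimedean by blast
    obtain d where d: "0 < d" "\<And>s. s \<in> {a..b} \<Longrightarrow> s \<noteq> x \<Longrightarrow> \<bar>s - x\<bar> < d \<Longrightarrow>
       \<bar>I s - I x - f x * (s - x)\<bar> < inverse (Suc n) * \<bar>s - x\<bar>"
      using x(2)[of n] x(1) unfolding mem_Collect_eq not_le[symmetric] by blast
    show "\<forall>\<^sub>F s in at x within {a..b}. dist ((I s - I x) / (s - x)) (f x) < e"
      unfolding eventually_at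
    proof (intro exI[of _ d] conjI ballI impI)
      fix s assume s: "s \<in> {a..b}" "s \<noteq> x \<and> dist s x < d"
      then have "\<bar>I s - I x - f x * (s - x)\<bar> < e * \<bar>s - x\<bar>"
        using d(2)[of s] n by (auto simp: dist_real_def intro: order.strict_trans2 mult_right_mono)
      moreover have "dist ((I s - I x) / (s - x)) (f x) = \<bar>I s - I x - f x * (s - x)\<bar> / \<bar>s - x\<bar>"
        using s by (simp add: dist_real_def abs_divide[symmetric] diff_divide_distrib)
      ultimately show "dist ((I s - I x) / (s - x)) (f x) < e"
        using s by (simp add: pos_divide_less_eq)
    qed (use d in auto)
  qed
  ultimately show ?thesis
    by (elim negligible_subset) blast
qed

text \<open>Cut where \<open>G\<close> takes multiples of 1/2 as values. Between two cuts the term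
  \<open>r t * (G t - G s)\<close> is at most \<open>r t / 2\<close> and is absorbed on the left,
  which doubles the bound; \<open>N\<close> cuts therefore cost \<open>2 ^ N\<close>.\<close>

lemma Gronwall_bound:
  fixes r S G :: "real \<Rightarrow> real"
  assumes G: "continuous_on {0..1} G" "G 0 = 0"
    and r: "r 0 = 0" "\<And>t. t \<in> {0..1} \<Longrightarrow> 0 \<le> r t"
    and S: "S 0 = 0" "\<And>s t. 0 \<le> s \<Longrightarrow> s \<le> t \<Longrightarrow> t \<le> 1 \<Longrightarrow> S s \<le> S t"
    and step: "\<And>s t. 0 \<le> s \<Longrightarrow> s \<le> t \<Longrightarrow> t \<le> 1 \<Longrightarrow> r t - r s \<le> S t - S s + r t * (G t - G s)"
  shows "t \<in> {0..1} \<Longrightarrow> G t \<le> real N / 2 \<Longrightarrow> r t \<le> 2 ^ N * S t"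
proof (induction N arbitrary: t)
  case 0
  have "r t * G t \<le> 0"
    using 0 r by (intro mult_nonneg_nonpos) auto
  then show ?case
    using step[of 0 t] 0 r S G by simp
next
  case (Suc N)
  have St: "0 \<le> S t" using S(2)[of 0 t] S(1) Suc.prems by simp
  show ?case
  proof (cases "G t \<le> real N / 2")
    case True
    then have "r t \<le> 2 ^ N * S t" using Suc by simp
    also have "\<dots> \<le> 2 ^ Suc N * S t" using St by (simp add: mult_right_mono)
    finally show ?thesis .
  next
    case False
    \<comment> \<open>\<open>G\<close> starts at 0 and exceeds \<open>real N / 2\<close> at
      \<open>t\<close>; from such an \<open>s\<close> to \<open>t\<close> it grows by at most
      1/2.\<close>
    have "\<exists>s\<ge>0. s \<le> t \<and> G s = real N / 2"
      using Suc.prems False G by (intro IVT') (auto intro: continuous_on_subset)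
    then obtain s where s: "0 \<le> s" "s \<le> t" "G s = real N / 2" by blast
    have "r s \<le> 2 ^ N * S s" using s Suc by auto
    moreover have "r t * (G t - G s) \<le> r t * (1 / 2)"
      using Suc.prems s r by (intro mult_left_mono) (auto simp: field_simps)
    ultimately have "r t \<le> 2 * (2 ^ N * S s + (S t - S s))"
      using step[of s t] s Suc.prems by simp
    also have "\<dots> \<le> 2 * (2 ^ N * S s + 2 ^ N * (S t - S s))"
      using S(2)[of s t] s Suc.prems mult_right_mono[of 1 "2 ^ N" "S t - S s"] by simp
    finally show ?thesis by (simp add: algebra_simps)
  qed
qed


section \<open>Seminorm topologies and smooth maps\<close>

lemma istopology_seminorm_topology:
  fixes Q :: "('v::real_vector \<Rightarrow> real) set"
  shows "istopology (\<lambda>U. U \<subseteq> S \<and>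
     (\<forall>x\<in>U. \<exists>F \<epsilon>. finite F \<and> F \<subseteq> Q \<and> 0 < \<epsilon> \<and> {y\<in>S. \<forall>q\<in>F. q (y - x) < \<epsilon>} \<subseteq> U))"
  unfolding istopology_def
proof (intro conjI allI impI ballI)
  fix U V x
  assume U: "U \<subseteq> S \<and> (\<forall>x\<in>U. \<exists>F \<epsilon>. finite F \<and> F \<subseteq> Q \<and> 0 < \<epsilon> \<and> {y\<in>S. \<forall>q\<in>F. q (y - x) < \<epsilon>} \<subseteq> U)"
    and V: "V \<subseteq> S \<and> (\<forall>x\<in>V. \<exists>F \<epsilon>. finite F \<and> F \<subseteq> Q \<and> 0 < \<epsilon> \<and> {y\<in>S. \<forall>q\<in>F. q (y - x) < \<epsilon>} \<subseteq> V)"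
    and x: "x \<in> U \<inter> V"
  obtain F \<epsilon> where F: "finite F" "F \<subseteq> Q" "0 < \<epsilon>" "{y\<in>S. \<forall>q\<in>F. q (y - x) < \<epsilon>} \<subseteq> U"
    using U x by blast
  obtain F' \<epsilon>' where F': "finite F'" "F' \<subseteq> Q" "0 < \<epsilon>'" "{y\<in>S. \<forall>q\<in>F'. q (y - x) < \<epsilon>'} \<subseteq> V"
    using V x by blast
  have "{y\<in>S. \<forall>q\<in>F \<union> F'. q (y - x) < min \<epsilon> \<epsilon>'} \<subseteq> U \<inter> V"
    using F(4) F'(4) by auto
  then show "\<exists>F \<epsilon>. finite F \<and> F \<subseteq> Q \<and> 0 < \<epsilon> \<and> {y\<in>S. \<forall>q\<in>F. q (y - x) < \<epsilon>} \<subseteq> U \<inter> V"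
    using F F' by (intro exI[of _ "F \<union> F'"] exI[of _ "min \<epsilon> \<epsilon>'"]) auto
qed (meson Sup_least Union_upper UnionE Ball_def order_trans | blast)+

lemma openin_seminorm_topology:
  "openin (seminorm_topology S Q) U \<longleftrightarrow> U \<subseteq> S \<and>
     (\<forall>x\<in>U. \<exists>F \<epsilon>. finite F \<and> F \<subseteq> Q \<and> 0 < \<epsilon> \<and> {y\<in>S. \<forall>q\<in>F. q (y - x) < \<epsilon>} \<subseteq> U)"
  unfolding seminorm_topology_def topology_inverse'[OF istopology_seminorm_topology] by (rule refl)

lemma topspace_seminorm_topology [simp]: "topspace (seminorm_topology S Q) = S"
proof -
  have "openin (seminorm_topology S Q) S"
    unfolding openin_seminorm_topology by (auto intro!: exI[of _ "{}"] exI[of _ "1::real"])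
  then show ?thesis
    by (metis openin_seminorm_topology openin_subset openin_topspace subset_antisym)
qed

text \<open>The restriction to \<open>S\<close> matters for \<open>L1_seminorm\<close>: it is
  defined on all classes, but \<open>enn2real\<close> sends infinite integrals to 0, so
  subadditivity fails outside the integrable ones.\<close>

definition seminorm_on :: "'v::real_vector set \<Rightarrow> ('v \<Rightarrow> real) \<Rightarrow> bool" where
  "seminorm_on S q \<longleftrightarrow> (\<forall>x\<in>S. \<forall>y\<in>S. q (x + y) \<le> q x + q y) \<and> (\<forall>c. \<forall>x\<in>S. q (c *\<^sub>R x) = \<bar>c\<bar> * q x)"

lemma seminorm_onD:
  assumes "seminorm_on S q" "subspace S"
  shows "x \<in> S \<Longrightarrow> y \<in> S \<Longrightarrow> q (x + y) \<le> q x + q y" "x \<in> S \<Longrightarrow> q (c *\<^sub>R x) = \<bar>c\<bar> * q x"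
    "x \<in> S \<Longrightarrow> q (- x) = q x" "q 0 = 0" "x \<in> S \<Longrightarrow> 0 \<le> q x"
    "x \<in> S \<Longrightarrow> y \<in> S \<Longrightarrow> q (x - y) \<le> q x + q y" "x \<in> S \<Longrightarrow> y \<in> S \<Longrightarrow> q (x - y) = q (y - x)"
proof -
  show add: "x \<in> S \<Longrightarrow> y \<in> S \<Longrightarrow> q (x + y) \<le> q x + q y" for x y
    using assms by (auto simp: seminorm_on_def)
  show scale: "x \<in> S \<Longrightarrow> q (c *\<^sub>R x) = \<bar>c\<bar> * q x" for c x
    using assms by (auto simp: seminorm_on_def)
  show minus: "x \<in> S \<Longrightarrow> q (- x) = q x" for x
    using scale[of x "-1"] by simp
  show zero: "q 0 = 0"
    using scale[of 0 0] subspace_0[OF assms(2)] by simp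
  show "x \<in> S \<Longrightarrow> 0 \<le> q x"
    using add[of x "- x"] minus[of x] zero subspace_neg[OF assms(2), of x] by simp
  show "x \<in> S \<Longrightarrow> y \<in> S \<Longrightarrow> q (x - y) \<le> q x + q y"
    using add[of x "- y"] minus[of y] subspace_neg[OF assms(2), of y] by simp
  show "x \<in> S \<Longrightarrow> y \<in> S \<Longrightarrow> q (x - y) = q (y - x)"
    using minus[of "x - y"] subspace_diff[OF assms(2), of x y] by simp
qed

lemma seminorm_imp_on: "seminorm q \<Longrightarrow> seminorm_on S q"
  by (auto simp: seminorm_def seminorm_on_def)

lemma openin_seminorm_ball:
  assumes S: "subspace S" and q: "q \<in> Q" "seminorm_on S q" and a: "a \<in> S"
  shows "openin (seminorm_topology S Q) {y\<in>S. q (y - a) < e}"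
  unfolding openin_seminorm_topology
proof (intro conjI ballI)
  note D = seminorm_onD[OF q(2) S]
  fix x assume x: "x \<in> {y\<in>S. q (y - a) < e}"
  have "q (y - a) < e" if "y \<in> S" "q (y - x) < e - q (x - a)" for y
    using D(1)[of "y - x" "x - a"] that x a S by (simp add: subspace_diff)
  then show "\<exists>F \<epsilon>. finite F \<and> F \<subseteq> Q \<and> 0 < \<epsilon> \<and> {y\<in>S. \<forall>q\<in>F. q (y - x) < \<epsilon>} \<subseteq> {y\<in>S. q (y - a) < e}"
    using x q(1) by (intro exI[of _ "{q}"] exI[of _ "e - q (x - a)"]) auto
qed auto

lemma Hausdorff_seminorm_topology:
  assumes S: "subspace S" and Q: "\<And>q. q \<in> Q \<Longrightarrow> seminorm_on S q"
    and sep: "\<And>x. x \<in> S \<Longrightarrow> (\<And>q. q \<in> Q \<Longrightarrow> q x = 0) \<Longrightarrow> x = 0"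
  shows "Hausdorff_space (seminorm_topology S Q)"
  unfolding Hausdorff_space_def topspace_seminorm_topology
proof (intro allI impI)
  fix x y assume xy: "x \<in> S \<and> y \<in> S \<and> x \<noteq> y"
  then have d: "x - y \<in> S" "x - y \<noteq> 0" using S by (auto simp: subspace_diff)
  then obtain q where q: "q \<in> Q" "q (x - y) \<noteq> 0" using sep by blast
  note D = seminorm_onD[OF Q[OF q(1)] S]
  define e where "e = q (x - y) / 2"
  have e: "0 < e" using q(2) D(5)[OF d(1)] by (simp add: e_def)
  show "\<exists>U V. openin (seminorm_topology S Q) U \<and> openin (seminorm_topology S Q) V \<and> x \<in> U \<and> y \<in> V \<and> disjnt U V"
  proof (intro exI conjI)
    show "openin (seminorm_topology S Q) {z\<in>S. q (z - x) < e}" "openin (seminorm_topology S Q) {z\<in>S. q (z - y) < e}"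
      using xy by (auto intro!: openin_seminorm_ball S q Q)
    show "disjnt {z\<in>S. q (z - x) < e} {z\<in>S. q (z - y) < e}"
      unfolding disjnt_iff
    proof (intro allI notI, clarify)
      fix z assume "z \<in> S" "q (z - x) < e" "q (z - y) < e"
      then show False
        using D(6)[of "z - y" "z - x"] xy S by (simp add: subspace_diff e_def)
    qed
  qed (use xy e D(4) in auto)
qed

text \<open>Serves difference quotients and continuity at a point alike, by turning convergence
  along any filter into limits of real numbers.\<close>

lemma limitin_seminorm_topology:
  assumes S: "subspace S" and Q: "\<And>q. q \<in> Q \<Longrightarrow> seminorm_on S q"
  shows "limitin (seminorm_topology S Q) f l F \<longleftrightarrow>
    l \<in> S \<and> (\<forall>\<^sub>F x in F. f x \<in> S) \<and> (\<forall>q\<in>Q. ((\<lambda>x. q (f x - l)) \<longlongrightarrow> 0) F)"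
proof
  assume lim: "limitin (seminorm_topology S Q) f l F"
  then have l: "l \<in> S" by (auto dest: limitin_topspace)
  have ev: "\<forall>\<^sub>F x in F. f x \<in> S"
    using lim openin_topspace[of "seminorm_topology S Q"] l by (auto simp: limitin_def)
  moreover have "((\<lambda>x. q (f x - l)) \<longlongrightarrow> 0) F" if q: "q \<in> Q" for q
    unfolding tendsto_iff
  proof (intro allI impI)
    fix e :: real assume e: "0 < e"
    note D = seminorm_onD[OF Q[OF q] S]
    have "openin (seminorm_topology S Q) {y\<in>S. q (y - l) < e}"
      using q l by (intro openin_seminorm_ball S Q)
    then have "\<forall>\<^sub>F x in F. f x \<in> {y\<in>S. q (y - l) < e}"
      using lim l e D(4) by (auto simp: limitin_def)
    then show "\<forall>\<^sub>F x in F. dist (q (f x - l)) 0 < e"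
      by eventually_elim (use D(5) l S in \<open>auto simp: subspace_diff\<close>)
  qed
  ultimately show "l \<in> S \<and> (\<forall>\<^sub>F x in F. f x \<in> S) \<and> (\<forall>q\<in>Q. ((\<lambda>x. q (f x - l)) \<longlongrightarrow> 0) F)"
    using l by blast
next
  assume *: "l \<in> S \<and> (\<forall>\<^sub>F x in F. f x \<in> S) \<and> (\<forall>q\<in>Q. ((\<lambda>x. q (f x - l)) \<longlongrightarrow> 0) F)"
  show "limitin (seminorm_topology S Q) f l F"
    unfolding limitin_def
  proof (intro conjI allI impI)
    fix U assume U: "openin (seminorm_topology S Q) U \<and> l \<in> U"
    then obtain T e where T: "finite T" "T \<subseteq> Q" "0 < e" "{y\<in>S. \<forall>q\<in>T. q (y - l) < e} \<subseteq> U"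
      unfolding openin_seminorm_topology by blast
    have "\<forall>\<^sub>F x in F. q (f x - l) < e" if "q \<in> T" for q
      using * that T by (intro order_tendstoD(2)[of _ 0]) auto
    then have "\<forall>\<^sub>F x in F. \<forall>q\<in>T. q (f x - l) < e"
      using T(1) by (simp add: eventually_ball_finite)
    then show "\<forall>\<^sub>F x in F. f x \<in> U"
      using * T(4) by (auto elim: eventually_elim2)
  qed (use * in auto)
qed

section \<open>Powers of a space, directional derivatives, and smoothness by coinduction\<close>

lemma topspace_power_top:
  "topspace (power_top n E) = {x. (\<forall>i<n. x i \<in> topspace E) \<and> (\<forall>i\<ge>n. x i = 0)}"
  by (auto simp: power_top_def topspace_pullback_topology)

lemma continuous_map_power_top_proj:
  assumes "i < n"
  shows "continuous_map (power_top n E) E (\<lambda>x. x i)"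
proof -
  have "continuous_map (power_top n E) E ((\<lambda>x. x i) \<circ> (\<lambda>x. restrict x {..<n}))"
    unfolding power_top_def using assms
    by (intro continuous_map_pullback continuous_map_product_projection) auto
  then show ?thesis
    by (rule continuous_map_eq) (use assms in auto)
qed

definition concat_halves :: "nat \<Rightarrow> (nat \<Rightarrow> 'v) \<Rightarrow> (nat \<Rightarrow> 'v) \<Rightarrow> nat \<Rightarrow> 'v" where
  "concat_halves n x y i = (if i < n then x i else y (i - n))"

lemma concat_halves_simps [simp]:
  "i < n \<Longrightarrow> concat_halves n x y i = x i" "concat_halves n x y (n + i) = y i" "concat_halves n x y n = y 0"
  by (auto simp: concat_halves_def)

lemma halves_in_topspace:
  assumes "z \<in> topspace (power_top (2 * n) E)"
  shows "first_half n z \<in> topspace (power_top n E)" "second_half n z \<in> topspace (power_top n E)"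
    "concat_halves n (first_half n z) (second_half n z) = z"
  using assms by (auto simp: topspace_power_top first_half_def second_half_def concat_halves_def fun_eq_iff)

lemma first_half_concat_halves:
  "x \<in> topspace (power_top n E) \<Longrightarrow> first_half n (concat_halves n x y) = x"
  by (auto simp: topspace_power_top first_half_def concat_halves_def fun_eq_iff)

lemma has_directional_derivative_unique:
  assumes "Hausdorff_space F" "has_directional_derivative F f x y l" "has_directional_derivative F f x y l'"
  shows "l = l'"
  using assms limitin_Hausdorff_unique[of F _ l "at (0::real)" l']
  by (auto simp: has_directional_derivative_def)

lemma dir_deriv_eq:
  assumes "Hausdorff_space F" "has_directional_derivative F f x y l"
  shows "dir_deriv F f x y = l"
  unfolding dir_deriv_def using assms has_directional_derivative_unique by blast

lemma has_directional_derivative_cong: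
  assumes "has_directional_derivative F f x y l"
    and "\<forall>\<^sub>F t in at 0. g (x + t *\<^sub>R y) = f (x + t *\<^sub>R y)" "g x = f x"
  shows "has_directional_derivative F g x y l"
  using assms(1) unfolding has_directional_derivative_def
  by (rule limitin_transform_eventually[rotated])
     (use assms(2,3) in \<open>auto elim: eventually_mono\<close>)

definition derivative_on :: "'v::real_vector topology \<Rightarrow> 'w::real_vector topology \<Rightarrow> nat \<Rightarrow> (nat \<Rightarrow> 'v) set \<Rightarrow>
    ((nat \<Rightarrow> 'v) \<Rightarrow> 'w) \<Rightarrow> ((nat \<Rightarrow> 'v) \<Rightarrow> 'w) \<Rightarrow> bool" where
  "derivative_on E F n D f f' \<longleftrightarrow> (\<forall>x\<in>D. \<forall>y\<in>topspace (power_top n E).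
     has_directional_derivative F f x y (f' (concat_halves n x y)))"

text \<open>\<open>C\<close> is an invariant: its members are continuous, and a derivative of a
  member in \<open>n\<close> variables is a member in \<open>2 * n\<close> variables, so all
  iterated derivatives stay inside. The variables added by a derivation are directions ranging over
  all of \<open>E\<close>; hence only coordinate 0 is confined to \<open>U\<close>.\<close>

theorem smooth_on_coinduct:
  fixes E :: "'v::real_vector topology" and F :: "'w::real_vector topology"
    and C :: "nat \<Rightarrow> ((nat \<Rightarrow> 'v) \<Rightarrow> 'w) \<Rightarrow> bool"
  defines "D \<equiv> \<lambda>n U. {z \<in> topspace (power_top n E). z 0 \<in> U}"
  assumes F: "Hausdorff_space F"
    and E: "subspace (topspace E)"
    and U: "openin E U" "\<And>x y. x \<in> U \<Longrightarrow> y \<in> topspace E \<Longrightarrow> \<forall>\<^sub>F t in at 0. x + t *\<^sub>R y \<in> U"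
    and C1: "C 1 g" "\<And>z. z 0 \<in> U \<Longrightarrow> g z = f (z 0)"
    and cont: "\<And>n h. 0 < n \<Longrightarrow> C n h \<Longrightarrow> continuous_map (subtopology (power_top n E) (D n U)) F h"
    and deriv: "\<And>n h. 0 < n \<Longrightarrow> C n h \<Longrightarrow>
      \<exists>h'. C (2 * n) h' \<and> derivative_on E F n (D n U) h h'"
  shows "smooth_on E F U f"
proof -
  have D2: "{z \<in> topspace (power_top (2 * n) E). first_half n z \<in> D n U} = D (2 * n) U" if "0 < n" for n
    using that halves_in_topspace by (auto simp: D_def first_half_def)
  have ev: "\<forall>\<^sub>F t in at 0. x + t *\<^sub>R y \<in> D n U"
    if "0 < n" "x \<in> D n U" "y \<in> topspace (power_top n E)" for n x y
  proof -
    have "\<forall>\<^sub>F t in at 0. x 0 + t *\<^sub>R y 0 \<in> U"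
      using that by (intro U(2)) (auto simp: D_def topspace_power_top)
    then show ?thesis
      using that E by (auto simp: D_def topspace_power_top plus_fun_def scaleR_fun_def subspace_add
          subspace_scale elim!: eventually_mono)
  qed
  \<comment> \<open>Generalized to every \<open>g'\<close> that agrees with \<open>h\<close> on the
    domain, because \<open>dir_deriv\<close> is a definite description and equals the intended
    derivative only there.\<close>
  have Ck: "Ck_power k E F n (D n U) g'"
    if "0 < n" "C n h" "\<And>x. x \<in> D n U \<Longrightarrow> g' x = h x" for k n h g'
    using that
  proof (induction k arbitrary: n h g')
    case 0
    then show ?case
      using continuous_map_eq[OF cont[OF 0(1,2)], of g'] by simp
  next
    case (Suc k)
    have c: "continuous_map (subtopology (power_top n E) (D n U)) F g'"
      using continuous_map_eq[OF cont[OF Suc.prems(1,2)], of g'] Suc.prems(3) by simp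
    obtain h' where h': "C (2 * n) h'"
      "\<And>x y. x\<in>D n U \<Longrightarrow> y\<in>topspace (power_top n E) \<Longrightarrow>
        has_directional_derivative F h x y (h' (concat_halves n x y))"
      using deriv[OF Suc.prems(1,2)] unfolding derivative_on_def by blast
    have d: "has_directional_derivative F g' x y (h' (concat_halves n x y))"
      if xy: "x\<in>D n U" "y\<in>topspace (power_top n E)" for x y
      using Suc.prems(3) xy
      by (intro has_directional_derivative_cong[OF h'(2)] eventually_mono[OF ev[OF Suc.prems(1) xy]]) auto
    have "Ck_power k E F (2 * n) (D (2 * n) U) (\<lambda>z. dir_deriv F g' (first_half n z) (second_half n z))"
    proof (rule Suc.IH[OF _ h'(1)])
      fix z assume "z \<in> D (2 * n) U"
      then have z: "z \<in> topspace (power_top (2 * n) E)" "first_half n z \<in> D n U"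
        using D2[OF Suc.prems(1)] by auto
      show "dir_deriv F g' (first_half n z) (second_half n z) = h' z"
        using dir_deriv_eq[OF F d[OF z(2) halves_in_topspace(2)[OF z(1)]]] halves_in_topspace(3)[OF z(1)]
        by simp
    qed (use Suc.prems in auto)
    then show ?case
      using c d D2[OF Suc.prems(1)] by auto
  qed
  have "Ck_power k E F 1 (D 1 U) (\<lambda>x. f (x 0))" for k
    using C1 by (intro Ck[of 1 g]) (auto simp: D_def)
  then show ?thesis
    using U(1) by (simp add: smooth_on_def Ck_on_def D_def)
qed


section \<open>The Lie group of units\<close>

interpretation mult_monoid: monoid "mult_monoid :: 'a::monoid_mult monoid"
  rewrites "carrier mult_monoid = (UNIV :: 'a set)"
    and "monoid.mult mult_monoid = (times :: 'a \<Rightarrow> 'a \<Rightarrow> 'a)"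
    and "one mult_monoid = (1 :: 'a)"
  by (unfold_locales) (auto simp: mult_monoid_def mult.assoc)

lemma carrier_unit_group [simp]: "carrier unit_group = Units mult_monoid"
  and mult_unit_group [simp]: "x \<otimes>\<^bsub>unit_group\<^esub> y = x * y"
  and one_unit_group [simp]: "\<one>\<^bsub>unit_group\<^esub> = 1"
  and atlas_unit_group [simp]: "atlas unit_group = {(Units mult_monoid, \<lambda>x. x)}"
  by (simp_all add: unit_group_def)

lemma group_unit_group: "group (unit_group :: ('a::continuous_inverse_algebra, 'a) group_atlas)"
proof (rule groupI)
  fix x :: 'a assume "x \<in> carrier unit_group"
  then show "\<exists>y\<in>carrier unit_group. y \<otimes>\<^bsub>unit_group\<^esub> x = \<one>\<^bsub>unit_group\<^esub>"
    using mult_monoid.Units_inv_Units mult_monoid.Units_l_inv by (intro bexI[of _ "m_inv mult_monoid x"]) auto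
qed (auto simp: mult.assoc)

lemma inv_unit_group:
  fixes x :: "'a::continuous_inverse_algebra"
  assumes "x \<in> Units mult_monoid"
  shows "inv\<^bsub>unit_group\<^esub> x = m_inv mult_monoid x"
  using assms by (intro group.inv_equality[OF group_unit_group]) auto

lemma Hausdorff_space_euclidean_t2: "Hausdorff_space (euclidean :: 'b::t2_space topology)"
  unfolding Hausdorff_space_def disjnt_def by (metis hausdorff open_openin)

lemma tendsto_scaleR_lc:
  fixes g :: "'b \<Rightarrow> 'v::locally_convex_space"
  assumes "(f \<longlongrightarrow> c) F" "(g \<longlongrightarrow> x) F"
  shows "((\<lambda>t. f t *\<^sub>R g t) \<longlongrightarrow> c *\<^sub>R x) F"
  using filterlim_compose[OF tendsto_scaleR_Pair filterlim_Pair[OF assms]] by simp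

lemma continuous_map_euclidean_atin:
  "continuous_map X euclidean f \<longleftrightarrow> (\<forall>x\<in>topspace X. (f \<longlongrightarrow> f x) (atin X x))"
  by (simp add: continuous_map_atin)

lemma tendsto_along_line:
  fixes x y :: "'v::locally_convex_space"
  shows "((\<lambda>t. x + t *\<^sub>R y) \<longlongrightarrow> x) (at 0)"
proof -
  have "((\<lambda>t::real. x + t *\<^sub>R y) \<longlongrightarrow> x + 0 *\<^sub>R y) (at 0)"
    by (intro tendsto_intros tendsto_scaleR_lc)
  then show ?thesis by simp
qed

lemma has_directional_derivative_imp_tendsto:
  fixes f :: "'v::real_vector \<Rightarrow> 'w::locally_convex_space"
  assumes "has_directional_derivative euclidean f x y l"
  shows "((\<lambda>t. f (x + t *\<^sub>R y)) \<longlongrightarrow> f x) (at 0)"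
proof -
  have "((\<lambda>t. f x + t *\<^sub>R ((f (x + t *\<^sub>R y) - f x) /\<^sub>R t)) \<longlongrightarrow> f x + 0 *\<^sub>R l) (at 0)"
    using assms unfolding has_directional_derivative_def
    by (intro tendsto_intros tendsto_scaleR_lc) simp
  moreover have "\<forall>\<^sub>F t in at 0. f x + t *\<^sub>R ((f (x + t *\<^sub>R y) - f x) /\<^sub>R t) = f (x + t *\<^sub>R y)"
    unfolding eventually_at by (auto intro: exI[of _ 1])
  ultimately show ?thesis
    by (auto intro: Lim_transform_eventually)
qed

lemma has_directional_derivative_add:
  fixes f g :: "'v::real_vector \<Rightarrow> 'w::locally_convex_space"
  assumes "has_directional_derivative euclidean f x y l" "has_directional_derivative euclidean g x y m"
  shows "has_directional_derivative euclidean (\<lambda>z. f z + g z) x y (l + m)"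
  using tendsto_add[OF assms[unfolded has_directional_derivative_def limitin_canonical_iff]]
  by (simp add: has_directional_derivative_def algebra_simps)

lemma has_directional_derivative_minus:
  fixes f :: "'v::real_vector \<Rightarrow> 'w::locally_convex_space"
  assumes "has_directional_derivative euclidean f x y l"
  shows "has_directional_derivative euclidean (\<lambda>z. - f z) x y (- l)"
  using tendsto_minus[OF assms[unfolded has_directional_derivative_def limitin_canonical_iff]]
  by (simp add: has_directional_derivative_def algebra_simps)

lemma has_directional_derivative_mult:
  fixes f g :: "'v::real_vector \<Rightarrow> 'a::continuous_inverse_algebra"
  assumes "has_directional_derivative euclidean f x y l" "has_directional_derivative euclidean g x y m"
  shows "has_directional_derivative euclidean (\<lambda>z. f z * g z) x y (l * g x + f x * m)"
proof -
  have "((\<lambda>t. (f (x + t *\<^sub>R y) - f x) /\<^sub>R t * g (x + t *\<^sub>R y) + f x * ((g (x + t *\<^sub>R y) - g x) /\<^sub>R t)) \<longlongrightarrow>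
      l * g x + f x * m) (at 0)"
    by (intro tendsto_intros assms[unfolded has_directional_derivative_def limitin_canonical_iff]
        has_directional_derivative_imp_tendsto[OF assms(2)])
  then show ?thesis
    by (simp add: has_directional_derivative_def algebra_simps)
qed

text \<open>
  For \<open>\<Lambda>\<close> a set of continuous linear maps, these maps on \<open>E\<^sup>n\<close> are stable under directional
  derivatives, because \<open>x \<mapsto> x\<^sup>-\<^sup>1\<close> has the derivative \<open>y \<mapsto> - x\<^sup>-\<^sup>1 y x\<^sup>-\<^sup>1\<close>.
\<close>

inductive rational_map :: "('v::real_vector \<Rightarrow> 'a::continuous_inverse_algebra) set \<Rightarrow> ('v \<Rightarrow> 'a) set \<Rightarrow>
    nat \<Rightarrow> ((nat \<Rightarrow> 'v) \<Rightarrow> 'a) \<Rightarrow> bool" for \<Lambda> I where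
  proj: "l \<in> \<Lambda> \<Longrightarrow> i < n \<Longrightarrow> rational_map \<Lambda> I n (\<lambda>z. l (z i))"
| add: "rational_map \<Lambda> I n f \<Longrightarrow> rational_map \<Lambda> I n g \<Longrightarrow> rational_map \<Lambda> I n (\<lambda>z. f z + g z)"
| minus: "rational_map \<Lambda> I n f \<Longrightarrow> rational_map \<Lambda> I n (\<lambda>z. - f z)"
| mult: "rational_map \<Lambda> I n f \<Longrightarrow> rational_map \<Lambda> I n g \<Longrightarrow> rational_map \<Lambda> I n (\<lambda>z. f z * g z)"
| inverse: "l \<in> I \<Longrightarrow> 0 < n \<Longrightarrow> rational_map \<Lambda> I n (\<lambda>z. m_inv mult_monoid (l (z 0)))"

lemma rational_map_first_half:
  "rational_map \<Lambda> I n f \<Longrightarrow> rational_map \<Lambda> I (2 * n) (\<lambda>z. f (first_half n z))"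
proof (induction rule: rational_map.induct)
  case (proj l i n)
  then have "(\<lambda>z. l (first_half n z i)) = (\<lambda>z. l (z i))"
    by (auto simp: first_half_def)
  then show ?case using proj by (auto intro: rational_map.proj)
next
  case (inverse l n)
  then have "(\<lambda>z. m_inv mult_monoid (l (first_half n z 0))) = (\<lambda>z. m_inv mult_monoid (l (z 0)))"
    by (auto simp: first_half_def)
  then show ?case using inverse by (auto intro: rational_map.inverse)
qed (auto intro: rational_map.intros)

lemma continuous_map_linear_proj:
  assumes "continuous_map E euclidean l" "i < n"
  shows "continuous_map (subtopology (power_top n E) S) euclidean (\<lambda>z. l (z i))"
  using continuous_map_compose[OF continuous_map_power_top_proj[OF assms(2)] assms(1)]
  by (auto simp: o_def intro: continuous_map_from_subtopology)

lemma continuous_map_rational_map: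
  assumes "rational_map \<Lambda> I n f"
    and \<Lambda>: "\<And>l. l \<in> \<Lambda> \<Longrightarrow> continuous_map E euclidean l" "I \<subseteq> \<Lambda>"
    and U: "\<And>l x. l \<in> I \<Longrightarrow> x \<in> U \<Longrightarrow> l x \<in> Units mult_monoid"
  shows "continuous_map (subtopology (power_top n E) {z \<in> topspace (power_top n E). z 0 \<in> U}) euclidean f"
  using assms(1)
proof (induction rule: rational_map.induct)
  case (proj l i n)
  then show ?case using \<Lambda> by (intro continuous_map_linear_proj) auto
next
  case (inverse l n)
  have "continuous_map (subtopology (power_top n E) {z \<in> topspace (power_top n E). z 0 \<in> U})
      euclidean (\<lambda>z. l (z 0))"
    using inverse \<Lambda> by (intro continuous_map_linear_proj) auto
  then show ?case
    unfolding continuous_map_euclidean_atin using inverse U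
    by (auto intro!: filterlim_compose[OF tendsto_m_inv])
qed (auto simp: continuous_map_euclidean_atin intro!: tendsto_intros)

text \<open>If \<open>c\<close> inverts \<open>a + t b\<close> and \<open>d\<close> inverts
  \<open>a\<close>, then \<open>c - d = - t c b d\<close>. The quotient is thus a product whose
  limit comes from the continuity of inversion.\<close>

lemma has_directional_derivative_m_inv:
  fixes a b :: "'a::continuous_inverse_algebra"
  assumes a: "a \<in> Units mult_monoid"
  shows "((\<lambda>t. (m_inv mult_monoid (a + t *\<^sub>R b) - m_inv mult_monoid a) /\<^sub>R t) \<longlongrightarrow>
    - (m_inv mult_monoid a * b * m_inv mult_monoid a)) (at 0)"
proof -
  have "((\<lambda>t. m_inv mult_monoid (a + t *\<^sub>R b)) \<longlongrightarrow> m_inv mult_monoid a) (at 0)"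
    by (rule filterlim_compose[OF tendsto_m_inv[OF a] tendsto_along_line])
  then have "((\<lambda>t. - (m_inv mult_monoid (a + t *\<^sub>R b) * b * m_inv mult_monoid a)) \<longlongrightarrow>
      - (m_inv mult_monoid a * b * m_inv mult_monoid a)) (at 0)"
    by (intro tendsto_intros)
  moreover have "\<forall>\<^sub>F t in at 0. a + t *\<^sub>R b \<in> Units mult_monoid"
    using topological_tendstoD[OF tendsto_along_line[of a b] open_Units a] by simp
  then have "\<forall>\<^sub>F t in at 0. - (m_inv mult_monoid (a + t *\<^sub>R b) * b * m_inv mult_monoid a) =
      (m_inv mult_monoid (a + t *\<^sub>R b) - m_inv mult_monoid a) /\<^sub>R t"
    using eventually_neq_at_within[of 0 0 UNIV]
  proof eventually_elim
    case (elim t)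
      let ?c = "m_inv mult_monoid (a + t *\<^sub>R b)"
      have "?c * (a + t *\<^sub>R b) * m_inv mult_monoid a = m_inv mult_monoid a"
        using elim by simp
      moreover have "?c * a * m_inv mult_monoid a = ?c"
        using a by (simp add: mult.assoc)
      ultimately have "?c - m_inv mult_monoid a = - (t *\<^sub>R (?c * b * m_inv mult_monoid a))"
        by (simp add: algebra_simps)
      then show ?case using elim by simp
  qed
  ultimately show ?thesis
    by (rule Lim_transform_eventually)
qed

text \<open>Inverses occur only of linear functions of coordinate 0, the one coordinate confined to
  \<open>U\<close>. Its direction is coordinate \<open>n\<close> of the doubled power, whence
  \<open>l (z n)\<close> in the derivative; factors that are not differentiated are read off the
  first half.\<close>

lemma rational_map_derivative_on:
  fixes E :: "'v::real_vector topology" and f :: "(nat \<Rightarrow> 'v) \<Rightarrow> 'a::continuous_inverse_algebra"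
  assumes "rational_map \<Lambda> I n f"
    and \<Lambda>: "\<And>l. l \<in> \<Lambda> \<Longrightarrow> linear l" "I \<subseteq> \<Lambda>"
    and U: "\<And>l x. l \<in> I \<Longrightarrow> x \<in> U \<Longrightarrow> l x \<in> Units mult_monoid"
  defines "D \<equiv> \<lambda>n. {z \<in> topspace (power_top n E). z 0 \<in> U}"
  shows "\<exists>f'. rational_map \<Lambda> I (2 * n) f' \<and> derivative_on E euclidean n (D n) f f'"
  using assms(1)
proof (induction rule: rational_map.induct)
  case (proj l i n)
  have "has_directional_derivative euclidean (\<lambda>z. l (z i)) x y (l (y i))" for x y
  proof -
    have "\<forall>\<^sub>F t in at 0. l (y i) = (l ((x + t *\<^sub>R y) i) - l (x i)) /\<^sub>R t"
      using linear_add[OF \<Lambda>(1)[OF proj(1)]] linear_scale[OF \<Lambda>(1)[OF proj(1)]]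
      unfolding eventually_at by (auto simp: scaleR_fun_def intro: exI[of _ 1])
    then show ?thesis
      unfolding has_directional_derivative_def limitin_canonical_iff
      by (rule Lim_transform_eventually[OF tendsto_const])
  qed
  then show ?case
    using proj by (intro exI[of _ "\<lambda>z. l (z (n + i))"]) (auto simp: derivative_on_def intro: rational_map.proj)
next
  case (add n f g)
  then obtain f' g' where "rational_map \<Lambda> I (2 * n) f'" "derivative_on E euclidean n (D n) f f'"
    "rational_map \<Lambda> I (2 * n) g'" "derivative_on E euclidean n (D n) g g'"
    by blast
  then show ?case
    by (intro exI[of _ "\<lambda>z. f' z + g' z"])
       (auto simp: derivative_on_def intro: rational_map.add has_directional_derivative_add)
next
  case (minus n f)
  then obtain f' where "rational_map \<Lambda> I (2 * n) f'" "derivative_on E euclidean n (D n) f f'"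
    by blast
  then show ?case
    by (intro exI[of _ "\<lambda>z. - f' z"])
       (auto simp: derivative_on_def intro: rational_map.minus has_directional_derivative_minus)
next
  case (mult n f g)
  then obtain f' g' where "rational_map \<Lambda> I (2 * n) f'" "derivative_on E euclidean n (D n) f f'"
    "rational_map \<Lambda> I (2 * n) g'" "derivative_on E euclidean n (D n) g g'"
    by blast
  then show ?case
    using mult.hyps
    by (intro exI[of _ "\<lambda>z. f' z * g (first_half n z) + f (first_half n z) * g' z"])
       (auto intro!: rational_map.add rational_map.mult rational_map_first_half has_directional_derivative_mult
         simp: derivative_on_def D_def first_half_concat_halves)
next
  case (inverse l n)
  have "has_directional_derivative euclidean (\<lambda>z. m_inv mult_monoid (l (z 0))) x y
      (- (m_inv mult_monoid (l (x 0)) * l (y 0) * m_inv mult_monoid (l (x 0))))"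
    if "x 0 \<in> U" for x y
    using has_directional_derivative_m_inv[OF U[OF inverse(1) that], of "l (y 0)"]
      linear_add[OF \<Lambda>(1)[of l]] linear_scale[OF \<Lambda>(1)[of l]] \<Lambda>(2) inverse(1)
    by (auto simp: has_directional_derivative_def scaleR_fun_def subset_iff)
  moreover have "rational_map \<Lambda> I (2 * n)
      (\<lambda>z. - (m_inv mult_monoid (l (z 0)) * l (z n) * m_inv mult_monoid (l (z 0))))"
    using inverse \<Lambda>(2) by (intro rational_map.intros) auto
  ultimately show ?case
    using inverse unfolding derivative_on_def D_def
    by (intro exI[of _ "\<lambda>z. - (m_inv mult_monoid (l (z 0)) * l (z n) * m_inv mult_monoid (l (z 0)))"]) auto
qed

text \<open>The abstract \<open>E\<close> covers both group operations: inversion on the algebra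
  itself, and multiplication on the product space with
  \<open>\<Lambda> = {fst, snd}\<close>.\<close>

theorem smooth_on_rational_map:
  fixes E :: "'v::real_vector topology" and f :: "'v \<Rightarrow> 'a::continuous_inverse_algebra"
  assumes "rational_map \<Lambda> I 1 g" "\<And>z. z 0 \<in> U \<Longrightarrow> g z = f (z 0)"
    and \<Lambda>: "\<And>l. l \<in> \<Lambda> \<Longrightarrow> linear l \<and> continuous_map E euclidean l" "I \<subseteq> \<Lambda>"
    and U: "openin E U" "\<And>l x. l \<in> I \<Longrightarrow> x \<in> U \<Longrightarrow> l x \<in> Units mult_monoid"
    and E: "subspace (topspace E)"
      "\<And>x y. x \<in> U \<Longrightarrow> y \<in> topspace E \<Longrightarrow> \<forall>\<^sub>F t in at 0. x + t *\<^sub>R y \<in> U"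
  shows "smooth_on E euclidean U f"
proof (rule smooth_on_coinduct[where C = "rational_map \<Lambda> I" and g = g])
  show "Hausdorff_space (euclidean :: 'a topology)" by (rule Hausdorff_space_euclidean_t2)
  fix n :: nat and h assume h: "rational_map \<Lambda> I n h"
  show "continuous_map (subtopology (power_top n E) {z \<in> topspace (power_top n E). z 0 \<in> U}) euclidean h"
    using \<Lambda> U by (intro continuous_map_rational_map[OF h]) auto
  show "\<exists>h'. rational_map \<Lambda> I (2 * n) h' \<and>
    derivative_on E euclidean n {z \<in> topspace (power_top n E). z 0 \<in> U} h h'"
    using \<Lambda> U by (intro rational_map_derivative_on[OF h]) auto
qed (use assms in auto)

section \<open>The unit group as a manifold with one chart\<close>

lemma openin_imp_eventually_line:
  fixes x y :: "'v::locally_convex_space"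
  assumes "open U" "x \<in> U"
  shows "\<forall>\<^sub>F t in at 0. x + t *\<^sub>R y \<in> U"
  using topological_tendstoD[OF tendsto_along_line assms] by simp

lemma open_imp_eventually_line_prod:
  fixes p q :: "'v::locally_convex_space \<times> 'v"
  assumes "openin (prod_topology euclidean euclidean) U" "p \<in> U"
  shows "\<forall>\<^sub>F t in at 0. p + t *\<^sub>R q \<in> U"
proof -
  obtain V W where VW: "open V" "open W" "fst p \<in> V" "snd p \<in> W" "V \<times> W \<subseteq> U"
    using assms unfolding openin_prod_topology_alt by (cases p) (simp, metis)
  have "\<forall>\<^sub>F t in at 0. fst p + t *\<^sub>R fst q \<in> V" "\<forall>\<^sub>F t in at 0. snd p + t *\<^sub>R snd q \<in> W"
    using openin_imp_eventually_line VW by blast+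
  then show ?thesis
    by eventually_elim (use VW in \<open>cases p; cases q; auto\<close>)
qed

text \<open>The chart expression contains \<open>inv_into U (\<lambda>x. x)\<close>, which is the
  identity on \<open>U\<close> only. Smoothness is therefore demanded of every map with the right
  values on \<open>U\<close>.\<close>

lemma smooth_map_single_chart:
  assumes "(V, \<psi>) \<in> B" "f ` U \<subseteq> V" "openin E U"
    and "\<And>f'. (\<And>x. x \<in> U \<Longrightarrow> f' x = \<psi> (f x)) \<Longrightarrow> smooth_on E F U f'"
  shows "smooth_map E {(U, \<lambda>x. x)} F B f"
proof -
  have "inv_into U (\<lambda>x. x) y = y" if "y \<in> U" for y
    using that by (intro inv_into_f_eq) (auto simp: inj_on_def)
  then have "smooth_on E F U (\<lambda>y. \<psi> (f (inv_into U (\<lambda>x. x) y)))"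
    by (intro assms(4)) auto
  then show ?thesis
    unfolding smooth_map_def using assms(1-3)
    by (intro ballI bexI[of _ "(V, \<psi>)"] bexI[of _ "(U, \<lambda>x. x)"]) auto
qed

lemma atlas_topology_single_chart:
  assumes "openin E X"
  shows "atlas_topology E X {(X, \<lambda>x. x)} = subtopology E X"
proof -
  have "(\<lambda>W. W \<subseteq> X \<and> (\<forall>(U, \<phi>)\<in>{(X, \<lambda>x. x)}. openin E (\<phi> ` (W \<inter> U)))) = openin (subtopology E X)"
    using assms by (auto simp: openin_open_subtopology Int_absorb2 fun_eq_iff)
  then show ?thesis
    unfolding atlas_topology_def by (simp add: openin_inverse)
qed

lemma smooth_on_id:
  fixes U :: "'a::continuous_inverse_algebra set"
  assumes "open U" "\<And>x. x \<in> U \<Longrightarrow> f x = x"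
  shows "smooth_on euclidean euclidean U f"
  using assms linear_ident
  by (intro smooth_on_rational_map[where \<Lambda> = "{\<lambda>x. x}" and I = "{}", OF rational_map.proj[of "\<lambda>x. x" _ 0]])
     (auto intro: openin_imp_eventually_line)

lemma unit_group_chart:
  "(Units mult_monoid, \<lambda>x. x) \<in>
    lie_charts euclidean (unit_group :: ('a::continuous_inverse_algebra, 'a) group_atlas)"
proof -
  let ?U = "Units (mult_monoid :: 'a monoid)"
  have "smooth_on euclidean euclidean ?U (\<lambda>y. inv_into ?U (\<lambda>x. x) y)"
    using open_Units inv_into_f_eq[of "\<lambda>x. x" ?U]
    by (intro smooth_on_id) (auto simp: inj_on_def)
  then show ?thesis
    using open_Units by (auto simp: charts_def compatible_def inj_on_def)
qed

theorem lie_group_unit_group: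
  "lie_group euclidean (unit_group :: ('a::continuous_inverse_algebra, 'a) group_atlas)"
proof -
  let ?U = "Units (mult_monoid :: 'a monoid)"
  have "smooth_atlas euclidean ?U {(?U, \<lambda>x. x)}"
    unfolding smooth_atlas_def
  proof (intro conjI)
    show "Hausdorff_space (atlas_topology euclidean ?U {(?U, \<lambda>x. x)})"
      using open_Units by (subst atlas_topology_single_chart) (auto intro: Hausdorff_space_subtopology Hausdorff_space_euclidean_t2)
  qed (use unit_group_chart in auto)
  moreover have "smooth_map (prod_topology euclidean euclidean) {(?U \<times> ?U, \<lambda>x. x)} euclidean {(?U, \<lambda>x. x)}
      (\<lambda>(g, h). g * h)"
  proof (rule smooth_map_single_chart)
    show op: "openin (prod_topology euclidean euclidean) (?U \<times> ?U)"
      by (simp add: open_Times open_Units)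
    fix f' assume f': "\<And>x :: 'a \<times> 'a. x \<in> ?U \<times> ?U \<Longrightarrow> f' x = (case x of (g, h) \<Rightarrow> g * h)"
    show "smooth_on (prod_topology euclidean euclidean) euclidean (?U \<times> ?U) f'"
    proof (rule smooth_on_rational_map[where \<Lambda> = "{fst, snd}" and I = "{}"])
      show "rational_map {fst, snd} {} 1 (\<lambda>z. fst (z 0) * snd (z 0) :: 'a)"
        by (intro rational_map.intros) auto
    qed (use f' op in \<open>auto simp: linear_fst linear_snd intro!: continuous_on_fst continuous_on_snd continuous_on_id
         intro: open_imp_eventually_line_prod[OF op]\<close>)
  qed auto
  moreover have "smooth_map euclidean {(?U, \<lambda>x. x)} euclidean {(?U, \<lambda>x. x)} (\<lambda>g. inv\<^bsub>unit_group\<^esub> g)"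
  proof (rule smooth_map_single_chart)
    fix f' assume f': "\<And>x :: 'a. x \<in> ?U \<Longrightarrow> f' x = inv\<^bsub>unit_group\<^esub> x"
    show "smooth_on euclidean euclidean ?U f'"
    proof (rule smooth_on_rational_map[where \<Lambda> = "{\<lambda>x. x}" and I = "{\<lambda>x. x}"])
      show "rational_map {\<lambda>x. x} {\<lambda>x. x} 1 (\<lambda>z. m_inv mult_monoid (z 0) :: 'a)"
        using rational_map.inverse[of "\<lambda>x. x" "{\<lambda>x. x}" 1] by auto
    qed (use f' open_Units linear_ident in \<open>auto simp: inv_unit_group intro: openin_imp_eventually_line\<close>)
  qed (use open_Units in \<open>auto simp: inv_unit_group\<close>)
  moreover have eq: "(\<lambda>(g, h). g \<otimes>\<^bsub>unit_group\<^esub> h) = (\<lambda>(g, h). g * h :: 'a)"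
    by (simp add: fun_eq_iff)
  ultimately show ?thesis
    unfolding lie_group_def eq
    by (simp add: group_unit_group product_atlas_def map_prod_ident)
qed


section \<open>Separably valued measurable functions\<close>

lemma seminormD:
  assumes "seminorm q"
  shows "q (x + y) \<le> q x + q y" "q (c *\<^sub>R x) = \<bar>c\<bar> * q x" "q (- x) = q x" "q 0 = 0" "0 \<le> q x"
    "q (x - y) \<le> q x + q y" "q (x - y) = q (y - x)" "\<bar>q x - q y\<bar> \<le> q (x - y)"
proof -
  note D = seminorm_onD[OF seminorm_imp_on[OF assms] subspace_UNIV, simplified]
  show "q (x + y) \<le> q x + q y" "q (c *\<^sub>R x) = \<bar>c\<bar> * q x" "q (- x) = q x" "q 0 = 0" "0 \<le> q x"
    "q (x - y) \<le> q x + q y" "q (x - y) = q (y - x)"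
    using D by blast+
  show "\<bar>q x - q y\<bar> \<le> q (x - y)"
    using D(1)[of "x - y" y] D(1)[of "y - x" x] D(7)[of x y] by simp
qed

text \<open>Monotonicity lets one index stand for finitely many conditions: any neighbourhood of 0
  contains a ball of a single \<open>p n\<close>, and any two such balls contain a third
  one.\<close>

locale frechet_seminorms =
  fixes p :: "nat \<Rightarrow> 'e::locally_convex_space \<Rightarrow> real"
  assumes p_seminorm: "seminorm (p n)"
    and p_cont: "continuous_on UNIV (p n)"
    and p_mono: "m \<le> n \<Longrightarrow> p m x \<le> p n x"
    and p_base: "open U \<Longrightarrow> 0 \<in> U \<Longrightarrow> \<exists>n. \<exists>e>0. \<forall>x. p n x < e \<longrightarrow> x \<in> U"
    and p_complete: "(\<And>n e. 0 < e \<Longrightarrow> \<exists>N. \<forall>i\<ge>N. \<forall>j\<ge>N. p n (X i - X j) < e) \<Longrightarrow> convergent X"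
begin

lemmas p_simps = seminormD[OF p_seminorm]

lemma p_triangle: "p n (x - z) \<le> p n (x - y) + p n (y - z)"
  using p_simps(1)[of n "x - y" "y - z"] by simp

lemma open_p_ball: "open {x. p n (x - a) < e}"
proof -
  have "continuous_on UNIV (\<lambda>x. p n (x - a))"
    by (intro continuous_on_compose2[OF p_cont] continuous_intros) auto
  then show ?thesis
    by (intro open_Collect_less) auto
qed

lemma open_contains_p_ball:
  assumes "open S" "a \<in> S"
  obtains n e where "0 < e" "\<And>x. p n (x - a) < e \<Longrightarrow> x \<in> S"
proof -
  have "open ((\<lambda>z. z + a) -` S)"
    using assms by (intro open_vimage continuous_intros) auto
  then obtain n e where e: "0 < e" "\<And>x. p n x < e \<Longrightarrow> x + a \<in> S"
    using p_base[of "(\<lambda>z. z + a) -` S"] assms by auto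
  show ?thesis
    by (rule that[OF e(1)]) (use e(2)[of "_ - a"] in simp)
qed

lemma tendsto_iff_p: "(f \<longlongrightarrow> l) F \<longleftrightarrow> (\<forall>n. ((\<lambda>x. p n (f x - l)) \<longlongrightarrow> 0) F)"
proof (intro iffI allI)
  fix n assume "(f \<longlongrightarrow> l) F"
  then have "((\<lambda>x. f x - l) \<longlongrightarrow> l - l) F"
    by (intro tendsto_intros)
  then have "((\<lambda>x. p n (f x - l)) \<longlongrightarrow> p n 0) F"
    using p_cont[of n] by (auto simp: continuous_on_eq_continuous_at isCont_def
        intro: tendsto_compose)
  then show "((\<lambda>x. p n (f x - l)) \<longlongrightarrow> 0) F"
    by (simp add: p_simps)
next
  assume *: "\<forall>n. ((\<lambda>x. p n (f x - l)) \<longlongrightarrow> 0) F"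
  show "(f \<longlongrightarrow> l) F"
  proof (rule topological_tendstoI)
    fix S assume "open S" "l \<in> S"
    then obtain n e where e: "0 < e" "\<And>x. p n (x - l) < e \<Longrightarrow> x \<in> S"
      by (metis open_contains_p_ball)
    then have "\<forall>\<^sub>F x in F. p n (f x - l) < e"
      using * order_tendstoD(2) by blast
    then show "\<forall>\<^sub>F x in F. f x \<in> S"
      by eventually_elim (rule e)
  qed
qed

lemma p_eq_0_imp: "(\<And>n. p n x = 0) \<Longrightarrow> x = 0"
proof (rule ccontr)
  assume *: "\<And>n. p n x = 0" "x \<noteq> 0"
  then obtain S where "open S" "0 \<in> S" "x \<notin> S"
    using t1_space[of 0 x] by auto
  with p_base[of S] * show False by auto
qed

lemma cont_seminorm_p [simp]: "cont_seminorm (p n)"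
  by (simp add: cont_seminorm_def p_seminorm p_cont)

text \<open>A ball of some \<open>p n\<close> lies in the unit ball of \<open>q\<close>; scaling a
  vector by \<open>1 / q x\<close> makes this a global estimate.\<close>

lemma cont_seminorm_le_p:
  assumes "cont_seminorm q"
  obtains n C where "0 < C" "\<And>x. q x \<le> C * p n x"
proof -
  note q = seminormD[of q] and qs = assms[unfolded cont_seminorm_def, THEN conjunct1]
  have "open {x. q x < 1}"
    using assms by (intro open_Collect_less) (auto simp: cont_seminorm_def)
  then obtain n e where e: "0 < e" "\<And>x. p n x < e \<Longrightarrow> q x < 1"
    using p_base[of "{x. q x < 1}"] q(4)[OF qs] by auto
  have "q x \<le> 2 / e * p n x" for x
  proof (rule ccontr)
    assume "\<not> q x \<le> 2 / e * p n x"
    then have *: "2 / e * p n x < q x" by simp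
    then have qx: "0 < q x"
      using p_simps(5)[of n x] e(1) by (smt (verit) divide_nonneg_pos mult_nonneg_nonneg)
    have "q ((1 / q x) *\<^sub>R x) < 1"
    proof (rule e(2))
      have "p n x < e * q x" using * e(1) p_simps(5)[of n x] by (simp add: field_simps)
      then show "p n ((1 / q x) *\<^sub>R x) < e"
        using qx by (simp add: p_simps(2) field_simps)
    qed
    then show False using qx by (simp add: q(2)[OF qs])
  qed
  then show ?thesis using e(1) by (intro that[of "2 / e" n]) auto
qed

lemma continuous_linear_le_p:
  fixes \<Lambda> :: "'e \<Rightarrow> real"
  assumes "linear \<Lambda>" "continuous_on UNIV \<Lambda>"
  obtains n C where "0 < C" "\<And>x. \<bar>\<Lambda> x\<bar> \<le> C * p n x"
proof -
  have "cont_seminorm (\<lambda>x. \<bar>\<Lambda> x\<bar>)"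
    using assms by (auto simp: cont_seminorm_def seminorm_def linear_add linear_scale abs_mult
        intro: continuous_on_rabs)
  then show ?thesis
    by (rule cont_seminorm_le_p) (rule that)
qed

lemma continuous_linear_if_le_p:
  fixes \<Lambda> :: "'e \<Rightarrow> real"
  assumes "linear \<Lambda>" "\<And>x. \<bar>\<Lambda> x\<bar> \<le> p n x"
  shows "continuous_on UNIV \<Lambda>"
  unfolding continuous_on_def
proof
  fix a
  have "((\<lambda>x. p n (x - a)) \<longlongrightarrow> 0) (at a)"
    using tendsto_iff_p[of "\<lambda>x. x" a "at a"] tendsto_ident_at[of a UNIV] by blast
  then have "((\<lambda>x. \<Lambda> x - \<Lambda> a) \<longlongrightarrow> 0) (at a)"
    by (rule Lim_null_comparison[rotated]) (auto simp: linear_diff[OF assms(1), symmetric] assms(2))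
  then show "(\<Lambda> \<longlongrightarrow> \<Lambda> a) (at a within UNIV)"
    by (simp add: LIM_zero_iff)
qed

lemma supporting_functional:
  obtains \<Lambda> where "linear \<Lambda>" "continuous_on UNIV \<Lambda>" "\<And>y. \<bar>\<Lambda> y\<bar> \<le> p n y" "\<Lambda> x = p n x"
  using Hahn_Banach_seminorm[OF p_seminorm[of n], of x] continuous_linear_if_le_p by metis

lemma functionals_separate:
  fixes x y :: 'e
  assumes "\<And>\<Lambda> :: 'e \<Rightarrow> real. linear \<Lambda> \<Longrightarrow> continuous_on UNIV \<Lambda> \<Longrightarrow> \<Lambda> x = \<Lambda> y"
  shows "x = y"
proof -
  have "p n (x - y) = 0" for n
    using supporting_functional[of n "x - y"] assms by (metis linear_diff cancel_comm_monoid_add_class.diff_cancel)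
  then have "x - y = 0" by (rule p_eq_0_imp)
  then show ?thesis by simp
qed

text \<open>Separability with the approximating points allowed outside \<open>A\<close>. In this
  form it passes to subsets and unions at once; \<open>separable_iff_approximable\<close> shows the
  equivalence.\<close>

definition approximable :: "'e set \<Rightarrow> bool" where
  "approximable A \<longleftrightarrow> (\<exists>D. countable D \<and> (\<forall>x\<in>A. \<forall>n. \<forall>e>0. \<exists>d\<in>D. p n (x - d) < e))"

lemma approximable_subset: "approximable B \<Longrightarrow> A \<subseteq> B \<Longrightarrow> approximable A"
  unfolding approximable_def by (meson subsetD)

lemma approximable_Un: "approximable A \<Longrightarrow> approximable B \<Longrightarrow> approximable (A \<union> B)"
  unfolding approximable_def
proof (elim exE conjE)
  fix C D assume "countable C" "countable D" "\<forall>x\<in>A. \<forall>n. \<forall>e>0. \<exists>d\<in>C. p n (x - d) < e"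
    "\<forall>x\<in>B. \<forall>n. \<forall>e>0. \<exists>d\<in>D. p n (x - d) < e"
  then show "\<exists>D. countable D \<and> (\<forall>x\<in>A \<union> B. \<forall>n. \<forall>e>0. \<exists>d\<in>D. p n (x - d) < e)"
    by (intro exI[of _ "C \<union> D"]) blast
qed

lemma approximable_countable: "countable A \<Longrightarrow> approximable A"
  unfolding approximable_def by (intro exI[of _ A]) (auto intro!: bexI simp: p_simps)

lemma open_prod_contains_p_balls:
  assumes "open S" "(a, b) \<in> S"
  obtains n e where "0 < e" "\<And>x y. p n (x - a) < e \<Longrightarrow> p n (y - b) < e \<Longrightarrow> (x, y) \<in> S"
proof -
  obtain V W where VW: "open V" "open W" "a \<in> V" "b \<in> W" "V \<times> W \<subseteq> S"
    by (rule open_prod_elim[OF assms]) auto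
  obtain n e where e: "0 < e" "\<And>x. p n (x - a) < e \<Longrightarrow> x \<in> V"
    using open_contains_p_ball VW by metis
  obtain n' e' where e': "0 < e'" "\<And>x. p n' (x - b) < e' \<Longrightarrow> x \<in> W"
    using open_contains_p_ball VW by metis
  show ?thesis
  proof
    show "0 < min e e'" using e e' by simp
    fix x y assume "p (max n n') (x - a) < min e e'" "p (max n n') (y - b) < min e e'"
    then have "p n (x - a) < e" "p n' (y - b) < e'"
      using p_mono[of n "max n n'" "x - a"] p_mono[of n' "max n n'" "y - b"] by auto
    then show "(x, y) \<in> S" using e e' VW by auto
  qed
qed

text \<open>
  \<open>'e\<close> need not be second countable, so that measurable functions are closed under the algebraic
  operations only if their values lie in separable sets.
\<close>

definition smeas :: "(real \<Rightarrow> 'e) \<Rightarrow> bool" where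
  "smeas f \<longleftrightarrow> f \<in> borel_measurable borel \<and> approximable (range f)"

text \<open>Whenever the pair of values lies in an open set, it lies in one of countably many
  rectangles of balls, centred in \<open>D\<close> and \<open>D'\<close>, inside that set. Hence the
  preimage is a countable union of measurable sets.\<close>

lemma smeas_comp2:
  fixes h :: "'e \<Rightarrow> 'e \<Rightarrow> 'e"
  assumes f: "smeas f" and g: "smeas g" and h: "continuous_on UNIV (\<lambda>(x, y). h x y)"
  shows "smeas (\<lambda>t. h (f t) (g t))"
proof -
  obtain D where D: "countable D" "\<And>t n e. 0 < e \<Longrightarrow> \<exists>d\<in>D. p n (f t - d) < e"
    using f by (auto simp: smeas_def approximable_def)
  obtain D' where D': "countable D'" "\<And>t n e. 0 < e \<Longrightarrow> \<exists>d\<in>D'. p n (g t - d) < e"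
    using g by (auto simp: smeas_def approximable_def)
  have near: "\<exists>n d d'. d \<in> D \<and> d' \<in> D' \<and> p n (f t - d) < inverse (Suc n) \<and> p n (g t - d') < inverse (Suc n) \<and>
      {x. p n (x - d) < inverse (Suc n)} \<times> {y. p n (y - d') < inverse (Suc n)} \<subseteq> S"
    if S: "open S" "(f t, g t) \<in> S" for S t
  proof -
    obtain m e where e: "0 < e" "\<And>x y. p m (x - f t) < e \<Longrightarrow> p m (y - g t) < e \<Longrightarrow> (x, y) \<in> S"
      by (rule open_prod_contains_p_balls[OF S]) (rule that)
    obtain N where N: "inverse (Suc N) < e / 2"
      using reals_Archimedean[of "e / 2"] e by auto
    \<comment> \<open>\<open>n\<close> is the seminorm index and, through
      \<open>inverse (Suc n)\<close>, also determines the radius; enlarging it sharpens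
      both.\<close>
    define n where "n = max N m"
    have "inverse (Suc n) \<le> inverse (Suc N)"
      by (simp add: n_def)
    with N have n: "inverse (Suc n) < e / 2" by linarith
    obtain d where d: "d \<in> D" "p n (f t - d) < inverse (Suc n)"
      using D(2)[of "inverse (Suc n)" n t] by auto
    obtain d' where d': "d' \<in> D'" "p n (g t - d') < inverse (Suc n)"
      using D'(2)[of "inverse (Suc n)" n t] by auto
    have "(x, y) \<in> S" if "p n (x - d) < inverse (Suc n)" "p n (y - d') < inverse (Suc n)" for x y
    proof (rule e)
      show "p m (x - f t) < e"
        using p_mono[of m n "x - f t"] p_triangle[of n x "f t" d] p_simps(7)[of n "f t" d] that d n
        by (simp add: n_def)
      show "p m (y - g t) < e"
        using p_mono[of m n "y - g t"] p_triangle[of n y "g t" d'] p_simps(7)[of n "g t" d'] that d' n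
        by (simp add: n_def)
    qed
    then show ?thesis using d d' by blast
  qed
  have "(\<lambda>t. h (f t) (g t)) \<in> borel_measurable borel"
  proof (rule borel_measurableI)
    fix W :: "'e set" assume "open W"
    let ?S = "(\<lambda>(x, y). h x y) -` W"
    have S: "open ?S"
      using h \<open>open W\<close> by (rule open_vimage[rotated])
    define B where "B n d = {x. p n (x - d) < inverse (Suc n)}" for n d
    define I where "I = {(n, d, d'). d \<in> D \<and> d' \<in> D' \<and> B n d \<times> B n d' \<subseteq> ?S}"
    have "I \<subseteq> UNIV \<times> D \<times> D'" by (auto simp: I_def)
    then have "countable I"
      by (rule countable_subset) (simp add: D(1) D'(1))
    moreover have "f -` B n d \<in> sets borel" "g -` B n d \<in> sets borel" for n d
    proof -
      have "B n d \<in> sets borel"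
        unfolding B_def by (rule borel_open[OF open_p_ball])
      then show "f -` B n d \<in> sets borel" "g -` B n d \<in> sets borel"
        using f g by (auto simp: smeas_def intro: measurable_sets_borel)
    qed
    ultimately have "(\<Union>(n, d, d')\<in>I. f -` B n d \<inter> g -` B n d') \<in> sets borel"
      by (intro sets.countable_UN'') (auto split: prod.splits)
    also have "(\<Union>(n, d, d')\<in>I. f -` B n d \<inter> g -` B n d') = (\<lambda>t. h (f t) (g t)) -` W"
    proof (intro subset_antisym subsetI)
      fix t assume "t \<in> (\<lambda>t. h (f t) (g t)) -` W"
      then have "(f t, g t) \<in> ?S" by simp
      from near[OF S this] show "t \<in> (\<Union>(n, d, d')\<in>I. f -` B n d \<inter> g -` B n d')"
        by (force simp: I_def B_def)
    qed (force simp: I_def)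
    finally show "(\<lambda>t. h (f t) (g t)) -` W \<inter> space borel \<in> sets borel" by simp
  qed
  moreover have "approximable (range (\<lambda>t. h (f t) (g t)))"
    unfolding approximable_def
  proof (intro exI conjI ballI allI impI)
    show "countable ((\<lambda>(d, d'). h d d') ` (D \<times> D'))"
      using D D' by auto
    fix x n and e :: real assume "x \<in> range (\<lambda>t. h (f t) (g t))" "0 < e"
    then obtain t where t: "x = h (f t) (g t)" by blast
    have "open ((\<lambda>(x, y). h x y) -` {y. p n (y - x) < e})"
      using h open_p_ball by (rule open_vimage[rotated])
    moreover have "(f t, g t) \<in> (\<lambda>(x, y). h x y) -` {y. p n (y - x) < e}"
      using \<open>0 < e\<close> by (simp add: t p_simps)
    ultimately obtain m d d' where *: "d \<in> D" "d' \<in> D'"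
      "{x. p m (x - d) < inverse (Suc m)} \<times> {y. p m (y - d') < inverse (Suc m)} \<subseteq>
        (\<lambda>(x, y). h x y) -` {y. p n (y - x) < e}"
      using near by meson
    \<comment> \<open>The centre of the rectangle belongs to it, so \<open>h d d'\<close> is close
      to \<open>x\<close>.\<close>
    have "(d, d') \<in> (\<lambda>(x, y). h x y) -` {y. p n (y - x) < e}"
      using *(3) by (rule subsetD) (simp add: p_simps)
    then show "\<exists>d\<in>(\<lambda>(d, d'). h d d') ` (D \<times> D'). p n (x - d) < e"
      using * by (force simp: p_simps(7)[of n x])
  qed
  ultimately show ?thesis by (simp add: smeas_def)
qed

lemma smeas_add: "smeas f \<Longrightarrow> smeas g \<Longrightarrow> smeas (\<lambda>t. f t + g t)"
  by (rule smeas_comp2) (auto simp: case_prod_beta intro!: continuous_intros)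

lemma smeas_scaleR:
  assumes f: "smeas f"
  shows "smeas (\<lambda>t. c *\<^sub>R f t)"
proof -
  have "continuous_on UNIV (\<lambda>(x :: 'e, y :: 'e). c *\<^sub>R x)"
    unfolding continuous_on_def case_prod_beta
    by (intro ballI tendsto_scaleR_lc tendsto_const tendsto_fst tendsto_ident_at)
  then show ?thesis
    using smeas_comp2[OF f f] by simp
qed

lemma smeas_const: "smeas (\<lambda>_. c)"
  by (auto simp: smeas_def intro: approximable_countable)

lemma smeas_if:
  assumes "smeas f" "smeas g" "S \<in> sets borel"
  shows "smeas (\<lambda>t. if t \<in> S then f t else g t)"
proof -
  have "approximable (range (\<lambda>t. if t \<in> S then f t else g t))"
    by (rule approximable_subset[OF approximable_Un[of "range f" "range g"]])
       (use assms in \<open>auto simp: smeas_def\<close>)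
  then show ?thesis
    using assms by (simp add: smeas_def measurable_If_set)
qed

lemma smeas_continuous:
  assumes "continuous_on UNIV f"
  shows "smeas f"
proof -
  have "\<exists>d\<in>f ` \<rat>. p n (f t - d) < e" if "0 < e" for t n and e :: real
  proof -
    have "open (f -` {x. p n (x - f t) < e})"
      using open_p_ball assms by (rule open_vimage)
    moreover have "t \<in> f -` {x. p n (x - f t) < e}"
      using that by (simp add: p_simps)
    ultimately obtain \<delta> where \<delta>: "0 < \<delta>" "ball t \<delta> \<subseteq> f -` {x. p n (x - f t) < e}"
      using open_contains_ball by blast
    obtain r where "r \<in> \<rat>" "t < r" "r < t + \<delta>"
      using Rats_dense_in_real[of t "t + \<delta>"] \<delta>(1) by auto
    then have "r \<in> \<rat>" "p n (f r - f t) < e"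
      using \<delta>(2) by (auto simp: subset_iff dist_real_def)
    then show ?thesis by (auto simp: p_simps(7)[of n "f t"])
  qed
  moreover have "countable (f ` \<rat>)"
    by (simp add: countable_rat)
  ultimately have "approximable (range f)"
    unfolding approximable_def by (intro exI[of _ "f ` \<rat>"]) auto
  then show ?thesis
    using assms by (simp add: smeas_def borel_measurable_continuous_onI)
qed

lemma smeas_continuous_on_Icc:
  assumes "continuous_on {0..1} f"
  shows "smeas (\<lambda>t. if t \<in> {0..1::real} then f t else 0)"
proof -
  \<comment> \<open>Clamping the argument to the unit interval extends \<open>f\<close> continuously
    to the line.\<close>
  have "continuous_on UNIV (\<lambda>t. f (max 0 (min 1 t)))"
    by (intro continuous_on_compose2[OF assms] continuous_intros) auto
  then have "smeas (\<lambda>t. if t \<in> {0..1} then f (max 0 (min 1 t)) else 0)"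
    by (intro smeas_if smeas_continuous smeas_const) auto
  also have "(\<lambda>t. if t \<in> {0..1} then f (max 0 (min 1 t)) else 0) = (\<lambda>t. if t \<in> {0..1} then f t else 0)"
    by (auto simp: max_def min_def)
  finally show ?thesis .
qed

lemma separable_iff_approximable:
  "separable_space (subtopology euclidean A) \<longleftrightarrow> approximable A"
proof
  assume "separable_space (subtopology euclidean A)"
  then obtain C where C: "countable C" "C \<subseteq> A" "(subtopology euclidean A) closure_of C = A"
    by (auto simp: separable_space_def)
  have "A \<subseteq> closure C"
    using C(3) closure_mono[of "A \<inter> C" C] by (auto simp: closure_of_subtopology)
  have "\<exists>d\<in>C. p n (x - d) < e" if "x \<in> A" "0 < e" for x n e
  proof -
    have "x \<in> {y. p n (y - x) < e} \<inter> closure C"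
      using that \<open>A \<subseteq> closure C\<close> by (auto simp: p_simps)
    then have "{y. p n (y - x) < e} \<inter> C \<noteq> {}"
      using open_Int_closure_eq_empty[OF open_p_ball[of n x e], of C] by blast
    then show ?thesis by (auto simp: p_simps(7)[of n x])
  qed
  then show "approximable A" using C(1) unfolding approximable_def by blast
next
  assume "approximable A"
  then obtain D where D: "countable D" "\<And>x n e. x \<in> A \<Longrightarrow> 0 < e \<Longrightarrow> \<exists>d\<in>D. p n (x - d) < e"
    unfolding approximable_def by blast
  \<comment> \<open>A dense set inside \<open>A\<close> is required: for each centre, seminorm and
    radius one point of \<open>A\<close> is picked if there is any, and the intersection with
    \<open>A\<close> drops arbitrary values chosen otherwise.\<close>
  define c where "c = (\<lambda>(d, n, k). SOME x. x \<in> A \<and> p n (x - d) < inverse (Suc k))"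
  define C where "C = c ` (D \<times> UNIV \<times> UNIV) \<inter> A"
  have "x \<in> closure C" if x: "x \<in> A" for x
    unfolding closure_iff_nhds_not_empty
  proof (intro allI impI)
    fix S U assume "U \<subseteq> S" "open U" "x \<in> U"
    then obtain n e where e: "0 < e" "\<And>y. p n (y - x) < e \<Longrightarrow> y \<in> S"
      using open_contains_p_ball by (metis subsetD)
    obtain k where k: "inverse (Suc k) < e / 2"
      using reals_Archimedean[of "e / 2"] e by auto
    obtain d where d: "d \<in> D" "p n (x - d) < inverse (Suc k)"
      using D(2)[OF x, of "inverse (Suc k)" n] by auto
    then have "\<exists>x. x \<in> A \<and> p n (x - d) < inverse (Suc k)"
      using x by blast
    then have "c (d, n, k) \<in> A \<and> p n (c (d, n, k) - d) < inverse (Suc k)"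
      unfolding c_def prod.case by (rule someI_ex)
    then have "c (d, n, k) \<in> C" "p n (c (d, n, k) - x) < e"
      using d k p_triangle[of n "c (d, n, k)" x d] p_simps(7)[of n x d] by (auto simp: C_def)
    then show "C \<inter> S \<noteq> {}" using e by blast
  qed
  then have "A \<subseteq> closure C" by blast
  moreover have "countable C" using D(1) by (auto simp: C_def)
  moreover have "C \<subseteq> A" by (auto simp: C_def)
  ultimately show "separable_space (subtopology euclidean A)"
    unfolding separable_space_def
    by (intro exI[of _ C]) (auto simp: closure_of_subtopology Int_absorb1)
qed

end


section \<open>Weak integrals\<close>

lemma integrable_imp_set_integrable:
  fixes g :: "real \<Rightarrow> real"
  assumes "integrable lborel g" "S \<in> sets borel"
  shows "set_integrable lborel S g"
  unfolding set_integrable_def by (rule integrable_mult_indicator) (use assms in auto)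

lemma set_integrable_Icc:
  fixes g :: "real \<Rightarrow> real"
  assumes "integrable lborel g"
  shows "set_integrable lborel {a..b} g" "g integrable_on {a..b}"
    "(LINT s:{a..b}|lborel. g s) = integral {a..b} g"
proof -
  show *: "set_integrable lborel {a..b} g"
    using assms by (intro integrable_imp_set_integrable) auto
  show "g integrable_on {a..b}" "(LINT s:{a..b}|lborel. g s) = integral {a..b} g"
    using set_borel_integral_eq_integral[OF *] by auto
qed

lemma integral_Icc_diff:
  fixes g :: "real \<Rightarrow> real"
  assumes "integrable lborel g" "a \<le> s" "s \<le> t"
  shows "integral {a..t} g - integral {a..s} g = integral {s..t} g"
  using Henstock_Kurzweil_Integration.integral_combine[of a s t g] set_integrable_Icc(2)[OF assms(1)] assms(2,3)
  by simp

lemma continuous_on_primitive: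
  fixes g :: "real \<Rightarrow> real"
  assumes "integrable lborel g"
  shows "continuous_on {a..b} (\<lambda>t. integral {a..t} g)"
  by (rule indefinite_integral_continuous_1) (rule set_integrable_Icc(2)[OF assms])

lemma integral_Icc_le_LINT:
  fixes g :: "real \<Rightarrow> real"
  assumes "integrable lborel g" "\<And>t. 0 \<le> g t"
  shows "integral {a..b} g \<le> (\<integral>t. g t \<partial>lborel)"
proof -
  have "integral {a..b} g = (\<integral>t. indicator {a..b} t *\<^sub>R g t \<partial>lborel)"
    using set_integrable_Icc(3)[OF assms(1), of a b] by (simp add: set_lebesgue_integral_def)
  also have "\<dots> \<le> (\<integral>t. g t \<partial>lborel)"
    using assms by (intro integral_mono integrable_mult_indicator) (auto simp: indicator_def)
  finally show ?thesis .
qed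

lemma integral_01_eq_LINT:
  fixes g :: "real \<Rightarrow> real"
  assumes "integrable lborel g" "\<And>t. t \<notin> {0..1} \<Longrightarrow> g t = 0"
  shows "integral {0..1} g = (\<integral>t. g t \<partial>lborel)"
proof -
  have "integral {0..1} g = (\<integral>t. indicator {0..1} t *\<^sub>R g t \<partial>lborel)"
    using set_integrable_Icc(3)[OF assms(1), of 0 1] by (simp add: set_lebesgue_integral_def)
  also have "\<dots> = (\<integral>t. g t \<partial>lborel)"
    using assms(2) by (intro Bochner_Integration.integral_cong) (auto simp: indicator_def)
  finally show ?thesis .
qed

context frechet_seminorms
begin

abbreviation "L1F \<equiv> L1_functions 0 1 :: (real \<Rightarrow> 'e) set"

lemma borel_measurable_cont_seminorm:
  "smeas \<gamma> \<Longrightarrow> cont_seminorm q \<Longrightarrow> (\<lambda>t. q (\<gamma> t)) \<in> borel_measurable borel"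
  unfolding smeas_def cont_seminorm_def
  by (auto intro: measurable_compose[OF _ borel_measurable_continuous_onI])

lemma borel_measurable_functional:
  "smeas \<gamma> \<Longrightarrow> continuous_on UNIV \<Lambda> \<Longrightarrow> (\<lambda>t. \<Lambda> (\<gamma> t) :: real) \<in> borel_measurable borel"
  unfolding smeas_def by (auto intro: measurable_compose[OF _ borel_measurable_continuous_onI])

text \<open>Each continuous seminorm is bounded by a multiple of some \<open>p n\<close>, so the
  sequence decides integrability. Vanishing off the unit interval adds at most the point 0 to the
  image, so separability may be asked of the whole range.\<close>

lemma L1_functions_iff:
  "\<gamma> \<in> L1F \<longleftrightarrow> smeas \<gamma> \<and> (\<forall>t. t \<notin> {0..1} \<longrightarrow> \<gamma> t = 0) \<and> (\<forall>n. integrable lborel (\<lambda>t. p n (\<gamma> t)))"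
proof (cases "\<forall>t. t \<notin> {0..1} \<longrightarrow> \<gamma> t = 0")
  case True
  have range: "range \<gamma> \<subseteq> \<gamma> ` {0..1} \<union> {0}"
    using True by (metis UnCI image_eqI image_subsetI insertI1)
  have sep: "separable_space (subtopology euclidean (\<gamma> ` {0..1})) \<longleftrightarrow> approximable (range \<gamma>)"
    unfolding separable_iff_approximable
    using approximable_subset[OF approximable_Un range, OF _ approximable_countable]
      approximable_subset[of "range \<gamma>" "\<gamma> ` {0..1}"] by auto
  have set_eq: "(\<integral>\<^sup>+t\<in>{0..1}. ennreal (q (\<gamma> t)) \<partial>lborel) = (\<integral>\<^sup>+t. ennreal (q (\<gamma> t)) \<partial>lborel)"
    if "cont_seminorm q" for q
    using True seminormD(4)[of q] that
    by (intro nn_integral_cong) (auto simp: indicator_def cont_seminorm_def)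
  have "(\<forall>q. cont_seminorm q \<longrightarrow> (\<integral>\<^sup>+t\<in>{0..1}. ennreal (q (\<gamma> t)) \<partial>lborel) < \<infinity>) \<longleftrightarrow>
      (\<forall>n. integrable lborel (\<lambda>t. p n (\<gamma> t)))" if s: "smeas \<gamma>"
  proof (intro iffI allI impI)
    fix n assume "\<forall>q. cont_seminorm q \<longrightarrow> (\<integral>\<^sup>+t\<in>{0..1}. ennreal (q (\<gamma> t)) \<partial>lborel) < \<infinity>"
    then have "(\<integral>\<^sup>+t\<in>{0..1}. ennreal (p n (\<gamma> t)) \<partial>lborel) < \<infinity>"
      using cont_seminorm_p by blast
    then show "integrable lborel (\<lambda>t. p n (\<gamma> t))"
      using borel_measurable_cont_seminorm[OF s, of "p n"] set_eq[of "p n"]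
      by (auto simp: integrable_iff_bounded p_simps(5))
  next
    fix q :: "'e \<Rightarrow> real" assume *: "\<forall>n. integrable lborel (\<lambda>t. p n (\<gamma> t))" "cont_seminorm q"
    then obtain n C where C: "0 < C" "\<And>x. q x \<le> C * p n x"
      using cont_seminorm_le_p by metis
    have "integrable lborel (\<lambda>t. C * p n (\<gamma> t))"
      using * by simp
    then have "(\<integral>\<^sup>+t. ennreal (norm (C * p n (\<gamma> t))) \<partial>lborel) < \<infinity>"
      unfolding integrable_iff_bounded by blast
    then have "(\<integral>\<^sup>+t. ennreal (C * p n (\<gamma> t)) \<partial>lborel) < \<infinity>"
      using C(1) by (simp add: p_simps(5) abs_mult)
    moreover have "(\<integral>\<^sup>+t. ennreal (q (\<gamma> t)) \<partial>lborel) \<le> (\<integral>\<^sup>+t. ennreal (C * p n (\<gamma> t)) \<partial>lborel)"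
      using C(2) by (intro nn_integral_mono ennreal_leI) auto
    ultimately show "(\<integral>\<^sup>+t\<in>{0..1}. ennreal (q (\<gamma> t)) \<partial>lborel) < \<infinity>"
      using set_eq[OF *(2)] by (simp add: order_le_less_trans)
  qed
  then show ?thesis
    using True unfolding L1_functions_def smeas_def mem_Collect_eq sep by blast
qed (auto simp: L1_functions_def)

lemma L1_smeas: "\<gamma> \<in> L1F \<Longrightarrow> smeas \<gamma>"
  and L1_outside: "\<gamma> \<in> L1F \<Longrightarrow> t \<notin> {0..1} \<Longrightarrow> \<gamma> t = 0"
  and L1_integrable_p: "\<gamma> \<in> L1F \<Longrightarrow> integrable lborel (\<lambda>t. p n (\<gamma> t))"
  unfolding L1_functions_iff by blast+

lemma L1_dominatedI:
  assumes "smeas \<gamma>" "\<And>t. t \<notin> {0..1} \<Longrightarrow> \<gamma> t = 0"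
    and "\<And>n. \<exists>g. integrable lborel g \<and> (\<forall>t. p n (\<gamma> t) \<le> g t)"
  shows "\<gamma> \<in> L1F"
proof -
  have "integrable lborel (\<lambda>t. p n (\<gamma> t))" for n
  proof -
    obtain g where g: "integrable lborel g" "\<And>t. p n (\<gamma> t) \<le> g t"
      using assms(3) by blast
    then show ?thesis
      using borel_measurable_cont_seminorm[OF assms(1), of "p n"]
      by (intro Bochner_Integration.integrable_bound[OF g(1)])
         (auto simp: p_simps(5) intro!: AE_I2 order_trans[OF g(2)])
  qed
  then show ?thesis using assms by (simp add: L1_functions_iff)
qed

lemma L1_add:
  assumes "\<gamma> \<in> L1F" "\<sigma> \<in> L1F"
  shows "(\<lambda>t. \<gamma> t + \<sigma> t) \<in> L1F"
proof (rule L1_dominatedI)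
  fix n show "\<exists>g. integrable lborel g \<and> (\<forall>t. p n (\<gamma> t + \<sigma> t) \<le> g t)"
    using L1_integrable_p[OF assms(1), of n] L1_integrable_p[OF assms(2), of n]
    by (intro exI[of _ "\<lambda>t. p n (\<gamma> t) + p n (\<sigma> t)"]) (simp add: p_simps(1))
qed (use L1_outside[OF assms(1)] L1_outside[OF assms(2)] in \<open>auto intro: smeas_add L1_smeas assms\<close>)

lemma L1_scaleR:
  assumes "\<gamma> \<in> L1F"
  shows "(\<lambda>t. c *\<^sub>R \<gamma> t) \<in> L1F"
proof (rule L1_dominatedI)
  fix n show "\<exists>g. integrable lborel g \<and> (\<forall>t. p n (c *\<^sub>R \<gamma> t) \<le> g t)"
    using L1_integrable_p[OF assms, of n]
    by (intro exI[of _ "\<lambda>t. \<bar>c\<bar> * p n (\<gamma> t)"]) (simp add: p_simps(2))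
qed (use L1_outside[OF assms] in \<open>auto intro: smeas_scaleR L1_smeas assms\<close>)

lemma L1_diff:
  assumes "\<gamma> \<in> L1F" "\<sigma> \<in> L1F"
  shows "(\<lambda>t. \<gamma> t - \<sigma> t) \<in> L1F"
  using L1_add[OF assms(1) L1_scaleR[OF assms(2), of "-1"]] by simp

lemma L1_zero: "(\<lambda>_. 0) \<in> L1F"
  by (simp add: L1_functions_iff smeas_const p_simps(4))

lemma L1_restrict:
  assumes "\<gamma> \<in> L1F" "S \<in> sets borel"
  shows "(\<lambda>t. if t \<in> S then \<gamma> t else 0) \<in> L1F"
proof (rule L1_dominatedI)
  fix n show "\<exists>g. integrable lborel g \<and> (\<forall>t. p n (if t \<in> S then \<gamma> t else 0) \<le> g t)"
    using L1_integrable_p[OF assms(1), of n]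
    by (intro exI[of _ "\<lambda>t. p n (\<gamma> t)"]) (auto simp: p_simps(4,5))
qed (use L1_outside[OF assms(1)] smeas_if[OF L1_smeas[OF assms(1)] smeas_const assms(2)] in auto)

lemma L1_indicator:
  assumes "A \<in> sets borel" "A \<subseteq> {0..1}"
  shows "(\<lambda>t. if t \<in> A then x else 0) \<in> L1F"
proof (rule L1_dominatedI)
  fix n
  have "integrable lborel (\<lambda>t. indicator {0..1::real} t * p n x)"
    by simp
  moreover have "p n (if t \<in> A then x else 0) \<le> indicator {0..1} t * p n x" for t
    using assms(2) by (auto simp: p_simps(4,5) indicator_def)
  ultimately show "\<exists>g. integrable lborel g \<and> (\<forall>t. p n (if t \<in> A then x else 0) \<le> g t)"
    by blast
qed (use assms in \<open>auto intro!: smeas_if smeas_const\<close>)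

lemma L1_integrable_functional:
  assumes "\<gamma> \<in> L1F" "linear \<Lambda>" "continuous_on UNIV (\<Lambda> :: 'e \<Rightarrow> real)"
  shows "integrable lborel (\<lambda>t. \<Lambda> (\<gamma> t))"
proof -
  obtain n C where C: "0 < C" "\<And>x. \<bar>\<Lambda> x\<bar> \<le> C * p n x"
    using continuous_linear_le_p[OF assms(2,3)] by metis
  have "integrable lborel (\<lambda>t. C * p n (\<gamma> t))"
    using L1_integrable_p[OF assms(1)] by simp
  then show ?thesis
    using borel_measurable_functional[OF L1_smeas[OF assms(1)] assms(3)] C
    by (elim Bochner_Integration.integrable_bound) (auto intro!: AE_I2 order_trans[OF C(2)] simp: abs_mult p_simps(5))
qed

lemma has_weak_integral_iff:
  assumes "\<gamma> \<in> L1F" "S \<in> sets borel"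
  shows "has_weak_integral \<gamma> I S \<longleftrightarrow>
    (\<forall>\<Lambda> :: 'e \<Rightarrow> real. linear \<Lambda> \<and> continuous_on UNIV \<Lambda> \<longrightarrow> \<Lambda> I = (LINT s:S|lborel. \<Lambda> (\<gamma> s)))"
  using integrable_imp_set_integrable[OF L1_integrable_functional[OF assms(1)] assms(2)]
  unfolding has_weak_integral_def by auto

lemma has_weak_integral_add:
  "has_weak_integral \<gamma> I S \<Longrightarrow> has_weak_integral \<sigma> J S \<Longrightarrow> has_weak_integral (\<lambda>t. \<gamma> t + \<sigma> t :: 'e) (I + J) S"
  unfolding has_weak_integral_def by (auto simp: linear_add set_integral_add)

lemma has_weak_integral_scaleR:
  "has_weak_integral \<gamma> I S \<Longrightarrow> has_weak_integral (\<lambda>t. c *\<^sub>R \<gamma> t :: 'e) (c *\<^sub>R I) S"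
  unfolding has_weak_integral_def by (auto simp: linear_scale)

lemma has_weak_integral_diff:
  "has_weak_integral \<gamma> I S \<Longrightarrow> has_weak_integral \<sigma> J S \<Longrightarrow> has_weak_integral (\<lambda>t. \<gamma> t - \<sigma> t :: 'e) (I - J) S"
  using has_weak_integral_add[of \<gamma> I S "\<lambda>t. - 1 *\<^sub>R \<sigma> t" "- 1 *\<^sub>R J"] has_weak_integral_scaleR[of \<sigma> J S "-1"]
  by simp

lemma has_weak_integral_zero: "has_weak_integral (\<lambda>_. 0 :: 'e) 0 S"
  unfolding has_weak_integral_def by (auto simp: linear_0 set_integrable_def set_lebesgue_integral_def)

lemma has_weak_integral_unique:
  "has_weak_integral \<gamma> I S \<Longrightarrow> has_weak_integral \<gamma> J S \<Longrightarrow> I = (J :: 'e)"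
  by (rule functionals_separate) (auto simp: has_weak_integral_def)

lemma has_weak_integral_le:
  assumes I: "has_weak_integral \<gamma> I S" and g: "set_integrable lborel S g" "\<And>s. s \<in> S \<Longrightarrow> p n (\<gamma> s) \<le> g s"
  shows "p n I \<le> (LINT s:S|lborel. g s)"
proof -
  obtain \<Lambda> where \<Lambda>: "linear \<Lambda>" "continuous_on UNIV \<Lambda>" "\<And>y. \<bar>\<Lambda> y\<bar> \<le> p n y" "\<Lambda> I = p n I"
    by (rule supporting_functional[of n I]) (rule that)
  have "\<Lambda> I = (LINT s:S|lborel. \<Lambda> (\<gamma> s))" "set_integrable lborel S (\<lambda>s. \<Lambda> (\<gamma> s))"
    using I \<Lambda> by (auto simp: has_weak_integral_def)
  moreover have "\<Lambda> (\<gamma> s) \<le> g s" if "s \<in> S" for s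
    using \<Lambda>(3)[of "\<gamma> s"] g(2)[OF that] by simp
  ultimately show ?thesis
    using set_integral_mono[of lborel S "\<lambda>s. \<Lambda> (\<gamma> s)" g] g(1) \<Lambda>(4) by simp
qed

lemma has_weak_integral_indicator:
  assumes "A \<in> sets borel" "A \<subseteq> {0..1}"
  shows "has_weak_integral (\<lambda>t. if t \<in> A then x else 0) (measure lborel A *\<^sub>R x :: 'e) UNIV"
proof (subst has_weak_integral_iff[OF L1_indicator[OF assms]]; clarsimp)
  fix \<Lambda> :: "'e \<Rightarrow> real" assume \<Lambda>: "linear \<Lambda>" "continuous_on UNIV \<Lambda>"
  have "(LINT t|lborel. \<Lambda> (if t \<in> A then x else 0)) = (LINT t|lborel. indicator A t *\<^sub>R \<Lambda> x)"
    by (intro Bochner_Integration.integral_cong) (auto simp: linear_0[OF \<Lambda>(1)])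
  also have "\<dots> = measure lborel A * \<Lambda> x"
    using assms by simp
  finally show "\<Lambda> (measure lborel A *\<^sub>R x) = (LINT s:UNIV|lborel. \<Lambda> (if s \<in> A then x else 0))"
    by (simp add: linear_scale[OF \<Lambda>(1)] set_lebesgue_integral_def)
qed

text \<open>\<open>kk t\<close> is the first index of a point of the countable set within
  \<open>e / 2\<close> of \<open>\<gamma> t\<close>. The countably valued approximation obtained
  from it is cut off to finitely many values, with an error that is small by dominated convergence;
  finite step functions have explicit weak integrals.\<close>

lemma L1_approx:
  assumes \<gamma>: "\<gamma> \<in> L1F" and e: "0 < e"
  obtains \<sigma> I where "\<sigma> \<in> L1F" "has_weak_integral \<sigma> I UNIV" "(\<integral>t. p n (\<gamma> t - \<sigma> t) \<partial>lborel) < e"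
proof -
  obtain D where D: "countable D" "\<And>t n e. 0 < e \<Longrightarrow> \<exists>d\<in>D. p n (\<gamma> t - d) < e"
    using L1_smeas[OF \<gamma>] by (auto simp: smeas_def approximable_def)
  have "D \<noteq> {}" using D(2)[of 1 n 0] by auto
  define d where "d = from_nat_into D"
  have "\<exists>k. p n (\<gamma> t - d k) < e / 2" for t
    using D(2)[of "e / 2" n t] e from_nat_into_surj[OF D(1)] unfolding d_def by (metis half_gt_zero)
  define kk where "kk t = (LEAST k. p n (\<gamma> t - d k) < e / 2)" for t
  have kk: "p n (\<gamma> t - d (kk t)) < e / 2" for t
    unfolding kk_def by (rule LeastI_ex) fact
  have [measurable]: "(\<lambda>t. p n (\<gamma> t - x)) \<in> borel_measurable borel" for x
    using borel_measurable_cont_seminorm[OF smeas_add[OF L1_smeas[OF \<gamma>] smeas_const[of "- x"]], of "p n"]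
    by simp
  have [measurable]: "kk \<in> measurable borel (count_space UNIV)"
    unfolding kk_def by measurable
  have [measurable]: "(\<lambda>t. p n (\<gamma> t)) \<in> borel_measurable borel"
    using borel_measurable_cont_seminorm[OF L1_smeas[OF \<gamma>]] by simp
  define A where "A k = {t \<in> {0..1}. kk t = k}" for k
  have A: "A k \<in> sets borel" "A k \<subseteq> {0..1}" for k
    unfolding A_def by (measurable; auto)+
  define \<sigma> where "\<sigma> K t = (\<Sum>k<K. if t \<in> A k then d k else 0)" for K :: nat and t
  have \<sigma>_eq: "\<sigma> K t = (if t \<in> {0..1} \<and> kk t < K then d (kk t) else 0)" for K t
  proof (cases "t \<in> {0..1}")
    case True
    then have "\<sigma> K t = (\<Sum>k<K. if kk t = k then d k else 0)"
      unfolding \<sigma>_def by (intro sum.cong) (auto simp: A_def)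
    then show ?thesis using True by (simp add: sum.delta)
  qed (auto simp: \<sigma>_def A_def)
  have \<sigma>: "\<sigma> K \<in> L1F \<and> (\<exists>I. has_weak_integral (\<sigma> K) I UNIV)" for K
  proof (induction K)
    case 0
    then show ?case unfolding \<sigma>_def using L1_zero has_weak_integral_zero by auto
  next
    case (Suc K)
    have "\<sigma> (Suc K) = (\<lambda>t. \<sigma> K t + (if t \<in> A K then d K else 0))"
      by (simp add: \<sigma>_def fun_eq_iff)
    then show ?case
      using Suc L1_add L1_indicator[OF A] has_weak_integral_add has_weak_integral_indicator[OF A]
      by metis
  qed
  \<comment> \<open>The error where the cutoff has replaced the approximating value by 0.\<close>
  define f where "f K t = indicator {t. K \<le> kk t} t * p n (\<gamma> t)" for K :: nat and t
  have "(\<lambda>K. \<integral>t. f K t \<partial>lborel) \<longlonglongrightarrow> integral\<^sup>L lborel (\<lambda>t::real. 0 :: real)"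
  proof (rule Bochner_Integration.integral_dominated_convergence[where w = "\<lambda>t. p n (\<gamma> t)"])
    show "AE t in lborel. (\<lambda>K. f K t) \<longlonglongrightarrow> 0"
    proof (rule AE_I2)
      fix t
      have "\<forall>\<^sub>F K in sequentially. f K t = 0"
        using eventually_gt_at_top[of "kk t"] by eventually_elim (simp add: f_def)
      then show "(\<lambda>K. f K t) \<longlonglongrightarrow> 0" by (rule tendsto_eventually)
    qed
    show "AE t in lborel. norm (f K t) \<le> p n (\<gamma> t)" for K
      by (rule AE_I2) (auto simp: f_def indicator_def p_simps(5))
    show "integrable lborel (\<lambda>t. p n (\<gamma> t))" by (rule L1_integrable_p[OF \<gamma>])
    show "f K \<in> borel_measurable lborel" for K unfolding f_def by measurable
  qed auto
  then have "\<forall>\<^sub>F K in sequentially. (\<integral>t. f K t \<partial>lborel) < e / 2"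
    using e by (intro order_tendstoD(2)) auto
  then obtain K where K: "(\<integral>t. f K t \<partial>lborel) < e / 2"
    by (auto simp: eventually_sequentially)
  have f_int: "integrable lborel (f K)"
    unfolding f_def using integrable_mult_indicator[OF _ L1_integrable_p[OF \<gamma>], of "{t. K \<le> kk t}"] by simp
  \<comment> \<open>The interval has length 1, so the uniform part of the error contributes
    \<open>e / 2\<close>.\<close>
  have "(\<integral>t. p n (\<gamma> t - \<sigma> K t) \<partial>lborel) \<le> (\<integral>t. e / 2 * indicator {0..1} t + f K t \<partial>lborel)"
  proof (rule integral_mono)
    show "integrable lborel (\<lambda>t. p n (\<gamma> t - \<sigma> K t))"
      using L1_integrable_p[OF L1_diff[OF \<gamma>]] \<sigma> by blast
    show "integrable lborel (\<lambda>t. e / 2 * indicator {0..1} t + f K t)"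
      using f_int by simp
    show "p n (\<gamma> t - \<sigma> K t) \<le> e / 2 * indicator {0..1} t + f K t" for t
      using kk[of t] L1_outside[OF \<gamma>, of t] e p_simps(5)[of n "\<gamma> t"]
      by (auto simp: \<sigma>_eq f_def indicator_def p_simps(4))
  qed
  also have "\<dots> = e / 2 + (\<integral>t. f K t \<partial>lborel)"
    using f_int by simp
  also have "\<dots> < e" using K by simp
  finally show ?thesis using \<sigma>[of K] that by blast
qed

text \<open>The \<open>k\<close>-th step function approximates in the \<open>k\<close>-th seminorm
  up to \<open>inverse (Suc k)\<close>. By monotonicity it does so in all earlier seminorms, so one
  sequence serves them all; its integrals converge by completeness, and functionals pass to the
  limit.\<close>

lemma has_weak_integral_exists_UNIV:
  assumes \<gamma>: "\<gamma> \<in> L1F"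
  shows "\<exists>I. has_weak_integral \<gamma> I UNIV"
proof -
  have "\<exists>\<sigma> I. \<sigma> \<in> L1F \<and> has_weak_integral \<sigma> I UNIV \<and> (\<integral>t. p k (\<gamma> t - \<sigma> t) \<partial>lborel) < inverse (Suc k)" for k
    using L1_approx[OF \<gamma>, of "inverse (Suc k)" k] by (metis inverse_positive_iff_positive of_nat_0_less_iff zero_less_Suc)
  then obtain \<sigma> I where \<sigma>: "\<And>k. \<sigma> k \<in> L1F" and I: "\<And>k. has_weak_integral (\<sigma> k) (I k) UNIV"
    and approx: "\<And>k. (\<integral>t. p k (\<gamma> t - \<sigma> k t) \<partial>lborel) < inverse (Suc k)"
    by metis
  have int: "integrable lborel (\<lambda>t. p m (\<gamma> t - \<sigma> k t))" for m k
    by (rule L1_integrable_p[OF L1_diff[OF \<gamma> \<sigma>]])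
  have approx': "(\<integral>t. p m (\<gamma> t - \<sigma> k t) \<partial>lborel) < inverse (Suc k)" if "m \<le> k" for m k
    using integral_mono[OF int[of m k] int[of k k] p_mono[OF that]] approx[of k] by simp
  have diff: "p m (I i - I j) < inverse (Suc i) + inverse (Suc j)" if "m \<le> i" "m \<le> j" for m i j
  proof -
    have "p m (I i - I j) \<le> (LINT t:UNIV|lborel. p m (\<gamma> t - \<sigma> i t) + p m (\<gamma> t - \<sigma> j t))"
    proof (rule has_weak_integral_le[OF has_weak_integral_diff[OF I I]])
      show "p m (\<sigma> i s - \<sigma> j s) \<le> p m (\<gamma> s - \<sigma> i s) + p m (\<gamma> s - \<sigma> j s)" for s
        using p_triangle[of m "\<sigma> i s" "\<sigma> j s" "\<gamma> s"] p_simps(7)[of m "\<sigma> i s" "\<gamma> s"] by simp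
    qed (use int in \<open>simp add: set_integrable_def\<close>)
    also have "\<dots> = (\<integral>t. p m (\<gamma> t - \<sigma> i t) \<partial>lborel) + (\<integral>t. p m (\<gamma> t - \<sigma> j t) \<partial>lborel)"
      using int by (simp add: set_lebesgue_integral_def)
    finally show ?thesis using approx'[OF that(1)] approx'[OF that(2)] by linarith
  qed
  have "convergent I"
  proof (rule p_complete)
    fix m and e :: real assume e: "0 < e"
    obtain N where N: "inverse (Suc N) < e / 2"
      using reals_Archimedean[of "e / 2"] e by auto
    have "p m (I i - I j) < e" if "max m N \<le> i" "max m N \<le> j" for i j
    proof -
      have "inverse (Suc i) \<le> inverse (Suc N)" "inverse (Suc j) \<le> inverse (Suc N)"
        using that by auto
      then show ?thesis using diff[of m i j] that N by linarith
    qed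
    then show "\<exists>N. \<forall>i\<ge>N. \<forall>j\<ge>N. p m (I i - I j) < e" by blast
  qed
  then obtain L where L: "I \<longlonglongrightarrow> L" by (auto simp: convergent_def)
  have "has_weak_integral \<gamma> L UNIV"
  proof (subst has_weak_integral_iff[OF \<gamma>]; clarsimp)
    fix \<Lambda> :: "'e \<Rightarrow> real" assume \<Lambda>: "linear \<Lambda>" "continuous_on UNIV \<Lambda>"
    obtain m C where C: "0 < C" "\<And>x. \<bar>\<Lambda> x\<bar> \<le> C * p m x"
      using continuous_linear_le_p[OF \<Lambda>] by metis
    have "(\<lambda>k. \<Lambda> (I k)) \<longlonglongrightarrow> \<Lambda> L"
      using L \<Lambda>(2) by (auto simp: continuous_on_eq_continuous_at isCont_def intro: tendsto_compose)
    moreover have "(\<lambda>k. \<Lambda> (I k)) \<longlonglongrightarrow> (\<integral>t. \<Lambda> (\<gamma> t) \<partial>lborel)"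
    proof (rule LIM_zero_cancel, rule Lim_null_comparison)
      show "(\<lambda>k. C * inverse (Suc k)) \<longlonglongrightarrow> 0"
        using tendsto_mult_right_zero[OF LIMSEQ_inverse_real_of_nat, of C] by simp
      show "\<forall>\<^sub>F k in sequentially. norm (\<Lambda> (I k) - (\<integral>t. \<Lambda> (\<gamma> t) \<partial>lborel)) \<le> C * inverse (Suc k)"
        using eventually_ge_at_top[of m]
      proof eventually_elim
        case (elim k)
        note ints = L1_integrable_functional[OF \<gamma> \<Lambda>] L1_integrable_functional[OF \<sigma>[of k] \<Lambda>]
        have "\<Lambda> (I k) = (\<integral>t. \<Lambda> (\<sigma> k t) \<partial>lborel)"
          using I[of k] \<Lambda> by (auto simp: has_weak_integral_def set_lebesgue_integral_def)
        then have "norm (\<Lambda> (I k) - (\<integral>t. \<Lambda> (\<gamma> t) \<partial>lborel)) = norm (\<integral>t. \<Lambda> (\<sigma> k t) - \<Lambda> (\<gamma> t) \<partial>lborel)"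
          using ints by simp
        also have "\<dots> \<le> (\<integral>t. C * p m (\<gamma> t - \<sigma> k t) \<partial>lborel)"
        proof (rule Bochner_Integration.integral_norm_bound_integral)
          show "norm (\<Lambda> (\<sigma> k t) - \<Lambda> (\<gamma> t)) \<le> C * p m (\<gamma> t - \<sigma> k t)" for t
            using C(2)[of "\<sigma> k t - \<gamma> t"] by (simp add: linear_diff[OF \<Lambda>(1)] p_simps(7)[of m "\<gamma> t"])
        qed (use int ints in auto)
        also have "\<dots> \<le> C * inverse (Suc k)"
          using approx'[OF elim] C(1) by simp
        finally show ?case .
      qed
    qed
    ultimately show "\<Lambda> L = (LINT s:UNIV|lborel. \<Lambda> (\<gamma> s))"
      by (simp add: LIMSEQ_unique set_lebesgue_integral_def)
  qed
  then show ?thesis by blast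
qed

lemma has_weak_integral_restrict:
  "has_weak_integral (\<lambda>t. if t \<in> S then \<gamma> t else 0) I UNIV \<longleftrightarrow> has_weak_integral \<gamma> (I :: 'e) S"
proof -
  have "(\<lambda>t. indicator UNIV t *\<^sub>R \<Lambda> (if t \<in> S then \<gamma> t else 0)) = (\<lambda>t. indicator S t *\<^sub>R \<Lambda> (\<gamma> t))"
    if "linear \<Lambda>" for \<Lambda> :: "'e \<Rightarrow> real"
    by (auto simp: linear_0[OF that] indicator_def)
  then show ?thesis
    unfolding has_weak_integral_def set_integrable_def set_lebesgue_integral_def by simp
qed

lemma has_weak_integral_exists:
  "\<gamma> \<in> L1F \<Longrightarrow> S \<in> sets borel \<Longrightarrow> \<exists>I. has_weak_integral \<gamma> I S"
  using has_weak_integral_exists_UNIV[OF L1_restrict, of \<gamma> S] by (simp add: has_weak_integral_restrict)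

end


section \<open>Primitives\<close>

context frechet_seminorms
begin

definition prim :: "(real \<Rightarrow> 'e) \<Rightarrow> real \<Rightarrow> 'e" where
  "prim \<gamma> t = (THE I. has_weak_integral \<gamma> I {0..t})"

lemma prim_eqI: "has_weak_integral \<gamma> I {0..t} \<Longrightarrow> prim \<gamma> t = I"
  unfolding prim_def using has_weak_integral_unique by blast

lemma has_weak_integral_prim: "\<gamma> \<in> L1F \<Longrightarrow> has_weak_integral \<gamma> (prim \<gamma> t) {0..t}"
  using has_weak_integral_exists[of \<gamma> "{0..t}"] prim_eqI by auto

lemma prim_add: "\<gamma> \<in> L1F \<Longrightarrow> \<sigma> \<in> L1F \<Longrightarrow> prim (\<lambda>t. \<gamma> t + \<sigma> t) t = prim \<gamma> t + prim \<sigma> t"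
  by (intro prim_eqI has_weak_integral_add has_weak_integral_prim)

lemma prim_scaleR: "\<gamma> \<in> L1F \<Longrightarrow> prim (\<lambda>t. c *\<^sub>R \<gamma> t) t = c *\<^sub>R prim \<gamma> t"
  by (intro prim_eqI has_weak_integral_scaleR has_weak_integral_prim)

lemma prim_diff: "\<gamma> \<in> L1F \<Longrightarrow> \<sigma> \<in> L1F \<Longrightarrow> prim (\<lambda>t. \<gamma> t - \<sigma> t) t = prim \<gamma> t - prim \<sigma> t"
  by (intro prim_eqI has_weak_integral_diff has_weak_integral_prim)

lemma prim_zero [simp]: "prim (\<lambda>_. 0) t = 0"
  by (intro prim_eqI has_weak_integral_zero)

lemma has_weak_integral_prim_diff:
  assumes \<gamma>: "\<gamma> \<in> L1F" and st: "0 \<le> s" "s \<le> t"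
  shows "has_weak_integral \<gamma> (prim \<gamma> t - prim \<gamma> s) {s..t}"
proof (subst has_weak_integral_iff[OF \<gamma>]; clarsimp)
  fix \<Lambda> :: "'e \<Rightarrow> real" assume \<Lambda>: "linear \<Lambda>" "continuous_on UNIV \<Lambda>"
  note int = L1_integrable_functional[OF \<gamma> \<Lambda>]
  have "\<Lambda> (prim \<gamma> t) = (LINT u:{0..t}|lborel. \<Lambda> (\<gamma> u))" for t
    using has_weak_integral_prim[OF \<gamma>, of t] \<Lambda> unfolding has_weak_integral_def by blast
  then have "\<Lambda> (prim \<gamma> t) = integral {0..t} (\<lambda>u. \<Lambda> (\<gamma> u))" for t
    by (simp add: set_integrable_Icc(3)[OF int])
  then show "\<Lambda> (prim \<gamma> t - prim \<gamma> s) = (LINT u:{s..t}|lborel. \<Lambda> (\<gamma> u))"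
    using integral_Icc_diff[OF int st] set_integrable_Icc(3)[OF int]
    by (simp add: linear_diff[OF \<Lambda>(1)])
qed

lemma prim_diff_le:
  assumes "\<gamma> \<in> L1F" "0 \<le> s" "s \<le> t"
  shows "p n (prim \<gamma> t - prim \<gamma> s) \<le> integral {s..t} (\<lambda>u. p n (\<gamma> u))"
  using has_weak_integral_le[OF has_weak_integral_prim_diff[OF assms], of "\<lambda>u. p n (\<gamma> u)" n]
    set_integrable_Icc[OF L1_integrable_p[OF assms(1)]] by simp

lemma prim_le:
  assumes "\<gamma> \<in> L1F"
  shows "p n (prim \<gamma> t) \<le> integral {0..t} (\<lambda>u. p n (\<gamma> u))"
  using has_weak_integral_le[OF has_weak_integral_prim[OF assms], of t "\<lambda>u. p n (\<gamma> u)" n]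
    set_integrable_Icc[OF L1_integrable_p[OF assms(1)]] by simp

lemma prim_le_LINT:
  assumes "\<gamma> \<in> L1F"
  shows "p n (prim \<gamma> t) \<le> (\<integral>u. p n (\<gamma> u) \<partial>lborel)"
  using prim_le[OF assms] integral_Icc_le_LINT[OF L1_integrable_p[OF assms] p_simps(5)]
  by (rule order_trans)

lemma prim_at_0 [simp]: "\<gamma> \<in> L1F \<Longrightarrow> prim \<gamma> 0 = 0"
  using prim_le[of \<gamma> _ 0] p_simps(5)[of _ "prim \<gamma> 0"] by (intro p_eq_0_imp) (auto intro: antisym)

text \<open>Makes \<open>prim\<close> well defined on classes.\<close>

lemma prim_cong_AE:
  assumes "\<gamma> \<in> L1F" "\<sigma> \<in> L1F" "AE u in lborel. \<gamma> u = \<sigma> u"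
  shows "prim \<gamma> t = prim \<sigma> t"
proof -
  have "p n (prim \<gamma> t - prim \<sigma> t) = 0" for n
  proof -
    have "(\<integral>u. p n (\<gamma> u - \<sigma> u) \<partial>lborel) = integral\<^sup>L lborel (\<lambda>u::real. 0 :: real)"
      using assms(3) L1_integrable_p[OF L1_diff[OF assms(1,2)], of n]
      by (intro integral_cong_AE) (auto simp: p_simps(4) elim: eventually_mono)
    then show ?thesis
      using prim_le_LINT[OF L1_diff[OF assms(1,2)], of n t] p_simps(5)[of n "prim \<gamma> t - prim \<sigma> t"]
      by (simp add: prim_diff assms)
  qed
  then show ?thesis using p_eq_0_imp[of "prim \<gamma> t - prim \<sigma> t"] by simp
qed

lemma prim_dist_le:
  assumes "\<gamma> \<in> L1F" "0 \<le> s" "0 \<le> t"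
  shows "p n (prim \<gamma> s - prim \<gamma> t) \<le>
    \<bar>integral {0..s} (\<lambda>u. p n (\<gamma> u)) - integral {0..t} (\<lambda>u. p n (\<gamma> u))\<bar>"
proof (cases "s \<le> t")
  case True
  then show ?thesis
    using prim_diff_le[OF assms(1,2) True, of n] integral_Icc_diff[OF L1_integrable_p[OF assms(1)] assms(2) True, of n]
      p_simps(7)[of n "prim \<gamma> s"] by simp
next
  case False
  then show ?thesis
    using prim_diff_le[OF assms(1,3), of s n] integral_Icc_diff[OF L1_integrable_p[OF assms(1)] assms(3), of s n]
    by simp
qed

lemma continuous_on_prim:
  assumes "\<gamma> \<in> L1F"
  shows "continuous_on {0..1} (prim \<gamma>)"
  unfolding continuous_on_def tendsto_iff_p
proof (intro ballI allI)
  fix t :: real and n assume t: "t \<in> {0..1}"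
  let ?G = "\<lambda>t. integral {0..t} (\<lambda>u. p n (\<gamma> u))"
  have "(?G \<longlongrightarrow> ?G t) (at t within {0..1})"
    using continuous_on_primitive[OF L1_integrable_p[OF assms], of 0 1 n] t by (simp add: continuous_on_def)
  then have "((\<lambda>s. \<bar>?G s - ?G t\<bar>) \<longlongrightarrow> 0) (at t within {0..1})"
    by (simp add: LIM_zero tendsto_rabs_zero)
  then show "((\<lambda>s. p n (prim \<gamma> s - prim \<gamma> t)) \<longlongrightarrow> 0) (at t within {0..1})"
    by (rule Lim_null_comparison[rotated])
       (use t prim_dist_le[OF assms] in \<open>auto simp: eventually_at_filter p_simps(5)\<close>)
qed

lemma prim_const:
  assumes "t \<in> {0..1}"
  shows "prim (\<lambda>u. if u \<in> {0..1} then d else 0) t = t *\<^sub>R d"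
proof (rule prim_eqI, subst has_weak_integral_iff[OF L1_indicator]; clarsimp)
  fix \<Lambda> :: "'e \<Rightarrow> real" assume \<Lambda>: "linear \<Lambda>" "continuous_on UNIV \<Lambda>"
  have "(LINT u:{0..t}|lborel. \<Lambda> (if 0 \<le> u \<and> u \<le> 1 then d else 0)) = (LINT u:{0..t}|lborel. \<Lambda> d)"
    using assms by (intro set_lebesgue_integral_cong) auto
  also have "\<dots> = t * \<Lambda> d"
    using assms by (simp add: set_lebesgue_integral_def)
  finally show "\<Lambda> (t *\<^sub>R d) = (LINT u:{0..t}|lborel. \<Lambda> (if 0 \<le> u \<and> u \<le> 1 then d else 0))"
    by (simp add: linear_scale[OF \<Lambda>(1)])
qed

theorem prim_has_derivative_AE:
  assumes \<gamma>: "\<gamma> \<in> L1F"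
  shows "AE t in lborel. t \<in> {0..1} \<longrightarrow>
    ((\<lambda>s. (prim \<gamma> s - prim \<gamma> t) /\<^sub>R (s - t)) \<longlongrightarrow> \<gamma> t) (at t within {0..1})"
proof -
  obtain D where D: "countable D" "\<And>t n e. 0 < e \<Longrightarrow> \<exists>d\<in>D. p n (\<gamma> t - d) < e"
    using L1_smeas[OF \<gamma>] by (auto simp: smeas_def approximable_def)
  \<comment> \<open>The constant is cut off because elements of \<open>L1F\<close> vanish outside
    the unit interval.\<close>
  define c where "c d u = (if u \<in> {0..1::real} then d else 0)" for d :: 'e and u
  have c: "c d \<in> L1F" for d
    unfolding c_def by (rule L1_indicator) auto
  define \<gamma>' where "\<gamma>' d u = \<gamma> u - c d u" for d u
  have \<gamma>': "\<gamma>' d \<in> L1F" for d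
    unfolding \<gamma>'_def by (rule L1_diff[OF \<gamma> c])
  define I where "I n d t = integral {0..t} (\<lambda>u. p n (\<gamma>' d u))" for n d t
  define N where "N n d = {t\<in>{0..1}. \<not> ((\<lambda>s. (I n d s - I n d t) / (s - t)) \<longlongrightarrow> p n (\<gamma>' d t)) (at t within {0..1})}" for n d
  have "negligible (N n d)" for n d
    unfolding N_def I_def
    by (rule negligible_not_Lebesgue_differentiable) (rule set_integrable_Icc(2)[OF L1_integrable_p[OF \<gamma>']])
  then have "AE t in lborel. t \<notin> N n d" for n d
    using AE_not_in AE_completion_iff negligible_iff_null_sets by blast
  \<comment> \<open>Countably many null sets: almost every \<open>t\<close> is good for all centres
    and all seminorms at once.\<close>
  then have "AE t in lborel. \<forall>d\<in>D. \<forall>n. t \<notin> N n d"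
    by (simp add: AE_ball_countable[OF D(1)] AE_all_countable)
  then show ?thesis
  proof eventually_elim
    case (elim t)
    show ?case
    proof
      assume t: "t \<in> {0..1}"
      show "((\<lambda>s. (prim \<gamma> s - prim \<gamma> t) /\<^sub>R (s - t)) \<longlongrightarrow> \<gamma> t) (at t within {0..1})"
        unfolding tendsto_iff_p
      proof (intro allI)
        fix n
        show "((\<lambda>s. p n ((prim \<gamma> s - prim \<gamma> t) /\<^sub>R (s - t) - \<gamma> t)) \<longlongrightarrow> 0) (at t within {0..1})"
          unfolding tendsto_iff
        proof (intro allI impI)
          fix e :: real assume e: "0 < e"
          then obtain d where d: "d \<in> D" "p n (\<gamma> t - d) < e / 2"
            using D(2)[of "e / 2" n t] by auto
          have "t \<notin> N n d" using elim d by blast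
          then have "((\<lambda>s. (I n d s - I n d t) / (s - t)) \<longlongrightarrow> p n (\<gamma>' d t)) (at t within {0..1})"
            using t by (simp add: N_def)
          moreover have "p n (\<gamma>' d t) < e / 2" using d t by (simp add: \<gamma>'_def c_def)
          ultimately have "\<forall>\<^sub>F s in at t within {0..1}. (I n d s - I n d t) / (s - t) < e / 2"
            by (rule order_tendstoD(2))
          moreover have "\<forall>\<^sub>F s in at t within {0..1}. s \<in> {0..1} \<and> s \<noteq> t"
            by (auto simp: eventually_at_filter)
          ultimately show "\<forall>\<^sub>F s in at t within {0..1}.
              dist (p n ((prim \<gamma> s - prim \<gamma> t) /\<^sub>R (s - t) - \<gamma> t)) 0 < e"
          proof eventually_elim
            case (elim s)
            then have s: "s \<in> {0..1}" "s \<noteq> t" by auto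
            have mono: "I n d a \<le> I n d b" if "0 \<le> a" "a \<le> b" for a b
              unfolding I_def using integral_Icc_diff[OF L1_integrable_p[OF \<gamma>'] that, of n d]
                Henstock_Kurzweil_Integration.integral_nonneg[OF set_integrable_Icc(2)[OF L1_integrable_p[OF \<gamma>']], of a b n d]
              by (simp add: p_simps(5))
            have prim': "prim (\<gamma>' d) u = prim \<gamma> u - u *\<^sub>R d" if "u \<in> {0..1}" for u
              unfolding \<gamma>'_def using prim_diff[OF \<gamma> c] prim_const[OF that] by (simp add: c_def[abs_def])
            have "prim (\<gamma>' d) s - prim (\<gamma>' d) t = prim \<gamma> s - prim \<gamma> t - (s - t) *\<^sub>R d"
              by (simp add: prim'[OF s(1)] prim'[OF t] algebra_simps)
            then have le: "p n (prim \<gamma> s - prim \<gamma> t - (s - t) *\<^sub>R d) \<le> \<bar>I n d s - I n d t\<bar>"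
              using prim_dist_le[OF \<gamma>', of s t n d] s t by (simp add: I_def)
            have "(prim \<gamma> s - prim \<gamma> t) /\<^sub>R (s - t) - d = (1 / (s - t)) *\<^sub>R (prim \<gamma> s - prim \<gamma> t - (s - t) *\<^sub>R d)"
              using s by (simp add: scaleR_right_diff_distrib inverse_eq_divide)
            then have "p n ((prim \<gamma> s - prim \<gamma> t) /\<^sub>R (s - t) - d) =
                p n (prim \<gamma> s - prim \<gamma> t - (s - t) *\<^sub>R d) / \<bar>s - t\<bar>"
              by (simp add: p_simps(2))
            also have "\<dots> \<le> \<bar>I n d s - I n d t\<bar> / \<bar>s - t\<bar>"
              using le by (intro divide_right_mono) auto
            \<comment> \<open>\<open>I n d\<close> is increasing, so its quotient is nonnegative on
              either side of \<open>t\<close>. The difference quotient of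
              \<open>prim \<gamma>\<close> is thus within \<open>e / 2\<close> of \<open>d\<close>,
              which is within \<open>e / 2\<close> of \<open>\<gamma> t\<close>.\<close>
            also have "\<dots> = (I n d s - I n d t) / (s - t)"
              using mono[of s t] mono[of t s] s t by (cases "s \<le> t") (auto simp: abs_if divide_simps algebra_simps)
            finally show ?case
              unfolding dist_real_def using elim(1) d(2) p_triangle[of n "(prim \<gamma> s - prim \<gamma> t) /\<^sub>R (s - t)" "\<gamma> t" d]
                p_simps(7)[of n "\<gamma> t" d] p_simps(5)[of n "(prim \<gamma> s - prim \<gamma> t) /\<^sub>R (s - t) - \<gamma> t"]
              by linarith
          qed
        qed
      qed
    qed
  qed
qed

text \<open>Both functions are almost everywhere the derivative of the same primitive. This is the
  uniqueness of \<open>\<eta>'\<close>, on which the definite description in \<open>AC_deriv\<close>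
  rests.\<close>

lemma prim_inj_AE:
  assumes \<gamma>: "\<gamma> \<in> L1F" and \<sigma>: "\<sigma> \<in> L1F" and eq: "\<And>t. t \<in> {0..1} \<Longrightarrow> prim \<gamma> t = prim \<sigma> t"
  shows "AE t in lborel. \<gamma> t = \<sigma> t"
  using prim_has_derivative_AE[OF \<gamma>] prim_has_derivative_AE[OF \<sigma>]
proof eventually_elim
  case (elim t)
  show ?case
  proof (cases "t \<in> {0..1}")
    case True
    have "\<forall>\<^sub>F s in at t within {0..1}. (prim \<gamma> s - prim \<gamma> t) /\<^sub>R (s - t) = (prim \<sigma> s - prim \<sigma> t) /\<^sub>R (s - t)"
      using True eq by (auto simp: eventually_at_filter)
    then have "((\<lambda>s. (prim \<sigma> s - prim \<sigma> t) /\<^sub>R (s - t)) \<longlongrightarrow> \<gamma> t) (at t within {0..1})"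
      using elim(1) True by (auto elim: Lim_transform_eventually)
    moreover have "at t within {0..1} \<noteq> bot"
      using True by (simp add: trivial_limit_within)
    ultimately show ?thesis
      using elim(2) True tendsto_unique by blast
  qed (use L1_outside[OF \<gamma>] L1_outside[OF \<sigma>] in simp)
qed

lemma prim_restrict:
  assumes "\<gamma> \<in> L1F" "0 \<le> s"
  shows "prim (\<lambda>u. if u \<in> {..s} then \<gamma> u else 0) t = prim \<gamma> (min s t)"
proof (rule prim_eqI)
  have "{..s} \<inter> {0..t} = {0..min s t}" by auto
  then have eq: "(\<lambda>u. if u \<in> {0..t} then if u \<in> {..s} then \<gamma> u else 0 else 0) =
      (\<lambda>u. if u \<in> {0..min s t} then \<gamma> u else 0)"
    by auto
  show "has_weak_integral (\<lambda>u. if u \<in> {..s} then \<gamma> u else 0) (prim \<gamma> (min s t)) {0..t}"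
    using has_weak_integral_prim[OF assms(1), of "min s t"]
    unfolding has_weak_integral_restrict[symmetric, of _ _ "{0..t}"] has_weak_integral_restrict[symmetric, of _ _ "{0..min s t}"] eq .
qed

lemma prim_eq_0:
  assumes "\<gamma> \<in> L1F" "\<And>u. u \<in> {0..t} \<Longrightarrow> \<gamma> u = 0"
  shows "prim \<gamma> t = 0"
proof (rule p_eq_0_imp)
  fix n
  have "integral {0..t} (\<lambda>u. p n (\<gamma> u)) = integral {0..t} (\<lambda>u. 0)"
    using assms(2) by (intro integral_cong) (auto simp: p_simps(4))
  then show "p n (prim \<gamma> t) = 0"
    using prim_le[OF assms(1), of n t] p_simps(5)[of n "prim \<gamma> t"] by simp
qed

end


section \<open>Linear differential equations\<close>

locale m_convex_seminorms = frechet_seminorms p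
  for p :: "nat \<Rightarrow> 'a::continuous_inverse_algebra \<Rightarrow> real" +
  assumes p_mult: "p n (x * y) \<le> p n x * p n y"
begin

abbreviation L1_norm :: "nat \<Rightarrow> (real \<Rightarrow> 'a) \<Rightarrow> real" where
  "L1_norm n \<gamma> \<equiv> \<integral>t. p n (\<gamma> t) \<partial>lborel"

lemma L1_norm_nonneg: "0 \<le> L1_norm n \<gamma>"
  by (intro Bochner_Integration.integral_nonneg) (simp add: p_simps(5))

lemma L1_continuous_mult:
  assumes \<eta>: "continuous_on {0..1} \<eta>" "\<And>n t. t \<in> {0..1} \<Longrightarrow> p n (\<eta> t) \<le> C n" and \<gamma>: "\<gamma> \<in> L1F"
  shows "(\<lambda>t. \<eta> t * \<gamma> t) \<in> L1F"
proof (rule L1_dominatedI)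
  have "continuous_on UNIV (\<lambda>(x, y). x * y :: 'a)"
    unfolding case_prod_beta continuous_on_def
    by (intro ballI tendsto_mult tendsto_fst tendsto_snd tendsto_ident_at)
  then have "smeas (\<lambda>t. (if t \<in> {0..1} then \<eta> t else 0) * \<gamma> t)"
    by (rule smeas_comp2[OF smeas_continuous_on_Icc[OF \<eta>(1)] L1_smeas[OF \<gamma>]])
  also have "(\<lambda>t. (if t \<in> {0..1} then \<eta> t else 0) * \<gamma> t) = (\<lambda>t. \<eta> t * \<gamma> t)"
    using L1_outside[OF \<gamma>] by (auto simp: fun_eq_iff)
  finally show "smeas (\<lambda>t. \<eta> t * \<gamma> t)" .
  show "\<eta> t * \<gamma> t = 0" if "t \<notin> {0..1}" for t
    using L1_outside[OF \<gamma> that] by simp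
  fix n
  have "p n (\<eta> t * \<gamma> t) \<le> C n * p n (\<gamma> t)" for t
  proof (cases "t \<in> {0..1}")
    case True
    then show ?thesis
      using p_mult[of n "\<eta> t" "\<gamma> t"] \<eta>(2)[OF True, of n] p_simps(5)[of n "\<gamma> t"]
      by (meson mult_right_mono order_trans)
  qed (use L1_outside[OF \<gamma>, of t] in \<open>auto simp: p_simps(4)\<close>)
  then show "\<exists>g. integrable lborel g \<and> (\<forall>t. p n (\<eta> t * \<gamma> t) \<le> g t)"
    using L1_integrable_p[OF \<gamma>, of n] by (intro exI[of _ "\<lambda>t. C n * p n (\<gamma> t)"]) simp
qed

text \<open>The map \<open>B\<close> of the overview on representatives, not a convolution. Being
  defined at each point, it allows equations that hold at every time.\<close>

definition conv :: "(real \<Rightarrow> 'a) \<Rightarrow> (real \<Rightarrow> 'a) \<Rightarrow> real \<Rightarrow> 'a" where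
  "conv \<rho> \<gamma> t = prim \<rho> t * \<gamma> t"

lemma L1_conv: "\<rho> \<in> L1F \<Longrightarrow> \<gamma> \<in> L1F \<Longrightarrow> conv \<rho> \<gamma> \<in> L1F"
  unfolding conv_def by (rule L1_continuous_mult[OF continuous_on_prim prim_le_LINT])

lemma p_conv_le:
  assumes "\<rho> \<in> L1F"
  shows "p n (conv \<rho> \<gamma> t) \<le> integral {0..t} (\<lambda>u. p n (\<rho> u)) * p n (\<gamma> t)"
  unfolding conv_def using p_mult[of n "prim \<rho> t" "\<gamma> t"] prim_le[OF assms, of n t] p_simps(5)[of n "\<gamma> t"]
  by (meson mult_right_mono order_trans)

lemma L1_norm_mono:
  assumes "\<gamma> \<in> L1F" "integrable lborel g" "\<And>t. p n (\<gamma> t) \<le> g t"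
  shows "L1_norm n \<gamma> \<le> (\<integral>t. g t \<partial>lborel)"
  using assms by (intro integral_mono L1_integrable_p)

lemma L1_norm_conv_le:
  assumes \<rho>: "\<rho> \<in> L1F" and \<gamma>: "\<gamma> \<in> L1F"
  shows "L1_norm n (conv \<rho> \<gamma>) \<le> L1_norm n \<rho> * L1_norm n \<gamma>"
proof -
  have "p n (conv \<rho> \<gamma> t) \<le> L1_norm n \<rho> * p n (\<gamma> t)" for t
    using p_conv_le[OF \<rho>, of n \<gamma> t] integral_Icc_le_LINT[OF L1_integrable_p[OF \<rho>] p_simps(5), of 0 t n]
      p_simps(5)[of n "\<gamma> t"]
    by (meson mult_right_mono order_trans)
  then have "L1_norm n (conv \<rho> \<gamma>) \<le> (\<integral>t. L1_norm n \<rho> * p n (\<gamma> t) \<partial>lborel)"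
    using L1_integrable_p[OF \<gamma>] by (intro L1_norm_mono L1_conv \<rho> \<gamma>) auto
  then show ?thesis by simp
qed

lemma integral_p_nonneg: "\<gamma> \<in> L1F \<Longrightarrow> 0 \<le> integral {a..b} (\<lambda>u. p n (\<gamma> u))"
  by (intro Henstock_Kurzweil_Integration.integral_nonneg set_integrable_Icc(2) L1_integrable_p)
     (auto simp: p_simps(5))

lemma integral_p_mono:
  assumes "\<gamma> \<in> L1F" "0 \<le> s" "s \<le> t"
  shows "integral {0..s} (\<lambda>u. p n (\<gamma> u)) \<le> integral {0..t} (\<lambda>u. p n (\<gamma> u))"
  using integral_Icc_diff[OF L1_integrable_p[OF assms(1)] assms(2,3), of n]
    integral_p_nonneg[OF assms(1), of s t n] by simp

text \<open>On \<open>{s..t}\<close> the primitive of \<open>\<rho>\<close> is bounded by the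
  integral up to the later time \<open>t\<close>, which yields exactly the shape of the hypothesis
  \<open>step\<close> in \<open>Gronwall_bound\<close>.\<close>

lemma integral_p_conv_le:
  assumes \<rho>: "\<rho> \<in> L1F" and \<gamma>: "\<gamma> \<in> L1F" and "0 \<le> s" "s \<le> t"
  shows "integral {s..t} (\<lambda>u. p n (conv \<rho> \<gamma> u)) \<le>
    integral {0..t} (\<lambda>u. p n (\<rho> u)) * integral {s..t} (\<lambda>u. p n (\<gamma> u))"
proof -
  have "integral {s..t} (\<lambda>u. p n (conv \<rho> \<gamma> u)) \<le>
      integral {s..t} (\<lambda>u. integral {0..t} (\<lambda>u. p n (\<rho> u)) * p n (\<gamma> u))"
  proof (rule integral_le)
    fix u assume "u \<in> {s..t}"
    then show "p n (conv \<rho> \<gamma> u) \<le> integral {0..t} (\<lambda>u. p n (\<rho> u)) * p n (\<gamma> u)"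
      using p_conv_le[OF \<rho>, of n \<gamma> u] integral_p_mono[OF \<rho>, of u t n] assms(3) p_simps(5)[of n "\<gamma> u"]
      by (meson atLeastAtMost_iff mult_right_mono order_trans)
  qed (intro set_integrable_Icc(2) L1_integrable_p L1_conv \<rho> \<gamma> integrable_mult_right)+
  then show ?thesis by simp
qed

text \<open>The bound \<open>2\<^sup>N\<close> replaces \<open>exp (L1_norm n \<gamma>)\<close>; any bound locally uniform in \<open>\<gamma>\<close> would do.\<close>

lemma linear_equation_bound:
  assumes L1: "\<rho> \<in> L1F" "\<gamma> \<in> L1F" "\<sigma> \<in> L1F" and eq: "AE t in lborel. \<rho> t = conv \<rho> \<gamma> t + \<sigma> t"
    and N: "2 * L1_norm n \<gamma> \<le> real N" and t: "t \<in> {0..1}"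
  shows "integral {0..t} (\<lambda>u. p n (\<rho> u)) \<le> 2 ^ N * integral {0..t} (\<lambda>u. p n (\<sigma> u))"
proof -
  let ?I = "\<lambda>\<gamma> t. integral {0..t} (\<lambda>u. p n (\<gamma> u))"
  \<comment> \<open>The right-hand side obeys the pointwise estimate at every time, while
    \<open>\<rho>\<close> equals it only almost everywhere; their integrals coincide.\<close>
  define \<rho>' where "\<rho>' t = conv \<rho> \<gamma> t + \<sigma> t" for t
  have \<rho>': "\<rho>' \<in> L1F"
    unfolding \<rho>'_def by (intro L1_add L1_conv L1)
  have int: "integrable lborel (\<lambda>u. p n (\<gamma> u))" if "\<gamma> \<in> L1F" for \<gamma>
    by (rule L1_integrable_p[OF that])
  have eqI: "?I \<rho> t = ?I \<rho>' t" for t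
  proof -
    have "(LINT u:{0..t}|lborel. p n (\<rho> u)) = (LINT u:{0..t}|lborel. p n (\<rho>' u))"
      using eq int[OF L1(1)] int[OF \<rho>'] unfolding set_lebesgue_integral_def
      by (intro integral_cong_AE) (auto simp: \<rho>'_def elim!: eventually_mono)
    then show ?thesis using int[OF L1(1)] int[OF \<rho>'] by (simp add: set_integrable_Icc(3))
  qed
  have "?I \<rho>' t \<le> 2 ^ N * ?I \<sigma> t"
  proof (rule Gronwall_bound[where G = "?I \<gamma>" and S = "?I \<sigma>" and r = "?I \<rho>'"])
    show "continuous_on {0..1} (?I \<gamma>)"
      by (rule continuous_on_primitive[OF int[OF L1(2)]])
    show "?I \<sigma> s \<le> ?I \<sigma> t" if "0 \<le> s" "s \<le> t" "t \<le> 1" for s t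
      by (rule integral_p_mono[OF L1(3) that(1,2)])
    show "0 \<le> ?I \<rho>' t" for t by (rule integral_p_nonneg[OF \<rho>'])
    show "?I \<gamma> t \<le> real N / 2"
      using integral_Icc_le_LINT[OF int[OF L1(2)] p_simps(5), of 0 t] N by simp
    fix s t :: real assume st: "0 \<le> s" "s \<le> t" "t \<le> 1"
    have "?I \<rho>' t - ?I \<rho>' s = integral {s..t} (\<lambda>u. p n (\<rho>' u))"
      by (rule integral_Icc_diff[OF int[OF \<rho>'] st(1,2)])
    also have "\<dots> \<le> integral {s..t} (\<lambda>u. p n (conv \<rho> \<gamma> u) + p n (\<sigma> u))"
      using int[OF \<rho>'] int[OF L1(3)] int[OF L1_conv[OF L1(1,2)]]
      by (intro integral_le set_integrable_Icc(2)) (auto simp: \<rho>'_def p_simps(1))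
    also have "\<dots> = integral {s..t} (\<lambda>u. p n (conv \<rho> \<gamma> u)) + integral {s..t} (\<lambda>u. p n (\<sigma> u))"
      by (intro Henstock_Kurzweil_Integration.integral_add set_integrable_Icc(2) int L1_conv L1)
    also have "\<dots> \<le> ?I \<rho>' t * (?I \<gamma> t - ?I \<gamma> s) + (?I \<sigma> t - ?I \<sigma> s)"
      using integral_p_conv_le[OF L1(1,2) st(1,2), of n] eqI
        integral_Icc_diff[OF int[OF L1(2)] st(1,2)] integral_Icc_diff[OF int[OF L1(3)] st(1,2)]
      by simp
    finally show "?I \<rho>' t - ?I \<rho>' s \<le> ?I \<sigma> t - ?I \<sigma> s + ?I \<rho>' t * (?I \<gamma> t - ?I \<gamma> s)" by simp
  qed (use t in auto)
  then show ?thesis by (simp add: eqI)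
qed

lemma linear_equation_norm_bound:
  assumes L1: "\<rho> \<in> L1F" "\<gamma> \<in> L1F" "\<sigma> \<in> L1F" and eq: "AE t in lborel. \<rho> t = conv \<rho> \<gamma> t + \<sigma> t"
    and N: "2 * L1_norm n \<gamma> \<le> real N"
  shows "L1_norm n \<rho> \<le> 2 ^ N * L1_norm n \<sigma>"
  using linear_equation_bound[OF assms, of 1]
    integral_01_eq_LINT[OF L1_integrable_p[OF L1(1)], of n] integral_01_eq_LINT[OF L1_integrable_p[OF L1(3)], of n]
    L1_outside[OF L1(1)] L1_outside[OF L1(3)]
  by (simp add: p_simps(4))

lemma L1_norm_eq_0_imp_AE:
  assumes "\<gamma> \<in> L1F" "\<And>n. L1_norm n \<gamma> = 0"
  shows "AE t in lborel. \<gamma> t = 0"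
proof -
  have "AE t in lborel. \<forall>n. p n (\<gamma> t) = 0"
    using assms L1_integrable_p[OF assms(1)]
    by (subst AE_all_countable, intro allI, subst integral_nonneg_eq_0_iff_AE[symmetric])
       (auto simp: p_simps(5))
  then show ?thesis
    by eventually_elim (rule p_eq_0_imp, simp)
qed

text \<open>The difference of two solutions has inhomogeneity 0, so the Gronwall bound makes all its
  seminorms vanish.\<close>

lemma linear_equation_unique:
  assumes L1: "\<rho> \<in> L1F" "\<rho>' \<in> L1F" "\<gamma> \<in> L1F"
    and eq: "AE t in lborel. \<rho> t = conv \<rho> \<gamma> t + \<sigma> t" "AE t in lborel. \<rho>' t = conv \<rho>' \<gamma> t + \<sigma> t"
  shows "AE t in lborel. \<rho> t = \<rho>' t"
proof -
  have "AE t in lborel. \<rho> t - \<rho>' t = conv (\<lambda>t. \<rho> t - \<rho>' t) \<gamma> t + 0"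
    using eq by eventually_elim (simp add: conv_def prim_diff L1 algebra_simps)
  then have "L1_norm n (\<lambda>t. \<rho> t - \<rho>' t) = 0" for n
    using linear_equation_norm_bound[OF L1_diff[OF L1(1,2)] L1(3) L1_zero, of n "nat \<lceil>2 * L1_norm n \<gamma>\<rceil>"]
      L1_norm_nonneg[of n "\<lambda>t. \<rho> t - \<rho>' t"] L1_norm_nonneg[of n \<gamma>]
    by (simp add: p_simps(4) real_nat_ceiling_ge antisym)
  from L1_norm_eq_0_imp_AE[OF L1_diff[OF L1(1,2)] this] show ?thesis
    by eventually_elim simp
qed

text \<open>These are the terms of the Neumann series, not its partial sums.\<close>

primrec picard :: "(real \<Rightarrow> 'a) \<Rightarrow> (real \<Rightarrow> 'a) \<Rightarrow> nat \<Rightarrow> real \<Rightarrow> 'a" where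
  "picard \<gamma> \<sigma> 0 = \<sigma>"
| "picard \<gamma> \<sigma> (Suc k) = conv (picard \<gamma> \<sigma> k) \<gamma>"

lemma L1_picard: "\<gamma> \<in> L1F \<Longrightarrow> \<sigma> \<in> L1F \<Longrightarrow> picard \<gamma> \<sigma> k \<in> L1F"
  by (induction k) (auto intro: L1_conv)

text \<open>Gronwall's lemma is applied to whole partial sums: the increment of term
  \<open>k + 1\<close> is controlled by term \<open>k\<close>, so a partial sum satisfies the
  inequality with source \<open>\<sigma>\<close>, and the resulting bound does not depend on
  \<open>M\<close>.\<close>

lemma summable_picard:
  assumes L1: "\<gamma> \<in> L1F" "\<sigma> \<in> L1F"
  shows "summable (\<lambda>k. L1_norm n (picard \<gamma> \<sigma> k))"
proof -
  let ?I = "\<lambda>\<gamma> t. integral {0..t} (\<lambda>u. p n (\<gamma> u))"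
  note int = L1_integrable_p
  obtain N where N: "2 * L1_norm n \<gamma> \<le> real N"
    using real_arch_simple by blast
  have "(\<Sum>k<M. ?I (picard \<gamma> \<sigma> k) 1) \<le> 2 ^ N * ?I \<sigma> 1" for M
  proof (rule Gronwall_bound[where G = "?I \<gamma>" and S = "?I \<sigma>" and r = "\<lambda>t. \<Sum>k<M. ?I (picard \<gamma> \<sigma> k) t"])
    show "continuous_on {0..1} (?I \<gamma>)"
      by (rule continuous_on_primitive[OF int[OF L1(1)]])
    show "?I \<sigma> s \<le> ?I \<sigma> t" if "0 \<le> s" "s \<le> t" "t \<le> 1" for s t
      by (rule integral_p_mono[OF L1(2) that(1,2)])
    show "0 \<le> (\<Sum>k<M. ?I (picard \<gamma> \<sigma> k) t)" for t
      by (intro sum_nonneg integral_p_nonneg L1_picard L1)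
    show "?I \<gamma> 1 \<le> real N / 2"
      using integral_Icc_le_LINT[OF int[OF L1(1)] p_simps(5), of 0 1 n] N by linarith
    fix s t :: real assume st: "0 \<le> s" "s \<le> t" "t \<le> 1"
    have diff: "?I \<rho> t - ?I \<rho> s = integral {s..t} (\<lambda>u. p n (\<rho> u))" if "\<rho> \<in> L1F" for \<rho>
      by (rule integral_Icc_diff[OF int[OF that] st(1,2)])
    have a: "(\<Sum>k<Suc M. ?I (picard \<gamma> \<sigma> k) t - ?I (picard \<gamma> \<sigma> k) s) \<le>
        (?I \<sigma> t - ?I \<sigma> s) + (\<Sum>k<M. ?I (picard \<gamma> \<sigma> k) t * (?I \<gamma> t - ?I \<gamma> s))" for M
      unfolding sum.lessThan_Suc_shift
    proof (intro add_mono sum_mono)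
      fix k
      show "?I (picard \<gamma> \<sigma> (Suc k)) t - ?I (picard \<gamma> \<sigma> (Suc k)) s \<le> ?I (picard \<gamma> \<sigma> k) t * (?I \<gamma> t - ?I \<gamma> s)"
        unfolding diff[OF L1(1)] diff[OF L1_picard[OF L1]]
        using integral_p_conv_le[OF L1_picard[OF L1] L1(1) st(1,2)] by simp
    qed simp
    \<comment> \<open>One further term on the left aligns the indices with those of the shifted sum;
      its increment is nonnegative.\<close>
    have b: "(\<Sum>k<M. ?I (picard \<gamma> \<sigma> k) t - ?I (picard \<gamma> \<sigma> k) s) \<le>
        (\<Sum>k<Suc M. ?I (picard \<gamma> \<sigma> k) t - ?I (picard \<gamma> \<sigma> k) s)"
      using integral_p_mono[OF L1_picard[OF L1] st(1,2)] by simp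
    show "(\<Sum>k<M. ?I (picard \<gamma> \<sigma> k) t) - (\<Sum>k<M. ?I (picard \<gamma> \<sigma> k) s) \<le>
        ?I \<sigma> t - ?I \<sigma> s + (\<Sum>k<M. ?I (picard \<gamma> \<sigma> k) t) * (?I \<gamma> t - ?I \<gamma> s)"
      using order_trans[OF b a] by (simp add: sum_subtractf sum_distrib_right)
  qed auto
  moreover have "?I (picard \<gamma> \<sigma> k) 1 = L1_norm n (picard \<gamma> \<sigma> k)" for k
    using L1_outside[OF L1_picard[OF L1]]
    by (intro integral_01_eq_LINT int L1_picard L1) (simp add: p_simps(4))
  ultimately show ?thesis
    by (intro summableI_nonneg_bounded[where x = "2 ^ N * ?I \<sigma> 1"]) (auto simp: L1_norm_nonneg)
qed

text \<open>The series is summed after taking primitives. There it converges at each time by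
  completeness of the algebra, and uniformly, to a continuous \<open>\<eta>\<close>; then
  \<open>\<eta> \<gamma> + \<sigma>\<close> is integrable by construction, which takes the place of
  a limit of integrable functions. It remains to see that its primitive is
  \<open>\<eta>\<close>.\<close>

lemma linear_equation_solution:
  assumes L1: "\<gamma> \<in> L1F" "\<sigma> \<in> L1F"
  obtains \<rho> where "\<rho> \<in> L1F" "\<And>t. \<rho> t = conv \<rho> \<gamma> t + \<sigma> t"
proof -
  let ?P = "picard \<gamma> \<sigma>"
  note P = L1_picard[OF L1]
  define \<eta>s where "\<eta>s M t = (\<Sum>k<M. prim (?P k) t)" for M t
  \<comment> \<open>Remainder of the series of norms, a bound uniform in time.\<close>
  define tail where "tail n M = (\<Sum>k. L1_norm n (?P k)) - (\<Sum>k<M. L1_norm n (?P k))" for n M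
  have tail0: "tail n \<longlonglongrightarrow> 0" for n
  proof -
    have "(\<lambda>M. (\<Sum>k. L1_norm n (?P k)) - (\<Sum>k<M. L1_norm n (?P k))) \<longlonglongrightarrow>
        (\<Sum>k. L1_norm n (?P k)) - (\<Sum>k. L1_norm n (?P k))"
      by (intro tendsto_diff tendsto_const summable_LIMSEQ summable_picard L1)
    then show ?thesis by (simp add: tail_def[abs_def])
  qed
  have diff: "p n (\<eta>s L t - \<eta>s M t) \<le> tail n M" if "M \<le> L" for n L M t
  proof -
    have "\<eta>s L t - \<eta>s M t = (\<Sum>k\<in>{M..<L}. prim (?P k) t)"
      using that by (simp add: \<eta>s_def sum_diff_nat_ivl lessThan_atLeast0)
    also have "p n \<dots> \<le> (\<Sum>k\<in>{M..<L}. p n (prim (?P k) t))"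
    proof (induction L)
      case (Suc L)
      then show ?case
        using p_simps(1)[of n "\<Sum>k\<in>{M..<L}. prim (?P k) t" "prim (?P L) t"]
        by (cases "M \<le> L") (auto simp: p_simps(4))
    qed (simp add: p_simps(4))
    also have "\<dots> \<le> (\<Sum>k\<in>{M..<L}. L1_norm n (?P k))"
      by (intro sum_mono prim_le_LINT P)
    also have "\<dots> = (\<Sum>k<L. L1_norm n (?P k)) - (\<Sum>k<M. L1_norm n (?P k))"
      using that by (simp add: sum_diff_nat_ivl lessThan_atLeast0)
    also have "\<dots> \<le> tail n M"
      unfolding tail_def
      using sum_le_suminf[OF summable_picard[OF L1, of n], of "{..<L}"] L1_norm_nonneg by simp
    finally show ?thesis .
  qed
  have "convergent (\<lambda>M. \<eta>s M t)" for t
  proof (rule p_complete)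
    fix n and e :: real assume e: "0 < e"
    obtain N where N: "\<And>M. N \<le> M \<Longrightarrow> tail n M < e"
      using order_tendstoD(2)[OF tail0 e, of n] by (auto simp: eventually_sequentially)
    have "p n (\<eta>s i t - \<eta>s j t) < e" if "N \<le> i" "N \<le> j" for i j
    proof (cases "i \<le> j")
      case True
      then show ?thesis using diff[OF True, of n t] N[OF that(1)] p_simps(7)[of n "\<eta>s i t"] by simp
    next
      case False
      then show ?thesis using diff[of j i n t] N[OF that(2)] by simp
    qed
    then show "\<exists>N. \<forall>i\<ge>N. \<forall>j\<ge>N. p n (\<eta>s i t - \<eta>s j t) < e" by blast
  qed
  then obtain \<eta> where \<eta>: "\<And>t. (\<lambda>M. \<eta>s M t) \<longlonglongrightarrow> \<eta> t"
    unfolding convergent_def by metis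
  have \<eta>_diff: "p n (\<eta> t - \<eta>s M t) \<le> tail n M" for n t M
  proof -
    have "(\<lambda>L. \<eta>s L t - \<eta>s M t) \<longlonglongrightarrow> \<eta> t - \<eta>s M t"
      by (intro tendsto_intros \<eta>)
    then have "(\<lambda>L. p n (\<eta>s L t - \<eta>s M t)) \<longlonglongrightarrow> p n (\<eta> t - \<eta>s M t)"
      using p_cont[of n] by (auto simp: continuous_on_eq_continuous_at isCont_def intro: tendsto_compose)
    then show ?thesis
      by (rule tendsto_upperbound) (auto intro: eventually_sequentiallyI[of M] diff)
  qed
  have \<eta>s_cont: "continuous_on {0..1} (\<eta>s M)" for M
    unfolding \<eta>s_def continuous_on_def
  proof (intro ballI)
    fix t :: real assume "t \<in> {0..1}"
    then have "(prim (?P k) \<longlongrightarrow> prim (?P k) t) (at t within {0..1})" for k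
      using continuous_on_prim[OF P] by (auto simp: continuous_on_def)
    then show "((\<lambda>t. \<Sum>k<M. prim (?P k) t) \<longlongrightarrow> (\<Sum>k<M. prim (?P k) t)) (at t within {0..1})"
      by (induction M) (auto intro: tendsto_add)
  qed
  have \<eta>_cont: "continuous_on {0..1} \<eta>"
    unfolding continuous_on_def tendsto_iff_p
  proof (intro ballI allI)
    fix t :: real and n assume t: "t \<in> {0..1}"
    show "((\<lambda>s. p n (\<eta> s - \<eta> t)) \<longlongrightarrow> 0) (at t within {0..1})"
      unfolding tendsto_iff
    proof (intro allI impI)
      fix e :: real assume e: "0 < e"
      obtain M where M: "tail n M < e / 3"
        using order_tendstoD(2)[OF tail0, of "e / 3" n] e by (auto simp: eventually_sequentially)
      have "((\<lambda>s. p n (\<eta>s M s - \<eta>s M t)) \<longlongrightarrow> 0) (at t within {0..1})"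
        using \<eta>s_cont[of M] t unfolding continuous_on_def tendsto_iff_p by blast
      then have "\<forall>\<^sub>F s in at t within {0..1}. p n (\<eta>s M s - \<eta>s M t) < e / 3"
        using e by (intro order_tendstoD(2)) auto
      then show "\<forall>\<^sub>F s in at t within {0..1}. dist (p n (\<eta> s - \<eta> t)) 0 < e"
      proof eventually_elim
        case (elim s)
        then show ?case
          unfolding dist_real_def
          using M \<eta>_diff[of n s M] \<eta>_diff[of n t M] p_triangle[of n "\<eta> s" "\<eta> t" "\<eta>s M s"]
            p_triangle[of n "\<eta>s M s" "\<eta> t" "\<eta>s M t"] p_simps(7)[of n "\<eta> t" "\<eta>s M t"] p_simps(5)[of n "\<eta> s - \<eta> t"]
          by linarith
      qed
    qed
  qed
  \<comment> \<open>\<open>\<eta>s 0\<close> is the empty sum, so the remainder at 0 bounds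
    \<open>\<eta>\<close> itself.\<close>
  have \<eta>_bound: "p n (\<eta> t) \<le> tail n 0" for n t
    using \<eta>_diff[of n t 0] by (simp add: \<eta>s_def)
  define \<rho> where "\<rho> t = \<eta> t * \<gamma> t + \<sigma> t" for t
  have \<rho>: "\<rho> \<in> L1F"
    unfolding \<rho>_def by (intro L1_add L1_continuous_mult[OF \<eta>_cont \<eta>_bound] L1)
  have \<eta>s_mult: "(\<lambda>u. \<eta>s M u * \<gamma> u) \<in> L1F" for M
  proof (rule L1_continuous_mult[OF \<eta>s_cont _ L1(1)])
    show "p n (\<eta>s M t) \<le> tail n 0 + tail n M" for n t
      using p_triangle[of n "\<eta>s M t" 0 "\<eta> t"] \<eta>_diff[of n t M] \<eta>_bound[of n t] p_simps(7)[of n "\<eta> t" "\<eta>s M t"]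
      by simp
  qed
  \<comment> \<open>Multiplication by \<open>\<gamma>\<close> turns the primitive of term
    \<open>k\<close> into term \<open>k + 1\<close>. With \<open>\<sigma>\<close> as term 0,
    integration gives the next partial sum.\<close>
  have prim_\<eta>s: "prim (\<lambda>u. \<eta>s M u * \<gamma> u + \<sigma> u) t = \<eta>s (Suc M) t" for M t
  proof (induction M)
    case (Suc M)
    have "(\<lambda>u. \<eta>s (Suc M) u * \<gamma> u + \<sigma> u) = (\<lambda>u. (\<eta>s M u * \<gamma> u + \<sigma> u) + ?P (Suc M) u)"
      by (simp add: \<eta>s_def conv_def algebra_simps)
    then show ?case
      using prim_add[OF L1_add[OF \<eta>s_mult L1(2)] P, of M "Suc M" t] Suc by (simp add: \<eta>s_def)
  qed (simp add: \<eta>s_def)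
  have "prim \<rho> t = \<eta> t" for t
  proof (rule LIMSEQ_unique)
    show "(\<lambda>M. \<eta>s (Suc M) t) \<longlonglongrightarrow> \<eta> t"
      using \<eta> by (rule LIMSEQ_Suc)
    show "(\<lambda>M. \<eta>s (Suc M) t) \<longlonglongrightarrow> prim \<rho> t"
      unfolding tendsto_iff_p
    proof
      fix n
      have bound: "p n (\<eta>s (Suc M) t - prim \<rho> t) \<le> tail n M * L1_norm n \<gamma>" for M
      proof -
        note d = L1_diff[OF L1_add[OF \<eta>s_mult L1(2)] \<rho>]
        have "\<eta>s (Suc M) t - prim \<rho> t = prim (\<lambda>u. \<eta>s M u * \<gamma> u + \<sigma> u - \<rho> u) t"
          by (simp only: prim_diff[OF L1_add[OF \<eta>s_mult L1(2)] \<rho>] prim_\<eta>s)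
        then have "p n (\<eta>s (Suc M) t - prim \<rho> t) \<le> L1_norm n (\<lambda>u. \<eta>s M u * \<gamma> u + \<sigma> u - \<rho> u)"
          using prim_le_LINT[OF d] by simp
        also have "\<dots> \<le> (\<integral>u. tail n M * p n (\<gamma> u) \<partial>lborel)"
        proof (rule L1_norm_mono[OF d])
          show "integrable lborel (\<lambda>u. tail n M * p n (\<gamma> u))"
            using L1_integrable_p[OF L1(1)] by simp
          show "p n (\<eta>s M u * \<gamma> u + \<sigma> u - \<rho> u) \<le> tail n M * p n (\<gamma> u)" for u
          proof -
            have "p n (\<eta>s M u * \<gamma> u + \<sigma> u - \<rho> u) = p n ((\<eta>s M u - \<eta> u) * \<gamma> u)"
              by (simp add: \<rho>_def algebra_simps)
            also have "\<dots> \<le> p n (\<eta>s M u - \<eta> u) * p n (\<gamma> u)" by (rule p_mult)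
            also have "\<dots> \<le> tail n M * p n (\<gamma> u)"
              using \<eta>_diff[of n u M] by (intro mult_right_mono) (auto simp: p_simps(5) p_simps(7)[of n "\<eta> u"])
            finally show ?thesis .
          qed
        qed
        finally show ?thesis by simp
      qed
      have lim: "(\<lambda>M. tail n M * L1_norm n \<gamma>) \<longlonglongrightarrow> 0"
        by (intro tendsto_mult_left_zero tail0)
      show "(\<lambda>M. p n (\<eta>s (Suc M) t - prim \<rho> t)) \<longlonglongrightarrow> 0"
        by (rule Lim_null_comparison[OF always_eventually lim]) (simp add: p_simps(5) bound)
    qed
  qed
  then have "\<rho> t = conv \<rho> \<gamma> t + \<sigma> t" for t
    by (simp add: conv_def \<rho>_def)
  with \<rho> show ?thesis by (rule that)
qed

text \<open>The chosen function solves the equation at every time, which keeps null sets out of the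
  identities that follow.\<close>

definition resolvent :: "(real \<Rightarrow> 'a) \<Rightarrow> (real \<Rightarrow> 'a) \<Rightarrow> real \<Rightarrow> 'a" where
  "resolvent \<gamma> \<sigma> = (SOME \<rho>. \<rho> \<in> L1F \<and> (\<forall>t. \<rho> t = conv \<rho> \<gamma> t + \<sigma> t))"

lemma resolvent:
  assumes "\<gamma> \<in> L1F" "\<sigma> \<in> L1F"
  shows "resolvent \<gamma> \<sigma> \<in> L1F" "resolvent \<gamma> \<sigma> t = conv (resolvent \<gamma> \<sigma>) \<gamma> t + \<sigma> t"
proof -
  have "\<exists>\<rho>. \<rho> \<in> L1F \<and> (\<forall>t. \<rho> t = conv \<rho> \<gamma> t + \<sigma> t)"
    using linear_equation_solution[OF assms] by metis
  from someI_ex[OF this] show "resolvent \<gamma> \<sigma> \<in> L1F" "resolvent \<gamma> \<sigma> t = conv (resolvent \<gamma> \<sigma>) \<gamma> t + \<sigma> t"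
    unfolding resolvent_def by blast+
qed

section \<open>Factorization and invertibility of the evolution\<close>

definition evolution :: "(real \<Rightarrow> 'a) \<Rightarrow> real \<Rightarrow> 'a" where
  "evolution \<gamma> t = 1 + prim (resolvent \<gamma> \<gamma>) t"

lemma resolvent_eq_evolution: "\<gamma> \<in> L1F \<Longrightarrow> resolvent \<gamma> \<gamma> t = evolution \<gamma> t * \<gamma> t"
  using resolvent(2)[of \<gamma> \<gamma> t] by (simp add: evolution_def conv_def algebra_simps)

lemma L1_mult_left:
  assumes "\<gamma> \<in> L1F"
  shows "(\<lambda>t. a * \<gamma> t) \<in> L1F"
  by (rule L1_continuous_mult[OF _ _ assms, of "\<lambda>_. a" "\<lambda>n. p n a"]) auto

text \<open>Composing a continuous functional with left multiplication by \<open>a\<close> gives a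
  continuous functional, so the factor passes through the weak integral.\<close>

lemma prim_mult_left:
  assumes \<gamma>: "\<gamma> \<in> L1F"
  shows "prim (\<lambda>t. a * \<gamma> t) t = a * prim \<gamma> t"
proof (rule prim_eqI, subst has_weak_integral_iff[OF L1_mult_left[OF \<gamma>]]; clarsimp)
  fix \<Lambda> :: "'a \<Rightarrow> real" assume \<Lambda>: "linear \<Lambda>" "continuous_on UNIV \<Lambda>"
  have "linear (\<lambda>x. \<Lambda> (a * x))"
    by (intro linearI) (simp_all add: distrib_left linear_add[OF \<Lambda>(1)] linear_scale[OF \<Lambda>(1)])
  moreover have "continuous_on UNIV (\<lambda>x. \<Lambda> (a * x))"
    by (rule continuous_on_compose2[OF \<Lambda>(2)]) (auto simp: continuous_on_def intro: tendsto_intros)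
  ultimately show "\<Lambda> (a * prim \<gamma> t) = (LINT u:{0..t}|lborel. \<Lambda> (a * \<gamma> u))"
    using has_weak_integral_prim[OF \<gamma>, of t] unfolding has_weak_integral_def by blast
qed

text \<open>Solutions starting at \<open>1\<close> at time \<open>s\<close> give the factorization from which invertibility follows.\<close>

lemma evolution_split:
  assumes \<gamma>: "\<gamma> \<in> L1F" and s: "0 \<le> s" "s \<le> t" "t \<le> 1"
  defines "\<gamma>' \<equiv> \<lambda>u. if u \<in> {s<..} then \<gamma> u else 0"
  shows "evolution \<gamma> t = evolution \<gamma> s * evolution \<gamma>' t"
proof -
  have \<gamma>': "\<gamma>' \<in> L1F"
    unfolding \<gamma>'_def by (rule L1_restrict[OF \<gamma>]) auto
  let ?\<rho> = "resolvent \<gamma> \<gamma>" and ?\<rho>' = "resolvent \<gamma>' \<gamma>'"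
  note \<rho> = resolvent(1)[OF \<gamma> \<gamma>] and \<rho>' = resolvent(1)[OF \<gamma>' \<gamma>']
  \<comment> \<open>Derivative of the path that follows \<open>evolution \<gamma>\<close> up to
    \<open>s\<close> and then \<open>evolution \<gamma> s\<close> times the restarted solution.
    Uniqueness will identify it with \<open>?\<rho>\<close>.\<close>
  define \<rho>'' where "\<rho>'' u = (if u \<in> {..s} then ?\<rho> u else 0) + evolution \<gamma> s * ?\<rho>' u" for u
  have r: "(\<lambda>u. if u \<in> {..s} then ?\<rho> u else 0) \<in> L1F"
    by (rule L1_restrict[OF \<rho>]) auto
  have \<rho>'': "\<rho>'' \<in> L1F"
    unfolding \<rho>''_def by (intro L1_add r L1_mult_left \<rho>')
  have prim'': "prim \<rho>'' u = prim ?\<rho> (min s u) + evolution \<gamma> s * prim ?\<rho>' u" for u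
    unfolding \<rho>''_def using prim_add[OF r L1_mult_left[OF \<rho>']] prim_restrict[OF \<rho> s(1)] prim_mult_left[OF \<rho>']
    by simp
  \<comment> \<open>Up to time \<open>s\<close> the restarted solution stands still.\<close>
  have zero: "?\<rho>' u = 0" if "u \<le> s" for u
    using resolvent_eq_evolution[OF \<gamma>', of u] that by (simp add: \<gamma>'_def)
  have "\<rho>'' u = conv \<rho>'' \<gamma> u + \<gamma> u" for u
  proof (cases "u \<le> s")
    case True
    have "prim ?\<rho>' u = 0"
      using zero True by (intro prim_eq_0[OF \<rho>']) auto
    then show ?thesis
      using True resolvent(2)[OF \<gamma> \<gamma>, of u] zero[OF True]
      by (simp add: \<rho>''_def conv_def prim'' min_absorb2)
  next
    case False
    then have "\<rho>'' u = evolution \<gamma> s * evolution \<gamma>' u * \<gamma> u"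
      using resolvent_eq_evolution[OF \<gamma>', of u] by (simp add: \<rho>''_def \<gamma>'_def mult.assoc)
    also have "evolution \<gamma> s * evolution \<gamma>' u = 1 + prim \<rho>'' u"
      using False by (simp add: prim'' evolution_def algebra_simps)
    finally show ?thesis by (simp add: conv_def algebra_simps)
  qed
  then have "AE u in lborel. ?\<rho> u = \<rho>'' u"
    using resolvent(2)[OF \<gamma> \<gamma>] by (intro linear_equation_unique[OF \<rho> \<rho>'' \<gamma>, of \<gamma>] AE_I2) auto
  then have "prim ?\<rho> t = prim \<rho>'' t"
    by (rule prim_cong_AE[OF \<rho> \<rho>''])
  then show ?thesis
    using s by (simp add: evolution_def prim'' algebra_simps)
qed

lemma Units_mult_closed:
  "x \<in> Units mult_monoid \<Longrightarrow> y \<in> Units mult_monoid \<Longrightarrow> x * y \<in> Units (mult_monoid :: 'a monoid)"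
  using monoid.m_closed group.is_monoid[OF group_unit_group] by fastforce

lemma evolution_in_Units:
  assumes \<gamma>: "\<gamma> \<in> L1F" and t: "t \<in> {0..1}"
  shows "evolution \<gamma> t \<in> Units mult_monoid"
proof -
  have one: "1 \<in> Units (mult_monoid :: 'a monoid)"
    using mult_monoid.Units_one_closed by simp
  obtain n e where e: "0 < e" "\<And>x :: 'a. p n (x - 1) < e \<Longrightarrow> x \<in> Units mult_monoid"
    using open_contains_p_ball[OF open_Units one] by metis
  \<comment> \<open>This \<open>N\<close> serves all restarted equations, since cutting
    \<open>\<gamma>\<close> off does not increase its norm.\<close>
  obtain N where N: "2 * L1_norm n \<gamma> \<le> real N"
    using real_arch_simple by blast
  let ?G = "\<lambda>t. integral {0..t} (\<lambda>u. p n (\<gamma> u))"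
  have "uniformly_continuous_on {0..1} ?G"
    using continuous_on_primitive[OF L1_integrable_p[OF \<gamma>]]
    by (intro compact_uniformly_continuous) auto
  \<comment> \<open>Compensates the Gronwall factor \<open>2 ^ N\<close>, so that short evolutions
    stay within \<open>e\<close> of 1.\<close>
  moreover have "0 < e / 2 ^ N" using e by simp
  ultimately obtain \<delta> where \<delta>: "0 < \<delta>"
    "\<And>s t. s \<in> {0..1} \<Longrightarrow> t \<in> {0..1} \<Longrightarrow> dist s t < \<delta> \<Longrightarrow> dist (?G s) (?G t) < e / 2 ^ N"
    unfolding uniformly_continuous_on_def by metis
  have step: "evolution \<gamma> t \<in> Units mult_monoid"
    if st: "evolution \<gamma> s \<in> Units mult_monoid" "0 \<le> s" "s \<le> t" "t \<le> 1" "t - s < \<delta>" for s t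
  proof -
    define \<gamma>' where "\<gamma>' = (\<lambda>u. if u \<in> {s<..} then \<gamma> u else 0)"
    have \<gamma>': "\<gamma>' \<in> L1F"
      unfolding \<gamma>'_def by (rule L1_restrict[OF \<gamma>]) auto
    have "L1_norm n \<gamma>' \<le> L1_norm n \<gamma>"
      using L1_integrable_p[OF \<gamma>] by (intro L1_norm_mono[OF \<gamma>']) (auto simp: \<gamma>'_def p_simps(4,5))
    then have N': "2 * L1_norm n \<gamma>' \<le> real N" using N by simp
    have "p n (evolution \<gamma>' t - 1) \<le> integral {0..t} (\<lambda>u. p n (resolvent \<gamma>' \<gamma>' u))"
      using prim_le[OF resolvent(1)[OF \<gamma>' \<gamma>'], of n t] by (simp add: evolution_def)
    also have "\<dots> \<le> 2 ^ N * integral {0..t} (\<lambda>u. p n (\<gamma>' u))"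
      using st
      by (intro linear_equation_bound[OF resolvent(1)[OF \<gamma>' \<gamma>'] \<gamma>' \<gamma>' AE_I2[OF resolvent(2)[OF \<gamma>' \<gamma>']] N']) auto
    also have "integral {0..t} (\<lambda>u. p n (\<gamma>' u)) = integral {s..t} (\<lambda>u. p n (\<gamma>' u))"
    proof -
      have "integral {0..s} (\<lambda>u. p n (\<gamma>' u)) = integral {0..s} (\<lambda>u. 0)"
        by (intro integral_cong) (auto simp: \<gamma>'_def p_simps(4))
      then show ?thesis
        using integral_Icc_diff[OF L1_integrable_p[OF \<gamma>'] st(2,3), of n] by simp
    qed
    also have "\<dots> \<le> integral {s..t} (\<lambda>u. p n (\<gamma> u))"
      by (intro integral_le set_integrable_Icc(2) L1_integrable_p \<gamma> \<gamma>') (auto simp: \<gamma>'_def p_simps(4,5))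
    also have "\<dots> = ?G t - ?G s"
      using integral_Icc_diff[OF L1_integrable_p[OF \<gamma>] st(2,3), of n] by simp
    also have "\<dots> < e / 2 ^ N"
      using \<delta>(2)[of t s] st by (simp add: dist_real_def)
    finally have "p n (evolution \<gamma>' t - 1) < e"
      by (simp add: field_simps)
    then have "evolution \<gamma>' t \<in> Units mult_monoid" by (rule e(2))
    then show ?thesis
      using evolution_split[OF \<gamma> st(2,3,4)] st(1) Units_mult_closed unfolding \<gamma>'_def by metis
  qed
  \<comment> \<open>Units are propagated in steps of length \<open>\<delta> / 2\<close>, half the
    threshold because the inequality in \<open>step\<close> is strict.\<close>
  have "\<forall>t. 0 \<le> t \<and> t \<le> 1 \<and> t \<le> real k * (\<delta> / 2) \<longrightarrow> evolution \<gamma> t \<in> Units mult_monoid" for k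
  proof (induction k)
    case 0
    then show ?case
      using one resolvent(1)[OF \<gamma> \<gamma>] by (auto simp: evolution_def)
  next
    case (Suc k)
    show ?case
    proof (intro allI impI)
      fix t assume t: "0 \<le> t \<and> t \<le> 1 \<and> t \<le> real (Suc k) * (\<delta> / 2)"
      define s where "s = max 0 (t - \<delta> / 2)"
      have "s \<le> real k * (\<delta> / 2)"
        unfolding s_def using t \<delta>(1) by (intro max.boundedI) (auto simp: field_simps)
      then have "evolution \<gamma> s \<in> Units mult_monoid"
        using Suc t \<delta>(1) by (auto simp: s_def)
      then show "evolution \<gamma> t \<in> Units mult_monoid"
        using t \<delta>(1) by (intro step[of s t]) (auto simp: s_def)
    qed
  qed
  moreover obtain k where "2 / \<delta> \<le> real k"
    using real_arch_simple by blast
  then have "t \<le> real k * (\<delta> / 2)"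
    using t \<delta>(1) by (simp add: field_simps)
  ultimately show ?thesis using t by auto
qed

end


section \<open>Continuity of the solution operator\<close>

context m_convex_seminorms
begin

abbreviation L1 :: "'a ae_fun topology" where "L1 \<equiv> L1_space 0 1"
abbreviation L1S :: "'a ae_fun set" where "L1S \<equiv> ae_class ` L1F"
abbreviation nrm :: "nat \<Rightarrow> 'a ae_fun \<Rightarrow> real" where "nrm n \<equiv> L1_seminorm (p n)"

lemma ae_class_eq_iff: "ae_class f = ae_class g \<longleftrightarrow> (AE t in lborel. f t = g t)"
  by (rule ae_fun.abs_eq_iff)

lemmas ae_class_simps = plus_ae_fun.abs_eq minus_ae_fun.abs_eq scaleR_ae_fun.abs_eq uminus_ae_fun.abs_eq
  zero_ae_fun.abs_eq

definition repr :: "'a ae_fun \<Rightarrow> real \<Rightarrow> 'a" where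
  "repr x = (SOME \<gamma>. \<gamma> \<in> L1F \<and> ae_class \<gamma> = x)"

lemma repr: "x \<in> L1S \<Longrightarrow> repr x \<in> L1F" "x \<in> L1S \<Longrightarrow> ae_class (repr x) = x"
proof -
  assume "x \<in> L1S"
  then have "\<exists>\<gamma>. \<gamma> \<in> L1F \<and> ae_class \<gamma> = x" by blast
  from someI_ex[OF this] show "repr x \<in> L1F" "ae_class (repr x) = x"
    unfolding repr_def by blast+
qed

lemma repr_AE: "\<gamma> \<in> L1F \<Longrightarrow> AE t in lborel. repr (ae_class \<gamma>) t = \<gamma> t"
  using repr(2)[OF imageI] by (simp only: ae_class_eq_iff)

lemma subspace_L1S: "subspace L1S"
proof (rule subspaceI)
  show "0 \<in> L1S"
    using L1_zero by (auto simp: ae_class_simps)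
  show "x + y \<in> L1S" if "x \<in> L1S" "y \<in> L1S" for x y
    using that L1_add by (auto simp: ae_class_simps)
  show "c *\<^sub>R x \<in> L1S" if "x \<in> L1S" for c x
    using that L1_scaleR by (auto simp: ae_class_simps)
qed

lemma L1_integrable_seminorm:
  assumes "\<gamma> \<in> L1F" "cont_seminorm q"
  shows "integrable lborel (\<lambda>t. q (\<gamma> t))"
proof -
  obtain n C where C: "0 < C" "\<And>x. q x \<le> C * p n x"
    using cont_seminorm_le_p[OF assms(2)] by metis
  have "norm (q x) \<le> norm (C * p n x)" for x
    using C seminormD(5)[of q x] assms(2) p_simps(5)[of n x] by (simp add: cont_seminorm_def abs_mult)
  moreover have "integrable lborel (\<lambda>t. C * p n (\<gamma> t))"
    using L1_integrable_p[OF assms(1)] by simp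
  ultimately show ?thesis
    using borel_measurable_cont_seminorm[OF L1_smeas[OF assms(1)] assms(2)]
    by (elim Bochner_Integration.integrable_bound) auto
qed

lemma L1_seminorm_eq:
  assumes "\<gamma> \<in> L1F" "cont_seminorm q"
  shows "L1_seminorm q (ae_class \<gamma>) = (\<integral>t. q (\<gamma> t) \<partial>lborel)"
  using integral_eq_nn_integral[of "\<lambda>t. q (\<gamma> t)" lborel] L1_integrable_seminorm[OF assms]
    assms(2) seminormD(5)[of q]
  by (simp add: L1_seminorm.abs_eq cont_seminorm_def)

lemma seminorm_on_L1:
  assumes q: "cont_seminorm q"
  shows "seminorm_on L1S (L1_seminorm q)"
  unfolding seminorm_on_def
proof (intro conjI ballI allI)
  note qs = seminormD[of q] and s = q[unfolded cont_seminorm_def, THEN conjunct1]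
  note int = L1_integrable_seminorm[OF _ q]
  fix x assume "x \<in> L1S"
  then obtain \<gamma> where x: "x = ae_class \<gamma>" and \<gamma>: "\<gamma> \<in> L1F" by blast
  show "L1_seminorm q (c *\<^sub>R x) = \<bar>c\<bar> * L1_seminorm q x" for c
    using L1_seminorm_eq[OF L1_scaleR[OF \<gamma>] q, of c] L1_seminorm_eq[OF \<gamma> q]
    by (simp add: x ae_class_simps qs(2)[OF s])
  fix y assume "y \<in> L1S"
  then obtain \<sigma> where y: "y = ae_class \<sigma>" and \<sigma>: "\<sigma> \<in> L1F" by blast
  have "(\<integral>t. q (\<gamma> t + \<sigma> t) \<partial>lborel) \<le> (\<integral>t. q (\<gamma> t) + q (\<sigma> t) \<partial>lborel)"
    using int[OF \<gamma>] int[OF \<sigma>] int[OF L1_add[OF \<gamma> \<sigma>]] qs(1)[OF s] by (intro integral_mono) auto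
  then show "L1_seminorm q (x + y) \<le> L1_seminorm q x + L1_seminorm q y"
    using L1_seminorm_eq[OF L1_add[OF \<gamma> \<sigma>] q] L1_seminorm_eq[OF \<gamma> q] L1_seminorm_eq[OF \<sigma> q]
      int[OF \<gamma>] int[OF \<sigma>] by (simp add: x y ae_class_simps)
qed

lemmas nrm_simps = seminorm_onD[OF seminorm_on_L1[OF cont_seminorm_p] subspace_L1S]
lemmas L1S_intros = subspace_add[OF subspace_L1S] subspace_diff[OF subspace_L1S] subspace_scale[OF subspace_L1S]
  subspace_0[OF subspace_L1S] subspace_neg[OF subspace_L1S]

lemma nrm_ae_class: "\<gamma> \<in> L1F \<Longrightarrow> nrm n (ae_class \<gamma>) = L1_norm n \<gamma>"
  by (rule L1_seminorm_eq) auto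

lemma nrm_eq_0_imp: "x \<in> L1S \<Longrightarrow> (\<And>n. nrm n x = 0) \<Longrightarrow> x = 0"
  using L1_norm_eq_0_imp_AE by (auto simp: nrm_ae_class ae_class_simps ae_class_eq_iff)

lemma topspace_L1 [simp]: "topspace L1 = L1S"
  by (simp add: L1_space_def)

lemma Hausdorff_L1: "Hausdorff_space L1"
  unfolding L1_space_def
proof (rule Hausdorff_seminorm_topology[OF subspace_L1S])
  show "x = 0" if "x \<in> L1S" "\<And>q. q \<in> L1_seminorm ` Collect cont_seminorm \<Longrightarrow> q x = 0" for x
    using that by (intro nrm_eq_0_imp) auto
qed (auto intro: seminorm_on_L1)

text \<open>The topology is defined by all continuous seminorms, but each is dominated by a multiple
  of some \<open>p n\<close>, and this domination survives integration.\<close>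

lemma limitin_L1:
  "limitin L1 f l F \<longleftrightarrow> l \<in> L1S \<and> (\<forall>\<^sub>F x in F. f x \<in> L1S) \<and> (\<forall>n. ((\<lambda>x. nrm n (f x - l)) \<longlongrightarrow> 0) F)"
proof -
  have "((\<lambda>x. L1_seminorm q (f x - l)) \<longlongrightarrow> 0) F"
    if l: "l \<in> L1S" "\<forall>\<^sub>F x in F. f x \<in> L1S" and lim: "\<forall>n. ((\<lambda>x. nrm n (f x - l)) \<longlongrightarrow> 0) F" and q: "cont_seminorm q" for q
  proof -
    obtain n C where C: "0 < C" "\<And>x. q x \<le> C * p n x"
      using cont_seminorm_le_p[OF q] by metis
    have le: "L1_seminorm q z \<le> C * nrm n z" if "z \<in> L1S" for z
    proof -
      obtain \<gamma> where \<gamma>: "\<gamma> \<in> L1F" "z = ae_class \<gamma>" using \<open>z \<in> L1S\<close> by blast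
      have "(\<integral>t. q (\<gamma> t) \<partial>lborel) \<le> (\<integral>t. C * p n (\<gamma> t) \<partial>lborel)"
        using C L1_integrable_seminorm[OF \<gamma>(1) q] L1_integrable_p[OF \<gamma>(1)] by (intro integral_mono) auto
      then show ?thesis
        using L1_seminorm_eq[OF \<gamma>(1) q] nrm_ae_class[OF \<gamma>(1), of n] \<gamma>(2) by simp
    qed
    have "((\<lambda>x. C * nrm n (f x - l)) \<longlongrightarrow> 0) F"
      using lim by (intro tendsto_mult_right_zero) auto
    moreover have "\<forall>\<^sub>F x in F. norm (L1_seminorm q (f x - l)) \<le> C * nrm n (f x - l)"
      using l(2)
    proof eventually_elim
      case (elim x)
      then have "f x - l \<in> L1S" using l(1) by (intro L1S_intros)
      then show ?case
        using le seminorm_onD(5)[OF seminorm_on_L1[OF q] subspace_L1S] by simp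
    qed
    ultimately show ?thesis by (rule Lim_null_comparison[rotated])
  qed
  moreover have "nrm n \<in> L1_seminorm ` Collect cont_seminorm" for n by auto
  ultimately show ?thesis
    unfolding L1_space_def
    by (subst limitin_seminorm_topology[OF subspace_L1S]) (auto intro: seminorm_on_L1)
qed

section \<open>The bilinear map and the resolvent on classes\<close>

definition B :: "'a ae_fun \<Rightarrow> 'a ae_fun \<Rightarrow> 'a ae_fun" where
  "B x y = ae_class (conv (repr x) (repr y))"

definition R :: "'a ae_fun \<Rightarrow> 'a ae_fun \<Rightarrow> 'a ae_fun" where
  "R x s = ae_class (resolvent (repr x) (repr s))"

lemma prim_repr: "\<gamma> \<in> L1F \<Longrightarrow> prim (repr (ae_class \<gamma>)) t = prim \<gamma> t"
  by (intro prim_cong_AE repr repr_AE) auto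

lemma B_ae_class: "\<gamma> \<in> L1F \<Longrightarrow> \<sigma> \<in> L1F \<Longrightarrow> B (ae_class \<gamma>) (ae_class \<sigma>) = ae_class (conv \<gamma> \<sigma>)"
  using repr_AE[of \<sigma>] by (auto simp: B_def ae_class_eq_iff conv_def prim_repr elim: eventually_mono)

lemma B_closed: "x \<in> L1S \<Longrightarrow> y \<in> L1S \<Longrightarrow> B x y \<in> L1S"
  by (auto simp: B_ae_class intro: L1_conv)

lemma B_diff_left: "x \<in> L1S \<Longrightarrow> x' \<in> L1S \<Longrightarrow> y \<in> L1S \<Longrightarrow> B (x - x') y = B x y - B x' y"
  by (auto simp: ae_class_simps B_ae_class L1_diff conv_def[abs_def] prim_diff algebra_simps)

lemma B_scaleR_left: "x \<in> L1S \<Longrightarrow> y \<in> L1S \<Longrightarrow> B (c *\<^sub>R x) y = c *\<^sub>R B x y"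
  by (auto simp: ae_class_simps B_ae_class L1_scaleR conv_def[abs_def] prim_scaleR)

lemma B_add_right: "x \<in> L1S \<Longrightarrow> y \<in> L1S \<Longrightarrow> y' \<in> L1S \<Longrightarrow> B x (y + y') = B x y + B x y'"
  by (auto simp: ae_class_simps B_ae_class L1_add conv_def[abs_def] algebra_simps)

lemma B_diff_right: "x \<in> L1S \<Longrightarrow> y \<in> L1S \<Longrightarrow> y' \<in> L1S \<Longrightarrow> B x (y - y') = B x y - B x y'"
  by (auto simp: ae_class_simps B_ae_class L1_diff conv_def[abs_def] algebra_simps)

lemma B_scaleR_right: "x \<in> L1S \<Longrightarrow> y \<in> L1S \<Longrightarrow> B x (c *\<^sub>R y) = c *\<^sub>R B x y"
  by (auto simp: ae_class_simps B_ae_class L1_scaleR conv_def[abs_def])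

lemma nrm_B_le: "x \<in> L1S \<Longrightarrow> y \<in> L1S \<Longrightarrow> nrm n (B x y) \<le> nrm n x * nrm n y"
  by (auto simp: B_ae_class nrm_ae_class L1_conv L1_norm_conv_le)

lemma R_closed: "x \<in> L1S \<Longrightarrow> s \<in> L1S \<Longrightarrow> R x s \<in> L1S"
  unfolding R_def by (intro imageI resolvent repr)

lemma R_eq:
  assumes "x \<in> L1S" "s \<in> L1S"
  shows "R x s = B (R x s) x + s"
proof -
  let ?\<rho> = "resolvent (repr x) (repr s)"
  note L1 = repr(1)[OF assms(1)] repr(1)[OF assms(2)]
  have "B (R x s) x = ae_class (conv ?\<rho> (repr x))"
    using B_ae_class[OF resolvent(1)[OF L1] L1(1)] repr(2)[OF assms(1)] by (simp add: R_def)
  moreover have "?\<rho> = (\<lambda>t. conv ?\<rho> (repr x) t + repr s t)"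
    using resolvent(2)[OF L1] by (simp add: fun_eq_iff)
  then have "R x s = ae_class (conv ?\<rho> (repr x)) + ae_class (repr s)"
    unfolding R_def ae_class_simps by simp
  ultimately show ?thesis
    using repr(2)[OF assms(2)] by simp
qed

lemma B_R: "x \<in> L1S \<Longrightarrow> s \<in> L1S \<Longrightarrow> B (R x s) x = R x s - s"
  by (metis R_eq add_diff_cancel_right')

lemma nrm_le_if_linear_equation:
  assumes L1: "r \<in> L1S" "x \<in> L1S" "s \<in> L1S" and eq: "r = B r x + s" and N: "2 * nrm n x \<le> real N"
  shows "nrm n r \<le> 2 ^ N * nrm n s"
proof -
  obtain \<rho> \<gamma> \<sigma> where *: "\<rho> \<in> L1F" "\<gamma> \<in> L1F" "\<sigma> \<in> L1F" "r = ae_class \<rho>" "x = ae_class \<gamma>" "s = ae_class \<sigma>"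
    using L1 by blast
  then have "AE t in lborel. \<rho> t = conv \<rho> \<gamma> t + \<sigma> t"
    using eq by (simp add: B_ae_class ae_class_simps ae_class_eq_iff)
  then show ?thesis
    using linear_equation_norm_bound[OF *(1-3), of n N] N * by (simp add: nrm_ae_class)
qed

text \<open>Identities such as \<open>R_diff\<close> and \<open>R_scaleR\<close> are obtained from
  this by checking that the other side solves the equation.\<close>

lemma linear_equation_unique_L1:
  assumes "r \<in> L1S" "x \<in> L1S" "s \<in> L1S" "r = B r x + s"
  shows "r = R x s"
proof -
  let ?d = "r - R x s"
  have d: "?d \<in> L1S" using assms R_closed by (intro L1S_intros) auto
  have "B r x = r - s"
    using assms(4) by (metis add_diff_cancel_right')
  then have "?d = B ?d x + 0"
    using assms(1-3) R_closed B_R[OF assms(2,3)] by (simp add: B_diff_left)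
  then have "nrm n ?d \<le> 2 ^ nat \<lceil>2 * nrm n x\<rceil> * nrm n 0" for n
    by (rule nrm_le_if_linear_equation[OF d assms(2) L1S_intros(4)]) (rule real_nat_ceiling_ge)
  then have "nrm n ?d = 0" for n
    using nrm_simps(5)[OF d, of n] by (simp add: nrm_simps(4) antisym)
  from nrm_eq_0_imp[OF d this] show ?thesis by simp
qed

text \<open>With \<open>x'\<close> in place of \<open>x\<close>, the equation for
  \<open>R x s\<close> has the defect \<open>B (R x s) (x' - x)\<close>, which moves into the
  inhomogeneity. The formula is exact, without remainder, and yields both continuity and the
  derivative of \<open>R\<close>.\<close>

lemma R_diff:
  assumes L1: "x \<in> L1S" "x' \<in> L1S" "s \<in> L1S" "s' \<in> L1S"
  shows "R x' s' - R x s = R x' ((s' - s) + B (R x s) (x' - x))"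
proof (rule linear_equation_unique_L1)
  show "R x' s' - R x s = B (R x' s' - R x s) x' + ((s' - s) + B (R x s) (x' - x))"
    using B_R[OF L1(1,3)] B_R[OF L1(2,4)] R_closed L1
    by (simp add: B_diff_left B_diff_right)
qed (intro L1S_intros B_closed R_closed L1)+

lemma R_scaleR:
  assumes "x \<in> L1S" "s \<in> L1S"
  shows "R x (c *\<^sub>R s) = c *\<^sub>R R x s"
proof (rule linear_equation_unique_L1[symmetric])
  show "c *\<^sub>R R x s = B (c *\<^sub>R R x s) x + c *\<^sub>R s"
    by (simp add: B_scaleR_left B_R R_closed assms scaleR_diff_right)
qed (intro L1S_intros R_closed assms)+

lemma limitin_L1I:
  assumes l: "l \<in> L1S" and f: "\<forall>\<^sub>F t in F. f t \<in> L1S"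
    and bound: "\<And>n. \<forall>\<^sub>F t in F. nrm n (f t - l) \<le> g n t" and g: "\<And>n. (g n \<longlongrightarrow> 0) F"
  shows "limitin L1 f l F"
  unfolding limitin_L1
proof (intro conjI allI l f)
  fix n
  have "\<forall>\<^sub>F t in F. norm (nrm n (f t - l)) \<le> g n t"
    using f bound[of n]
    by eventually_elim (use nrm_simps(5)[OF subspace_diff[OF subspace_L1S _ l]] in simp)
  then show "((\<lambda>t. nrm n (f t - l)) \<longlongrightarrow> 0) F"
    by (rule Lim_null_comparison[OF _ g])
qed

lemma limitin_L1D:
  assumes "limitin L1 f l F"
  shows "l \<in> L1S" "\<forall>\<^sub>F t in F. f t \<in> L1S" "((\<lambda>t. nrm n (f t - l)) \<longlongrightarrow> 0) F"
  using assms by (auto simp: limitin_L1)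

lemma limitin_L1_add:
  assumes f: "limitin L1 f x F" and g: "limitin L1 g y F"
  shows "limitin L1 (\<lambda>t. f t + g t) (x + y) F"
proof (rule limitin_L1I)
  note xy = limitin_L1D(1)[OF f] limitin_L1D(1)[OF g]
  show "x + y \<in> L1S" using xy by (intro L1S_intros)
  show "\<forall>\<^sub>F t in F. f t + g t \<in> L1S"
    using limitin_L1D(2)[OF f] limitin_L1D(2)[OF g] by eventually_elim (rule L1S_intros)
  show "((\<lambda>t. nrm n (f t - x) + nrm n (g t - y)) \<longlongrightarrow> 0) F" for n
    using tendsto_add[OF limitin_L1D(3)[OF f] limitin_L1D(3)[OF g]] by simp
  show "\<forall>\<^sub>F t in F. nrm n (f t + g t - (x + y)) \<le> nrm n (f t - x) + nrm n (g t - y)" for n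
    using limitin_L1D(2)[OF f] limitin_L1D(2)[OF g]
  proof eventually_elim
    case (elim t)
    then show ?case
      using nrm_simps(1)[OF L1S_intros(2) L1S_intros(2), of "f t" x "g t" y n] xy
      by (simp add: algebra_simps)
  qed
qed

lemma tendsto_nrm:
  assumes "limitin L1 f x F"
  shows "((\<lambda>t. nrm n (f t)) \<longlongrightarrow> nrm n x) F"
proof (rule LIM_zero_cancel, rule Lim_null_comparison[OF _ limitin_L1D(3)[OF assms]])
  note x = limitin_L1D(1)[OF assms]
  show "\<forall>\<^sub>F t in F. norm (nrm n (f t) - nrm n x) \<le> nrm n (f t - x)"
    using limitin_L1D(2)[OF assms]
  proof eventually_elim
    case (elim t)
    then have "f t - x \<in> L1S" using x by (intro L1S_intros)
    then show ?case
      using nrm_simps(1)[of "f t - x" x n] nrm_simps(6)[of "f t" "f t - x" n] x elim by simp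
  qed
qed

lemma limitin_B:
  assumes f: "limitin L1 f x F" and g: "limitin L1 g y F"
  shows "limitin L1 (\<lambda>t. B (f t) (g t)) (B x y) F"
proof (rule limitin_L1I)
  note xy = limitin_L1D(1)[OF f] limitin_L1D(1)[OF g]
  show "B x y \<in> L1S" using xy by (rule B_closed)
  show "\<forall>\<^sub>F t in F. B (f t) (g t) \<in> L1S"
    using limitin_L1D(2)[OF f] limitin_L1D(2)[OF g] by eventually_elim (rule B_closed)
  show "((\<lambda>t. nrm n (f t - x) * nrm n (g t) + nrm n x * nrm n (g t - y)) \<longlongrightarrow> 0) F" for n
    using tendsto_add[OF tendsto_mult[OF limitin_L1D(3)[OF f] tendsto_nrm[OF g]]
      tendsto_mult[OF tendsto_const limitin_L1D(3)[OF g]], of n n "nrm n x" n] by simp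
  show "\<forall>\<^sub>F t in F. nrm n (B (f t) (g t) - B x y) \<le>
      nrm n (f t - x) * nrm n (g t) + nrm n x * nrm n (g t - y)" for n
    using limitin_L1D(2)[OF f] limitin_L1D(2)[OF g]
  proof eventually_elim
    case (elim t)
    then have L1: "f t - x \<in> L1S" "g t - y \<in> L1S"
      using xy by (auto intro: L1S_intros)
    have "B (f t) (g t) - B x y = B (f t - x) (g t) + B x (g t - y)"
      using elim xy by (simp add: B_diff_left B_diff_right)
    then show ?case
      using nrm_simps(1)[OF B_closed[OF L1(1)] B_closed[OF xy(1) L1(2)], of "g t" n]
        nrm_B_le[OF L1(1), of "g t" n] nrm_B_le[OF xy(1) L1(2), of n] elim
      by auto
  qed
qed

lemma limitin_R:
  assumes f: "limitin L1 f x F" and g: "limitin L1 g s F"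
  shows "limitin L1 (\<lambda>t. R (f t) (g t)) (R x s) F"
proof (rule limitin_L1I)
  note xs = limitin_L1D(1)[OF f] limitin_L1D(1)[OF g]
  show r: "R x s \<in> L1S" using xs by (rule R_closed)
  show "\<forall>\<^sub>F t in F. R (f t) (g t) \<in> L1S"
    using limitin_L1D(2)[OF f] limitin_L1D(2)[OF g] by eventually_elim (rule R_closed)
  \<comment> \<open>Room of 1 above \<open>nrm n x\<close> makes one Gronwall constant valid for all
    \<open>f t\<close> close to \<open>x\<close>.\<close>
  define N where "N n = nat \<lceil>2 * (nrm n x + 1)\<rceil>" for n
  have N: "2 * (nrm n x + 1) \<le> real (N n)" for n
    unfolding N_def by (rule real_nat_ceiling_ge)
  show "((\<lambda>t. 2 ^ N n * (nrm n (g t - s) + nrm n (R x s) * nrm n (f t - x))) \<longlongrightarrow> 0) F" for n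
    using tendsto_mult[OF tendsto_const tendsto_add[OF limitin_L1D(3)[OF g]
      tendsto_mult[OF tendsto_const limitin_L1D(3)[OF f]]], of "2 ^ N n" n "nrm n (R x s)" n] by simp
  fix n
  have "\<forall>\<^sub>F t in F. nrm n (f t) < nrm n x + 1"
    using tendsto_nrm[OF f] by (rule order_tendstoD(2)) simp
  then show "\<forall>\<^sub>F t in F. nrm n (R (f t) (g t) - R x s) \<le>
      2 ^ N n * (nrm n (g t - s) + nrm n (R x s) * nrm n (f t - x))"
    using limitin_L1D(2)[OF f] limitin_L1D(2)[OF g]
  proof eventually_elim
    case (elim t)
    let ?s = "(g t - s) + B (R x s) (f t - x)"
    have L1: "g t - s \<in> L1S" "f t - x \<in> L1S" "B (R x s) (f t - x) \<in> L1S" "?s \<in> L1S"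
      using elim xs r by (auto intro!: L1S_intros B_closed)
    have "nrm n (R (f t) ?s) \<le> 2 ^ N n * nrm n ?s"
      using elim N[of n] L1 R_eq[of "f t" ?s] by (intro nrm_le_if_linear_equation[of _ "f t"] R_closed) auto
    also have "\<dots> \<le> 2 ^ N n * (nrm n (g t - s) + nrm n (R x s) * nrm n (f t - x))"
      using nrm_simps(1)[OF L1(1,3), of n] nrm_B_le[OF r L1(2), of n] by (intro mult_left_mono) auto
    finally show ?case
      using R_diff[of x "f t" s "g t"] xs elim by simp
  qed
qed

lemma limitin_L1_line:
  assumes "x \<in> L1S" "y \<in> L1S"
  shows "limitin L1 (\<lambda>t::real. x + t *\<^sub>R y) x (at 0)"
proof (rule limitin_L1I[where g = "\<lambda>n t. \<bar>t\<bar> * nrm n y"])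
  show "\<forall>\<^sub>F t::real in at 0. x + t *\<^sub>R y \<in> L1S"
    by (intro always_eventually allI L1S_intros assms)
  show "((\<lambda>t. \<bar>t\<bar> * nrm n y) \<longlongrightarrow> 0) (at 0)" for n
    by (intro tendsto_mult_left_zero tendsto_rabs_zero tendsto_ident_at)
qed (use assms nrm_simps(2) in auto)

end


section \<open>Smoothness of the solution operator\<close>

context m_convex_seminorms
begin

text \<open>
  Volterra series in several variables: a class of maps that contains the resolvent and is
  stable under directional derivatives.
\<close>

inductive volterra :: "nat \<Rightarrow> ((nat \<Rightarrow> 'a ae_fun) \<Rightarrow> 'a ae_fun) \<Rightarrow> bool" where
  proj: "i < n \<Longrightarrow> volterra n (\<lambda>z. z i)"
| add: "volterra n f \<Longrightarrow> volterra n g \<Longrightarrow> volterra n (\<lambda>z. f z + g z)"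
| B: "volterra n f \<Longrightarrow> i < n \<Longrightarrow> volterra n (\<lambda>z. B (f z) (z i))"
| R: "volterra n f \<Longrightarrow> 0 < n \<Longrightarrow> volterra n (\<lambda>z. R (z 0) (f z))"

lemma power_top_L1D: "z \<in> topspace (power_top n L1) \<Longrightarrow> i < n \<Longrightarrow> z i \<in> L1S"
  by (auto simp: topspace_power_top)

lemma volterra_closed: "volterra n f \<Longrightarrow> z \<in> topspace (power_top n L1) \<Longrightarrow> f z \<in> L1S"
  by (induction rule: volterra.induct) (blast intro: L1S_intros B_closed R_closed power_top_L1D)+

lemma volterra_first_half: "volterra n f \<Longrightarrow> volterra (2 * n) (\<lambda>z. f (first_half n z))"
proof (induction rule: volterra.induct)
  case (proj i n)
  then have "(\<lambda>z. first_half n z i) = (\<lambda>z. z i :: 'a ae_fun)" by (auto simp: first_half_def)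
  then show ?case using proj by (simp add: volterra.proj)
next
  case (B n f i)
  then have "(\<lambda>z. B (f (first_half n z)) (first_half n z i)) = (\<lambda>z. B (f (first_half n z)) (z i))"
    by (auto simp: first_half_def)
  then show ?case using B by (simp add: volterra.B)
next
  case (R n f)
  then have "(\<lambda>z. R (first_half n z 0) (f (first_half n z))) = (\<lambda>z. R (z 0) (f (first_half n z)))"
    by (auto simp: first_half_def)
  then show ?case using R by (simp add: volterra.R)
qed (rule volterra.add)

lemma continuous_map_volterra:
  "volterra n f \<Longrightarrow> continuous_map (power_top n L1) L1 f"
proof (induction rule: volterra.induct)
  case (proj i n)
  then show ?case by (rule continuous_map_power_top_proj)
next
  case (add n f g)
  then show ?case unfolding continuous_map_atin by (blast intro: limitin_L1_add)
next
  case (B n f i)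
  then show ?case
    using continuous_map_power_top_proj[OF B.hyps(2), of L1] unfolding continuous_map_atin
    by (intro ballI limitin_B) auto
next
  case (R n f)
  then show ?case
    using continuous_map_power_top_proj[OF R.hyps(2), of L1] unfolding continuous_map_atin
    by (intro ballI limitin_R) auto
qed

lemma line_in_topspace:
  assumes "x \<in> topspace (power_top n L1)" "y \<in> topspace (power_top n L1)"
  shows "x + t *\<^sub>R y \<in> topspace (power_top n L1)"
  using assms unfolding topspace_power_top
  by (auto simp only: mem_Collect_eq topspace_L1 plus_fun_apply scaleR_fun_def scaleR_zero_right add_0
      intro!: L1S_intros)

text \<open>The difference quotients are exactly values of \<open>B\<close> and \<open>R\<close> at
  convergent arguments: for \<open>B\<close> by bilinearity, for \<open>R\<close> by
  \<open>R_diff\<close> and homogeneity in the second argument. Joint continuity then gives the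
  limits.\<close>

lemma volterra_derivative_on:
  assumes "volterra n f"
  shows "\<exists>f'. volterra (2 * n) f' \<and> derivative_on L1 L1 n (topspace (power_top n L1)) f f'"
  using assms
proof (induction rule: volterra.induct)
  case (proj i n)
  have "has_directional_derivative L1 (\<lambda>z. z i) x y (y i)"
    if "x \<in> topspace (power_top n L1)" "y \<in> topspace (power_top n L1)" for x y :: "nat \<Rightarrow> 'a ae_fun"
  proof -
    have "\<forall>\<^sub>F t in at 0. y i = ((x + t *\<^sub>R y) i - x i) /\<^sub>R t"
      unfolding eventually_at by (auto simp: scaleR_fun_def intro: exI[of _ 1])
    then show ?thesis
      unfolding has_directional_derivative_def
      by (rule limitin_transform_eventually) (use power_top_L1D[OF that(2) proj] in simp)
  qed
  then show ?case
    using proj by (intro exI[of _ "\<lambda>z. z (n + i)"]) (auto simp: derivative_on_def intro: volterra.proj)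
next
  case (add n f g)
  then obtain f' g' where *: "volterra (2 * n) f'" "volterra (2 * n) g'"
    "derivative_on L1 L1 n (topspace (power_top n L1)) f f'"
    "derivative_on L1 L1 n (topspace (power_top n L1)) g g'"
    by blast
  have "derivative_on L1 L1 n (topspace (power_top n L1)) (\<lambda>z. f z + g z) (\<lambda>z. f' z + g' z)"
    unfolding derivative_on_def
  proof (intro ballI)
    fix x y assume "x \<in> topspace (power_top n L1)" "y \<in> topspace (power_top n L1)"
    then show "has_directional_derivative L1 (\<lambda>z. f z + g z) x y
        (f' (concat_halves n x y) + g' (concat_halves n x y))"
      using limitin_L1_add[OF *(3,4)[unfolded derivative_on_def has_directional_derivative_def, rule_format], of x y x y]
      by (simp add: has_directional_derivative_def algebra_simps)
  qed
  then show ?case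
    using *(1,2) by (blast intro: volterra.add)
next
  case (B n f i)
  then obtain f' where f': "volterra (2 * n) f'"
    "\<And>x y. x \<in> topspace (power_top n L1) \<Longrightarrow> y \<in> topspace (power_top n L1) \<Longrightarrow>
      has_directional_derivative L1 f x y (f' (concat_halves n x y))"
    unfolding derivative_on_def by blast
  have "has_directional_derivative L1 (\<lambda>z. B (f z) (z i)) x y
      (B (f' (concat_halves n x y)) (x i) + B (f x) (y i))"
    if xy: "x \<in> topspace (power_top n L1)" "y \<in> topspace (power_top n L1)" for x y
  proof -
    note L1 = power_top_L1D[OF xy(1) B.hyps(2)] power_top_L1D[OF xy(2) B.hyps(2)]
      volterra_closed[OF B.hyps(1) xy(1)]
    have "limitin L1 (\<lambda>t. B ((f (x + t *\<^sub>R y) - f x) /\<^sub>R t) (x i + t *\<^sub>R y i) + B (f x) (y i))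
        (B (f' (concat_halves n x y)) (x i) + B (f x) (y i)) (at 0)"
      using f'(2)[OF xy] L1
      by (intro limitin_L1_add limitin_B limitin_L1_line)
         (auto simp: has_directional_derivative_def B_closed)
    moreover have "\<forall>\<^sub>F t in at 0. B ((f (x + t *\<^sub>R y) - f x) /\<^sub>R t) (x i + t *\<^sub>R y i) + B (f x) (y i) =
        (B (f (x + t *\<^sub>R y)) ((x + t *\<^sub>R y) i) - B (f x) (x i)) /\<^sub>R t"
      using eventually_neq_at_within[of 0 0 UNIV]
    proof eventually_elim
      case (elim t)
      have L1': "f (x + t *\<^sub>R y) \<in> L1S" "x i + t *\<^sub>R y i \<in> L1S" "t *\<^sub>R y i \<in> L1S"
        using volterra_closed[OF B.hyps(1) line_in_topspace[OF xy]] L1 by (auto intro: L1S_intros)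
      have "B ((f (x + t *\<^sub>R y) - f x) /\<^sub>R t) (x i + t *\<^sub>R y i) =
          (B (f (x + t *\<^sub>R y)) (x i + t *\<^sub>R y i) - B (f x) (x i + t *\<^sub>R y i)) /\<^sub>R t"
        using L1 L1' by (simp only: B_scaleR_left B_diff_left L1S_intros)
      moreover have "B (f x) (x i + t *\<^sub>R y i) = B (f x) (x i) + t *\<^sub>R B (f x) (y i)"
        using L1 L1' by (simp only: B_add_right B_scaleR_right)
      ultimately show ?case
        using elim by (simp add: scaleR_fun_def algebra_simps)
    qed
    ultimately show ?thesis
      unfolding has_directional_derivative_def by (rule limitin_transform_eventually[rotated])
  qed
  moreover have "volterra (2 * n) (\<lambda>z. B (f' z) (z i) + B (f (first_half n z)) (z (n + i)))"
    using B.hyps f' by (intro volterra.intros volterra_first_half) auto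
  ultimately show ?case
    using B.hyps
    by (intro exI[of _ "\<lambda>z. B (f' z) (z i) + B (f (first_half n z)) (z (n + i))"])
       (auto simp: derivative_on_def first_half_concat_halves)
next
  case (R n f)
  then obtain f' where f': "volterra (2 * n) f'"
    "\<And>x y. x \<in> topspace (power_top n L1) \<Longrightarrow> y \<in> topspace (power_top n L1) \<Longrightarrow>
      has_directional_derivative L1 f x y (f' (concat_halves n x y))"
    unfolding derivative_on_def by blast
  have "has_directional_derivative L1 (\<lambda>z. R (z 0) (f z)) x y
      (R (x 0) (f' (concat_halves n x y) + B (R (x 0) (f x)) (y 0)))"
    if xy: "x \<in> topspace (power_top n L1)" "y \<in> topspace (power_top n L1)" for x y
  proof -
    note L1 = power_top_L1D[OF xy(1) R.hyps(2)] power_top_L1D[OF xy(2) R.hyps(2)]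
      volterra_closed[OF R.hyps(1) xy(1)]
    have BR: "B (R (x 0) (f x)) (y 0) \<in> L1S"
      using L1 by (intro B_closed R_closed)
    have "limitin L1 (\<lambda>t. R (x 0 + t *\<^sub>R y 0) ((f (x + t *\<^sub>R y) - f x) /\<^sub>R t + B (R (x 0) (f x)) (y 0)))
        (R (x 0) (f' (concat_halves n x y) + B (R (x 0) (f x)) (y 0))) (at 0)"
      using f'(2)[OF xy] L1 BR
      by (intro limitin_R limitin_L1_add limitin_L1_line) (auto simp: has_directional_derivative_def)
    moreover have "\<forall>\<^sub>F t in at 0. R (x 0 + t *\<^sub>R y 0) ((f (x + t *\<^sub>R y) - f x) /\<^sub>R t + B (R (x 0) (f x)) (y 0)) =
        (R ((x + t *\<^sub>R y) 0) (f (x + t *\<^sub>R y)) - R (x 0) (f x)) /\<^sub>R t"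
      using eventually_neq_at_within[of 0 0 UNIV]
    proof eventually_elim
      case (elim t)
      have L1': "f (x + t *\<^sub>R y) \<in> L1S" "x 0 + t *\<^sub>R y 0 \<in> L1S" "t *\<^sub>R y 0 \<in> L1S"
        using volterra_closed[OF R.hyps(1) line_in_topspace[OF xy]] L1 by (auto intro: L1S_intros)
      let ?s = "f (x + t *\<^sub>R y) - f x + t *\<^sub>R B (R (x 0) (f x)) (y 0)"
      have s: "?s \<in> L1S" using L1 L1' BR by (intro L1S_intros)
      have "R (x 0 + t *\<^sub>R y 0) (f (x + t *\<^sub>R y)) - R (x 0) (f x) = R (x 0 + t *\<^sub>R y 0) ?s"
        using R_diff[OF L1(1) L1'(2) L1(3) L1'(1)] B_scaleR_right[OF R_closed[OF L1(1,3)] L1(2)] by simp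
      moreover have "R (x 0 + t *\<^sub>R y 0) (?s /\<^sub>R t) = R (x 0 + t *\<^sub>R y 0) ?s /\<^sub>R t"
        by (rule R_scaleR[OF L1'(2) s])
      ultimately show ?case
        using elim by (simp add: scaleR_fun_def scaleR_add_right)
    qed
    ultimately show ?thesis
      unfolding has_directional_derivative_def by (rule limitin_transform_eventually[rotated])
  qed
  moreover have "volterra (2 * n) (\<lambda>z. R (z 0) (f' z + B (R (z 0) (f (first_half n z))) (z n)))"
    using R.hyps f' by (intro volterra.intros volterra_first_half) auto
  ultimately show ?case
    using R.hyps
    by (intro exI[of _ "\<lambda>z. R (z 0) (f' z + B (R (z 0) (f (first_half n z))) (z n))"])
       (auto simp: derivative_on_def first_half_concat_halves)
qed

section \<open>Absolutely continuous functions as pairs of initial value and derivative\<close>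

definition ac_path :: "'a \<Rightarrow> 'a ae_fun \<Rightarrow> real \<Rightarrow> 'a" where
  "ac_path c x = zero_extend 0 1 (\<lambda>t. c + prim (repr x) t)"

lemma is_primitive_iff:
  assumes "\<gamma> \<in> L1F"
  shows "is_primitive 0 1 \<gamma> \<eta> \<longleftrightarrow> (\<forall>t\<in>{0..1}. \<eta> t = \<eta> 0 + prim \<gamma> t)"
proof
  assume "is_primitive 0 1 \<gamma> \<eta>"
  then show "\<forall>t\<in>{0..1}. \<eta> t = \<eta> 0 + prim \<gamma> t"
    using prim_eqI unfolding is_primitive_def by (metis add_diff_cancel_left' diff_add_cancel add.commute)
next
  assume *: "\<forall>t\<in>{0..1}. \<eta> t = \<eta> 0 + prim \<gamma> t"
  have "has_weak_integral \<gamma> (\<eta> t - \<eta> 0) {0..t}" if "t \<in> {0..1}" for t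
  proof -
    have "\<eta> t - \<eta> 0 = prim \<gamma> t" using * that by (metis add_diff_cancel_left')
    then show ?thesis using has_weak_integral_prim[OF assms] by simp
  qed
  then show "is_primitive 0 1 \<gamma> \<eta>" by (simp add: is_primitive_def)
qed

text \<open>\<open>ac_path\<close> inverts the map that sends a function to its initial value and
  derivative. For the derivative this uses that a primitive determines its class.\<close>

lemma ac_path_in_AC:
  assumes "x \<in> L1S"
  shows "ac_path c x \<in> AC_functions 0 1" "is_primitive 0 1 (repr x) (ac_path c x)" "ac_path c x 0 = c"
    "AC_deriv 0 1 (ac_path c x) = x"
proof -
  note L1 = repr(1)[OF assms]
  show zero: "ac_path c x 0 = c"
    using L1 by (simp add: ac_path_def zero_extend_def)
  then show prim: "is_primitive 0 1 (repr x) (ac_path c x)"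
    unfolding is_primitive_iff[OF L1] by (simp add: ac_path_def zero_extend_def)
  then show "ac_path c x \<in> AC_functions 0 1"
    using L1 by (auto simp: AC_functions_def ac_path_def zero_extend_def)
  show "AC_deriv 0 1 (ac_path c x) = x"
    unfolding AC_deriv_def
  proof (rule the_equality)
    show "\<exists>\<gamma>\<in>L1F. x = ae_class \<gamma> \<and> is_primitive 0 1 \<gamma> (ac_path c x)"
      using L1 prim repr(2)[OF assms] by metis
    fix y assume "\<exists>\<gamma>\<in>L1F. y = ae_class \<gamma> \<and> is_primitive 0 1 \<gamma> (ac_path c x)"
    then obtain \<gamma> where \<gamma>: "\<gamma> \<in> L1F" "y = ae_class \<gamma>" "is_primitive 0 1 \<gamma> (ac_path c x)" by blast
    have "prim \<gamma> t = prim (repr x) t" if "t \<in> {0..1}" for t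
      using \<gamma>(3) prim that unfolding is_primitive_iff[OF \<gamma>(1)] is_primitive_iff[OF L1] by (metis add_left_cancel)
    then have "ae_class \<gamma> = ae_class (repr x)"
      unfolding ae_class_eq_iff by (rule prim_inj_AE[OF \<gamma>(1) L1])
    then show "y = x" using \<gamma>(2) repr(2)[OF assms] by simp
  qed
qed

lemma AC_function_eq_ac_path:
  assumes "\<eta> \<in> AC_functions 0 1"
  obtains x where "x \<in> L1S" "\<eta> = ac_path (\<eta> 0) x"
proof -
  obtain \<gamma> where \<gamma>: "\<gamma> \<in> L1F" "is_primitive 0 1 \<gamma> \<eta>" and out: "\<And>t. t \<notin> {0..1} \<Longrightarrow> \<eta> t = 0"
    using assms by (auto simp: AC_functions_def)
  have "\<eta> = ac_path (\<eta> 0) (ae_class \<gamma>)"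
  proof
    fix t
    have "\<eta> t = \<eta> 0 + prim \<gamma> t" if "t \<in> {0..1}"
      using \<gamma>(2) that unfolding is_primitive_iff[OF \<gamma>(1)] by (rule bspec)
    then show "\<eta> t = ac_path (\<eta> 0) (ae_class \<gamma>) t"
      unfolding ac_path_def zero_extend_def prim_repr[OF \<gamma>(1)] using out[of t] by (simp only: split: if_split) blast
  qed
  then show ?thesis using \<gamma>(1) that by blast
qed

abbreviation AC :: "(real \<Rightarrow> 'a) topology" where "AC \<equiv> AC_space 0 1"

lemma continuous_map_ac_path: "continuous_map L1 AC (ac_path c)"
  unfolding AC_space_def
proof (rule continuous_map_pullback')
  have "continuous_map L1 (prod_topology euclidean L1) (\<lambda>x. (c, x))"
    by (simp add: continuous_map_paired)
  then show "continuous_map L1 (prod_topology euclidean L1) ((\<lambda>\<eta>. (\<eta> 0, AC_deriv 0 1 \<eta>)) \<circ> ac_path c)"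
    by (rule continuous_map_eq) (simp add: ac_path_in_AC)
  show "topspace L1 \<subseteq> ac_path c -` AC_functions 0 1"
    using ac_path_in_AC by auto
qed

text \<open>Initial value and derivative determine the function. Needed because directional
  derivatives with values in \<open>AC\<close> are definite descriptions, determined by uniqueness
  of limits.\<close>

lemma Hausdorff_AC: "Hausdorff_space AC"
proof (rule Hausdorff_space_injective_preimage)
  show "Hausdorff_space (prod_topology (euclidean :: 'a topology) L1)"
    by (simp add: Hausdorff_space_prod_topology Hausdorff_L1 Hausdorff_space_euclidean_t2)
  show "continuous_map AC (prod_topology euclidean L1) (\<lambda>\<eta>. (\<eta> 0, AC_deriv 0 1 \<eta>))"
    unfolding AC_space_def using continuous_map_pullback[OF continuous_map_id] by (simp add: id_def o_def)
  show "inj_on (\<lambda>\<eta>. (\<eta> 0, AC_deriv 0 1 \<eta>)) (topspace AC)"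
  proof (rule inj_onI)
    fix \<eta> \<zeta> assume "\<eta> \<in> topspace AC" "\<zeta> \<in> topspace AC" and eq: "(\<eta> 0, AC_deriv 0 1 \<eta>) = (\<zeta> 0, AC_deriv 0 1 \<zeta>)"
    then have "\<eta> \<in> AC_functions 0 1" "\<zeta> \<in> AC_functions 0 1"
      by (auto simp: AC_space_def topspace_pullback_topology)
    then show "\<eta> = \<zeta>"
      using eq AC_function_eq_ac_path[of \<eta>] AC_function_eq_ac_path[of \<zeta>] ac_path_in_AC(4) by (metis prod.inject)
  qed
qed

text \<open>The initial values cancel, so derivatives start at 0 whatever \<open>c\<close>
  is.\<close>

lemma ac_path_diff_scaleR:
  assumes "x \<in> L1S" "y \<in> L1S"
  shows "(ac_path c x - ac_path c y) /\<^sub>R t = ac_path 0 ((x - y) /\<^sub>R t)"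
proof -
  obtain \<gamma> \<sigma> where L1: "\<gamma> \<in> L1F" "\<sigma> \<in> L1F" "x = ae_class \<gamma>" "y = ae_class \<sigma>"
    using assms by blast
  have "(x - y) /\<^sub>R t = ae_class (\<lambda>u. (\<gamma> u - \<sigma> u) /\<^sub>R t)"
    using L1 by (simp add: ae_class_simps)
  then show ?thesis
    using L1 prim_repr[OF L1_scaleR[OF L1_diff[OF L1(1,2)]]] prim_repr
    by (auto simp: ac_path_def zero_extend_def fun_eq_iff scaleR_fun_def prim_scaleR prim_diff L1_diff L1_scaleR)
qed

text \<open>\<open>ac_path c\<close> is affine and continuous, so composition with it keeps Volterra
  maps closed under derivation. The initial value is a parameter of the class because it is 1 for
  \<open>f\<close> and 0 for all derivatives.\<close>

theorem smooth_on_ac_path_resolvent: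
  assumes f: "\<And>x. x \<in> L1S \<Longrightarrow> f x = ac_path 1 (R x x)"
  shows "smooth_on L1 AC L1S f"
proof (rule smooth_on_coinduct[where C = "\<lambda>n h. \<exists>c g. volterra n g \<and> h = (\<lambda>z. ac_path c (g z))"])
  let ?C = "\<lambda>n h. \<exists>c g. volterra n g \<and> h = (\<lambda>z. ac_path c (g z))"
  have "volterra 1 (\<lambda>z. R (z 0) (z 0))"
    by (rule volterra.R[OF volterra.proj]) auto
  then show "?C 1 (\<lambda>z. ac_path 1 (R (z 0) (z 0)))" by blast
  fix n :: nat and h assume n: "0 < n" and "?C n h"
  then obtain c g where g: "volterra n g" and h: "h = (\<lambda>z. ac_path c (g z))" by blast
  show "continuous_map (subtopology (power_top n L1) {z \<in> topspace (power_top n L1). z 0 \<in> L1S}) AC h"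
    using continuous_map_compose[OF continuous_map_volterra[OF g] continuous_map_ac_path[of c]]
    by (auto simp: h o_def intro: continuous_map_from_subtopology)
  obtain g' where g': "volterra (2 * n) g'"
    "\<And>x y. x \<in> topspace (power_top n L1) \<Longrightarrow> y \<in> topspace (power_top n L1) \<Longrightarrow>
      has_directional_derivative L1 g x y (g' (concat_halves n x y))"
    using volterra_derivative_on[OF g] unfolding derivative_on_def by blast
  have deriv: "has_directional_derivative AC h x y (ac_path 0 (g' (concat_halves n x y)))"
    if xy: "x \<in> topspace (power_top n L1)" "y \<in> topspace (power_top n L1)" for x y
  proof -
    have "limitin AC (ac_path 0 \<circ> (\<lambda>t. (g (x + t *\<^sub>R y) - g x) /\<^sub>R t)) (ac_path 0 (g' (concat_halves n x y))) (at 0)"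
      using g'(2)[OF xy] unfolding has_directional_derivative_def
      by (rule continuous_map_limit[OF continuous_map_ac_path])
    moreover have "ac_path 0 ((g (x + t *\<^sub>R y) - g x) /\<^sub>R t) = (h (x + t *\<^sub>R y) - h x) /\<^sub>R t" for t
      using ac_path_diff_scaleR[OF volterra_closed[OF g line_in_topspace[OF xy]] volterra_closed[OF g xy(1)]]
      by (simp add: h)
    ultimately show ?thesis
      by (simp add: has_directional_derivative_def o_def)
  qed
  have C': "?C (2 * n) (\<lambda>z. ac_path 0 (g' z))" using g'(1) by blast
  show "\<exists>h'. ?C (2 * n) h' \<and>
      derivative_on L1 AC n {z \<in> topspace (power_top n L1). z 0 \<in> L1S} h h'"
    unfolding derivative_on_def
    by (intro exI[of _ "\<lambda>z. ac_path 0 (g' z)"] conjI ballI C' deriv) (simp_all only: mem_Collect_eq)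
next
  show "openin L1 L1S"
    using openin_topspace[of L1] by simp
  show "\<forall>\<^sub>F t in at 0. x + t *\<^sub>R y \<in> L1S" if "x \<in> L1S" "y \<in> topspace L1" for x y
    using that by (intro always_eventually allI L1S_intros) auto
qed (use f Hausdorff_AC subspace_L1S in auto)

end


section \<open>Regularity of the group of units\<close>

lemma seminorm_Max:
  assumes F: "finite F" "\<And>q. q \<in> F \<Longrightarrow> seminorm q"
  shows "seminorm (\<lambda>x. Max (insert 0 ((\<lambda>q. q x) ` F)))"
proof -
  \<comment> \<open>The element 0 covers the empty family and makes \<open>m\<close> visibly
    nonnegative.\<close>
  define m where "m x = Max (insert 0 ((\<lambda>q. q x) ` F))" for x
  have le_iff: "m x \<le> c \<longleftrightarrow> 0 \<le> c \<and> (\<forall>q\<in>F. q x \<le> c)" for x c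
    using F(1) by (simp add: m_def)
  have nonneg: "0 \<le> m x" and le: "q \<in> F \<Longrightarrow> q x \<le> m x" for q x
    using F(1) by (simp_all add: m_def)
  have scale_le: "m (c *\<^sub>R x) \<le> \<bar>c\<bar> * m x" for c x
    unfolding le_iff using nonneg le by (auto simp: seminormD(2)[OF F(2)] intro: mult_left_mono)
  have "m (c *\<^sub>R x) = \<bar>c\<bar> * m x" for c x
  proof (cases "c = 0")
    case True
    then show ?thesis using scale_le[of 0 x] nonneg[of 0] by simp
  next
    case False
    have "m ((1 / c) *\<^sub>R (c *\<^sub>R x)) \<le> \<bar>1 / c\<bar> * m (c *\<^sub>R x)" by (rule scale_le)
    then have "\<bar>c\<bar> * m x \<le> m (c *\<^sub>R x)"
      using False by (simp add: field_simps)
    then show ?thesis using scale_le[of c x] by simp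
  qed
  moreover have "m (x + y) \<le> m x + m y" for x y
    unfolding le_iff using nonneg le seminormD(1)[OF F(2)] by (meson add_mono add_nonneg_nonneg order_trans)
  ultimately show ?thesis
    unfolding seminorm_def m_def by blast
qed

lemma continuous_on_seminorm:
  fixes q :: "'e::locally_convex_space \<Rightarrow> real"
  assumes q: "seminorm q" and "\<And>a e. 0 < e \<Longrightarrow> open {x. q (x - a) < e}"
  shows "continuous_on UNIV q"
  unfolding continuous_on_def tendsto_iff
proof (intro ballI allI impI)
  fix a and e :: real assume e: "0 < e"
  have "a \<in> {x. q (x - a) < e}"
    using e by (simp add: seminormD(4)[OF q])
  then have "\<forall>\<^sub>F x in at a. x \<in> {x. q (x - a) < e}"
    by (intro eventually_at_in_open') (use assms(2)[OF e] in auto)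
  then show "\<forall>\<^sub>F x in at a within UNIV. dist (q x) (q a) < e"
    by eventually_elim (use seminormD(8)[OF q] in \<open>auto simp: dist_real_def intro: le_less_trans\<close>)
qed

lemma countable_nhds_base_at_0:
  assumes "metrizable_space (euclidean :: 'e::locally_convex_space topology)"
  obtains V :: "nat \<Rightarrow> 'e::locally_convex_space set" where "\<And>n. open (V n)" "\<And>n. 0 \<in> V n"
    "\<And>U. open U \<Longrightarrow> 0 \<in> U \<Longrightarrow> \<exists>n. V n \<subseteq> U"
proof -
  have "first_countable (euclidean :: 'e topology)"
    using assms by (rule metrizable_imp_first_countable)
  then obtain \<B> :: "'e set set" where \<B>: "countable \<B>" "\<And>V. V \<in> \<B> \<Longrightarrow> open V"
    "\<And>U. open U \<Longrightarrow> 0 \<in> U \<Longrightarrow> \<exists>V\<in>\<B>. 0 \<in> V \<and> V \<subseteq> U"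
    unfolding first_countable_def by (simp, metis)
  define \<C> where "\<C> = {V\<in>\<B>. 0 \<in> V}"
  have "countable \<C>" using \<B>(1) by (simp add: \<C>_def)
  moreover have "\<C> \<noteq> {}" using \<B>(3)[of UNIV] by (auto simp: \<C>_def)
  ultimately have range: "range (from_nat_into \<C>) = \<C>" by simp
  show ?thesis
  proof (rule that[of "from_nat_into \<C>"])
    show "open (from_nat_into \<C> n)" "0 \<in> from_nat_into \<C> n" for n
      using range \<B>(2) by (auto simp: \<C>_def set_eq_iff)
    show "\<exists>n. from_nat_into \<C> n \<subseteq> U" if "open U" "0 \<in> U" for U
      using \<B>(3)[OF that] range by (metis (mono_tags, lifting) \<C>_def mem_Collect_eq rangeE)
  qed
qed

text \<open>Metrizability gives a countable base at 0, each member of which contains a ball for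
  finitely many seminorms of the family. Their maxima remain submultiplicative, because each factor
  is nonnegative and at most the maximum.\<close>

lemma m_convex_seminorms_exist:
  assumes "locally_m_convex TYPE('a::continuous_inverse_algebra)" and frechet: "frechet_space TYPE('a::continuous_inverse_algebra)"
  obtains p :: "nat \<Rightarrow> 'a::continuous_inverse_algebra \<Rightarrow> real" where "m_convex_seminorms p"
proof -
  obtain Q :: "('a \<Rightarrow> real) set" where Q: "\<And>q. q \<in> Q \<Longrightarrow> seminorm q"
    "\<And>q x y. q \<in> Q \<Longrightarrow> q (x * y) \<le> q x * q y" and top: "euclidean = seminorm_topology UNIV Q"
    using assms(1) unfolding locally_m_convex_def by blast
  have open_iff: "open U \<longleftrightarrow> openin (seminorm_topology UNIV Q) U" for U
    by (simp add: top[symmetric])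
  obtain V :: "nat \<Rightarrow> 'a set" where V: "\<And>n. open (V n)" "\<And>n. 0 \<in> V n"
    "\<And>U. open U \<Longrightarrow> 0 \<in> U \<Longrightarrow> \<exists>n. V n \<subseteq> U"
    using countable_nhds_base_at_0 frechet unfolding frechet_space_def by metis
  have "\<forall>n. \<exists>F \<epsilon>. finite F \<and> F \<subseteq> Q \<and> 0 < \<epsilon> \<and> {y. \<forall>q\<in>F. q y < \<epsilon>} \<subseteq> V n"
    using V(1,2) unfolding open_iff openin_seminorm_topology by fastforce
  from choice[OF this] obtain F where
    "\<forall>n. \<exists>\<epsilon>. finite (F n) \<and> F n \<subseteq> Q \<and> 0 < \<epsilon> \<and> {y. \<forall>q\<in>F n. q y < \<epsilon>} \<subseteq> V n"
    by blast
  from choice[OF this] obtain \<epsilon> where F: "\<And>n. finite (F n)" "\<And>n. F n \<subseteq> Q" "\<And>n. 0 < \<epsilon> n"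
    "\<And>n. {y. \<forall>q\<in>F n. q y < \<epsilon> n} \<subseteq> V n"
    by blast
  \<comment> \<open>Accumulating the finite sets makes the maxima increase with
    \<open>n\<close>.\<close>
  define G where "G n = (\<Union>k\<le>n. F k)" for n
  have G: "finite (G n)" "G n \<subseteq> Q" for n
    using F by (auto simp: G_def)
  define p where "p n x = Max (insert 0 ((\<lambda>q. q x) ` G n))" for n x
  have le: "0 \<le> p n x" "q \<in> G n \<Longrightarrow> q x \<le> p n x" for q n x
    using G(1) by (simp_all add: p_def)
  have less_iff: "p n x < e \<longleftrightarrow> 0 < e \<and> (\<forall>q\<in>G n. q x < e)" for n x e
    using G(1) by (simp add: p_def)
  have p: "seminorm (p n)" for n
    unfolding p_def using G Q(1) by (intro seminorm_Max) auto
  have base: "\<exists>n. \<exists>e>0. \<forall>x. p n x < e \<longrightarrow> x \<in> U" if U: "open U" "0 \<in> U" for U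
  proof -
    obtain n where n: "V n \<subseteq> U" using V(3)[OF U] by blast
    have "x \<in> U" if "p n x < \<epsilon> n" for x
      using that F(4)[of n] n unfolding less_iff by (auto simp: G_def)
    then show ?thesis using F(3) by blast
  qed
  show ?thesis
  proof (rule that, unfold_locales)
    fix n
    show "seminorm (p n)" by (rule p)
    show "continuous_on UNIV (p n)"
    proof (rule continuous_on_seminorm[OF p])
      fix a and e :: real assume e: "0 < e"
      have "open {x. q (x - a) < e}" if "q \<in> G n" for q
      proof -
        have "q \<in> Q" using G(2) that by blast
        then show ?thesis
          using openin_seminorm_ball[OF subspace_UNIV _ seminorm_imp_on[OF Q(1)], of q Q a e]
          unfolding open_iff by simp
      qed
      moreover have "{x. p n (x - a) < e} = (\<Inter>q\<in>G n. {x. q (x - a) < e})"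
        using e by (auto simp: less_iff)
      ultimately show "open {x. p n (x - a) < e}"
        using G(1) by (simp add: open_INT)
    qed
    show "p n (x * y) \<le> p n x * p n y" for x y
    proof -
      have "q (x * y) \<le> p n x * p n y" if "q \<in> G n" for q
      proof -
        have "q \<in> Q" using G(2) that by blast
        then have "q (x * y) \<le> q x * q y" by (rule Q(2))
        also have "\<dots> \<le> p n x * p n y"
          using le that seminormD(5)[OF Q(1)[OF \<open>q \<in> Q\<close>]] by (intro mult_mono) auto
        finally show ?thesis .
      qed
      then show ?thesis
        unfolding p_def[of n "x * y"] using G(1) le(1) by simp
    qed
    show "p m x \<le> p n x" if "m \<le> n" for m x
    proof -
      have "G m \<subseteq> G n"
        using that unfolding G_def by (intro UN_mono) auto
      then show ?thesis
        unfolding p_def using G(1) by (intro Max_mono insert_mono image_mono) auto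
    qed
  next
    show "\<exists>n. \<exists>e>0. \<forall>x. p n x < e \<longrightarrow> x \<in> U" if "open U" "0 \<in> U" for U
      using base that .
  next
    fix X :: "nat \<Rightarrow> 'a"
    assume X: "\<And>n e. 0 < e \<Longrightarrow> \<exists>N. \<forall>i\<ge>N. \<forall>j\<ge>N. p n (X i - X j) < e"
    \<comment> \<open>Every neighbourhood of 0 contains a ball of some \<open>p n\<close>, so a
      sequence that is Cauchy for the seminorms is Cauchy for the topology.\<close>
    have "\<exists>N. \<forall>m\<ge>N. \<forall>n\<ge>N. X m - X n \<in> U" if "open U \<and> 0 \<in> U" for U
      using base[of U] that X by meson
    then show "convergent X"
      using frechet unfolding frechet_space_def by blast
  qed
qed

context m_convex_seminorms
begin

section \<open>The evolution map in the global charts\<close>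

definition Evol :: "'a ae_fun \<Rightarrow> real \<Rightarrow> 'a" where
  "Evol x = (\<lambda>t\<in>{0..1}. evolution (repr x) t)"

lemma zero_extend_Evol:
  assumes "x \<in> L1S"
  shows "zero_extend 0 1 (Evol x) = ac_path 1 (R x x)"
  using prim_repr[OF resolvent(1)[OF repr(1)[OF assms] repr(1)[OF assms]]]
  by (auto simp: fun_eq_iff zero_extend_def Evol_def ac_path_def evolution_def R_def)

lemma AC_pathsI:
  assumes \<eta>: "\<eta> \<in> extensional {0..1}" "\<And>t. t \<in> {0..1} \<Longrightarrow> \<eta> t \<in> Units mult_monoid"
    and x: "x \<in> L1S" "zero_extend 0 1 \<eta> = ac_path c x"
  shows "\<eta> \<in> AC_paths (unit_group :: ('a, 'a) group_atlas)"
proof -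
  let ?U = "Units (mult_monoid :: 'a monoid)"
  have eq: "\<eta> t = c + prim (repr x) t" if "t \<in> {0..1}" for t
    using fun_cong[OF x(2), of t] that by (simp add: zero_extend_def ac_path_def)
  have "continuous_on {0..1} (\<lambda>t. c + prim (repr x) t)"
    using continuous_on_prim[OF repr(1)[OF x(1)]] by (auto simp: continuous_on_def intro: tendsto_intros)
  then have "continuous_on {0..1} \<eta>"
    by (rule continuous_on_eq) (simp add: eq)
  then have "continuous_map (top_of_set {0..1}) (atlas_topology euclidean ?U {(?U, \<lambda>x. x)}) \<eta>"
    using \<eta>(2) open_Units
    by (subst atlas_topology_single_chart) (auto simp: continuous_map_in_subtopology)
  \<comment> \<open>The subdivision has one piece and \<open>\<tau> = real\<close>, whence the form
    of the endpoints.\<close>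
  moreover have "zero_extend (real 0) (real (Suc 0)) \<eta> \<in> AC_functions (real 0) (real (Suc 0))"
    using x ac_path_in_AC(1)[OF x(1)] by simp
  then have "\<exists>n \<tau>. \<tau> 0 = 0 \<and> \<tau> n = 1 \<and> (\<forall>j<n. \<tau> j < \<tau> (Suc j) \<and>
      (\<exists>(U, \<phi>) \<in> lie_charts euclidean (unit_group :: ('a, 'a) group_atlas). \<eta> ` {\<tau> j..\<tau> (Suc j)} \<subseteq> U \<and>
        zero_extend (\<tau> j) (\<tau> (Suc j)) (\<lambda>t. \<phi> (\<eta> t)) \<in> AC_functions (\<tau> j) (\<tau> (Suc j))))"
    using \<eta>(2) unit_group_chart
    by (intro exI[of _ "1 :: nat"] exI[of _ real]) (auto intro!: bexI[of _ "(?U, \<lambda>x. x)"])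
  ultimately show ?thesis
    using \<eta>(1) unfolding AC_paths_def by simp
qed

lemma Evol_in_Units: "x \<in> L1S \<Longrightarrow> t \<in> {0..1} \<Longrightarrow> Evol x t \<in> Units mult_monoid"
  by (simp add: Evol_def evolution_in_Units repr)

lemma Evol_in_AC_paths: "x \<in> L1S \<Longrightarrow> Evol x \<in> AC_paths unit_group"
  by (rule AC_pathsI[OF _ Evol_in_Units R_closed zero_extend_Evol]) (auto simp: Evol_def)

lemma one_in_AC_paths: "(\<lambda>t\<in>{0..1}. 1) \<in> AC_paths (unit_group :: ('a, 'a) group_atlas)"
proof (rule AC_pathsI)
  show "zero_extend 0 1 (\<lambda>t\<in>{0..1}. 1) = ac_path 1 (0 :: 'a ae_fun)"
    using prim_repr[OF L1_zero] by (auto simp: fun_eq_iff zero_extend_def ac_path_def ae_class_simps)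
qed (use mult_monoid.Units_one_closed L1S_intros(4) in auto)

lemma Evol_has_derivative:
  assumes \<gamma>: "\<gamma> \<in> L1F"
  shows "AE t in lborel. t \<in> {0..1} \<longrightarrow>
    has_left_derivative unit_group (Units mult_monoid, \<lambda>x. x) (Evol (ae_class \<gamma>)) t (\<gamma> t)"
proof -
  let ?U = "Units (mult_monoid :: 'a monoid)"
  define g where "g = repr (ae_class \<gamma>)"
  have g: "g \<in> L1F" "AE t in lborel. g t = \<gamma> t"
    using repr(1) repr_AE \<gamma> by (auto simp: g_def)
  show ?thesis
    using prim_has_derivative_AE[OF resolvent(1)[OF g(1) g(1)]] g(2)
  proof eventually_elim
    case (elim t)
    show ?case
    proof
      assume t: "t \<in> {0..1}"
      have Evol: "Evol (ae_class \<gamma>) s = 1 + prim (resolvent g g) s" if "s \<in> {0..1}" for s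
        using that by (simp add: Evol_def evolution_def g_def)
      let ?a = "Evol (ae_class \<gamma>) t"
      \<comment> \<open>The equation holds for the representative \<open>g\<close>, which agrees
        with \<open>\<gamma>\<close> at this \<open>t\<close>.\<close>
      have res: "resolvent g g t = ?a * \<gamma> t"
        using resolvent_eq_evolution[OF g(1), of t] elim(2) t by (simp add: Evol_def g_def)
      have "((\<lambda>s. (Evol (ae_class \<gamma>) s - ?a) /\<^sub>R (s - t)) \<longlongrightarrow> ?a * \<gamma> t) (at t within {0..1})"
        using elim(1)[rule_format, OF t] unfolding res
        by (rule Lim_transform_eventually) (auto simp: eventually_at_filter Evol Evol[OF t])
      \<comment> \<open>In the global chart, left translation by \<open>?a\<close> is linear. The
        inverse of the chart is the identity only on units, but the line through 1 stays in this
        open set for small parameters.\<close>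
      moreover have "dir_deriv euclidean (\<lambda>y. ?a \<otimes>\<^bsub>unit_group\<^esub> inv_into ?U (\<lambda>x. x) y) \<one>\<^bsub>unit_group\<^esub> (\<gamma> t) = ?a * \<gamma> t"
      proof (rule dir_deriv_eq[OF Hausdorff_space_euclidean_t2])
        have inv: "inv_into ?U (\<lambda>x. x) y = y" if "y \<in> ?U" for y
          using that by (intro inv_into_f_eq) (auto simp: inj_on_def)
        have one: "(1 :: 'a) \<in> ?U"
          using mult_monoid.Units_one_closed by simp
        have "\<forall>\<^sub>F s in at 0. ?a * \<gamma> t =
            (?a * inv_into ?U (\<lambda>x. x) (1 + s *\<^sub>R \<gamma> t) - ?a * inv_into ?U (\<lambda>x. x) 1) /\<^sub>R s"
          using openin_imp_eventually_line[OF open_Units one, of "\<gamma> t"] eventually_neq_at_within[of 0 0 UNIV]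
          by eventually_elim (simp add: inv one algebra_simps)
        then show "has_directional_derivative euclidean (\<lambda>y. ?a \<otimes>\<^bsub>unit_group\<^esub> inv_into ?U (\<lambda>x. x) y)
            \<one>\<^bsub>unit_group\<^esub> (\<gamma> t) (?a * \<gamma> t)"
          unfolding has_directional_derivative_def limitin_canonical_iff mult_unit_group one_unit_group
          by (rule Lim_transform_eventually[OF tendsto_const])
      qed
      ultimately show "has_left_derivative unit_group (?U, \<lambda>x. x) (Evol (ae_class \<gamma>)) t (\<gamma> t)"
        unfolding has_left_derivative_def prod.case
        using unit_group_chart Evol_in_Units[OF imageI[OF \<gamma>] t]
        by (intro bexI[of _ "(?U, \<lambda>x. x)"]) auto
    qed
  qed
qed

text \<open>Take the chart at the constant path 1 that comes from the global chart of the units: the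
  translation is trivial and the condition on the image is always satisfied, so the domain is the
  whole group of paths.\<close>

lemma AC_group_global_chart:
  obtains \<psi> where "(AC_paths unit_group, \<psi>) \<in> atlas (AC_group (unit_group :: ('a, 'a) group_atlas))"
    "\<And>\<eta>. \<psi> \<eta> = zero_extend 0 1 \<eta>"
proof -
  let ?U = "Units (mult_monoid :: 'a monoid)" and ?G = "unit_group :: ('a, 'a) group_atlas"
  have one: "(1 :: 'a) \<in> ?U"
    using mult_monoid.Units_one_closed by simp
  have inv1: "inv\<^bsub>?G\<^esub> 1 = 1"
    using inv_unit_group[OF one] mult_monoid.inv_one by simp
  have inv_U: "m_inv ?G ` ?U = ?U"
  proof (intro subset_antisym subsetI)
    fix x assume "x \<in> m_inv ?G ` ?U"
    then show "x \<in> ?U" using mult_monoid.Units_inv_Units by (auto simp: inv_unit_group)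
  next
    fix x assume "x \<in> ?U"
    then show "x \<in> m_inv ?G ` ?U"
      by (intro image_eqI[of _ _ "m_inv mult_monoid x"]) (simp_all add: inv_unit_group)
  qed
  have in_U: "\<eta> t \<in> ?U" if "\<eta> \<in> AC_paths ?G" "t \<in> {0..1}" for \<eta> t
  proof -
    have "continuous_map (top_of_set {0..1}) (atlas_topology euclidean ?U {(?U, \<lambda>x. x)}) \<eta>"
      using that(1) by (simp add: AC_paths_def)
    then show ?thesis
      using that(2) open_Units
      by (subst (asm) atlas_topology_single_chart) (auto simp: continuous_map_in_subtopology)
  qed
  define \<xi> where "\<xi> = (\<lambda>t\<in>{0..1::real}. 1 :: 'a)"
  define \<psi> where "\<psi> = (\<lambda>\<eta>. zero_extend 0 1 (\<lambda>t. inv\<^bsub>?G\<^esub> \<xi> t \<otimes>\<^bsub>?G\<^esub> \<eta> t))"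
  have "{\<eta> \<in> AC_paths ?G. \<forall>t\<in>{0..1}. inv\<^bsub>?G\<^esub> \<xi> t \<otimes>\<^bsub>?G\<^esub> \<eta> t \<in> ?U} = AC_paths ?G"
    using in_U by (auto simp: \<xi>_def inv1)
  then have "(AC_paths ?G, \<psi>) \<in> atlas (AC_group ?G)"
    unfolding AC_group_def group_atlas.simps mem_Collect_eq
    using one_in_AC_paths unit_group_chart one inv_U
    by (intro exI[of _ \<xi>] exI[of _ ?U] exI[of _ "\<lambda>x. x"]) (simp add: \<psi>_def \<xi>_def)
  moreover have "\<psi> \<eta> = zero_extend 0 1 \<eta>" for \<eta>
    by (auto simp: \<psi>_def zero_extend_def fun_eq_iff \<xi>_def inv1)
  ultimately show ?thesis by (rule that)
qed

lemma smooth_map_Evol: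
  "smooth_map L1 {(topspace L1, \<lambda>x. x)} AC (atlas (AC_group (unit_group :: ('a, 'a) group_atlas))) Evol"
proof -
  obtain \<psi> where \<psi>: "(AC_paths unit_group, \<psi>) \<in> atlas (AC_group (unit_group :: ('a, 'a) group_atlas))"
    "\<And>\<eta>. \<psi> \<eta> = zero_extend 0 1 \<eta>"
    using AC_group_global_chart by metis
  show ?thesis
  proof (rule smooth_map_single_chart[OF \<psi>(1)])
    show "Evol ` topspace L1 \<subseteq> AC_paths unit_group"
      using Evol_in_AC_paths by auto
    show "smooth_on L1 AC (topspace L1) f'" if "\<And>x. x \<in> topspace L1 \<Longrightarrow> f' x = \<psi> (Evol x)" for f'
      unfolding topspace_L1 using that
      by (intro smooth_on_ac_path_resolvent) (simp add: \<psi>(2) zero_extend_Evol)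
  qed (rule openin_topspace)
qed

end

theorem proposition7p15:
  assumes "locally_m_convex TYPE('a::continuous_inverse_algebra)"
    and "frechet_space TYPE('a)"
  shows "L1_regular (unit_group :: ('a, 'a) group_atlas)"
proof -
  obtain p :: "nat \<Rightarrow> 'a \<Rightarrow> real" where "m_convex_seminorms p"
    using m_convex_seminorms_exist[OF assms] by blast
  then interpret m_convex_seminorms p .
  let ?U = "Units (mult_monoid :: 'a monoid)"
  have "Evol (ae_class \<gamma>) 0 = \<one>\<^bsub>unit_group\<^esub>" if "\<gamma> \<in> L1F" for \<gamma>
    using resolvent(1)[OF repr(1) repr(1)] that by (simp add: Evol_def evolution_def)
  then have "\<exists>Evol. (\<forall>\<gamma> \<in> L1F. Evol (ae_class \<gamma>) \<in> AC_paths unit_group \<and>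
      Evol (ae_class \<gamma>) 0 = \<one>\<^bsub>unit_group\<^esub> \<and>
      (AE t in lborel. t \<in> {0..1} \<longrightarrow>
        has_left_derivative unit_group (?U, \<lambda>x. x) (Evol (ae_class \<gamma>)) t (\<gamma> t))) \<and>
      smooth_map (L1_space 0 1) {(topspace (L1_space 0 1), \<lambda>x. x)} (AC_space 0 1)
        (atlas (AC_group (unit_group :: ('a, 'a) group_atlas))) Evol"
    using Evol_in_AC_paths Evol_has_derivative smooth_map_Evol by blast
  then show ?thesis
    unfolding L1_regular_def
    using assms(2) lie_group_unit_group unit_group_chart mult_monoid.Units_one_closed
    by (auto intro!: bexI[of _ "(?U, \<lambda>x. x)"])
qed

end
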